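(* Let $M$ be a $(2n+s)$-dimensional $S$-space-form of constant $f$-sectional curvature $c$. Then the scalar curvature of $M$ with respect to the Riemannian (Levi-Civita) connection $\nabla$ satisfies $$\tau=\frac{n(n-1)(c+3s)}{2}+n(c+2s).$$
   Context: A metric $f$-manifold is a $(2n+s)$-dimensional differentiable manifold $M$ ($n,s\geq 1$) with a $(1,1)$ tensor field $f$, vector fields $\xi_1,\dots,\xi_s$ (structure vector fields), 1-forms $\eta^1,\dots,\eta^s$ and a Riemannian metric $g$ such that $f^2=-I+\sum_{\alpha=1}^s\eta^\alpha\otimes\xi_\alpha$, $\eta^\alpha(\xi_\beta)=\delta_{\alpha\beta}$, $f\xi_\alpha=0$, $\eta^\alpha\circ f=0$, $g(fX,fY)=g(X,Y)-\sum_{\alpha=1}^s\eta^\alpha(X)\eta^\alpha(Y)$; moreover $\eta^\alpha(X)=g(X,\xi_\alpha)$ and $g(X,fY)=-g(fX,Y)$. The fundamental 2-form is $\Phi(X,Y)=g(X,fY)$. $M$ is an $S$-manifold if it is normal, i.e. $[f,f]+2\sum_{\alpha=1}^s d\eta^\alpha\otimes\xi_\alpha=0$ with $[f,f](X,Y)=f^2[X,Y]+[fX,fY]-f[fX,Y]-f[X,fY]$, and for every $1\leq\alpha\leq s$: $\eta^1\wedge\cdots\wedge\eta^s\wedge(d\eta^\alpha)^n\neq 0$ everywhere and $\Phi=d\eta^\alpha$. Convention: $d\eta(X,Y)=\frac12\left(X\eta(Y)-Y\eta(X)-\eta([X,Y])\right)$. For the Riemannian connection $\nabla$ with curvature $R(X,Y)Z=\nabla_X\nabla_YZ-\nabla_Y\nabla_XZ-\nabla_{[X,Y]}Z$,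 put $R(X,Y,Z,W)=g(R(X,Y)Z,W)$ and, for orthonormal $X,Y$, $K(X,Y)=R(X,Y,Y,X)$. $\mathcal{L}$ is the distribution orthogonal to the span of $\xi_1,\dots,\xi_s$. The $f$-sectional curvature is $K(X,fX)$ for unit $X\in\mathcal{L}$. An $S$-space-form is an $S$-manifold whose $f$-sectional curvature is constant. The scalar curvature is $\tau=\frac12\sum_{i,j=1}^{2n+s}K(e_i,e_j)$ for any local orthonormal frame $\{e_1,\dots,e_{2n+s}\}$, the terms with $i=j$ being zero. *)

theory Defs
  imports "HOL-Analysis.Analysis" "HOL-Combinatorics.Permutations"
begin

section \<open>Smooth maps between Euclidean spaces\<close>

text \<open>Meant for open \<open>S\<close> only.\<close>

primrec ck_on :: "nat \<Rightarrow> 'e::euclidean_space set \<Rightarrow> ('e \<Rightarrow> 'b::real_normed_vector) \<Rightarrow> bool" where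
  "ck_on 0 S h \<longleftrightarrow> continuous_on S h"
| "ck_on (Suc k) S h \<longleftrightarrow>
     (\<forall>x\<in>S. h differentiable (at x)) \<and> (\<forall>v. ck_on k S (\<lambda>x. frechet_derivative h (at x) v))"

definition smooth_on :: "'e::euclidean_space set \<Rightarrow> ('e \<Rightarrow> 'b::real_normed_vector) \<Rightarrow> bool" where
  "smooth_on S h \<longleftrightarrow> (\<forall>k. ck_on k S h)"

section \<open>Smooth manifolds\<close>

text \<open>
  The underlying space of the manifold is a whole type \<open>'a\<close>; Hausdorffness and second
  countability are imposed by type classes. A chart is a pair of its domain and its
  coordinate map (only the values on the domain matter), and the dimension of the manifold
  is \<open>DIM('e)\<close>.
\<close>

type_synonym ('a, 'e) chart = "'a set \<times> ('a \<Rightarrow> 'e)"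

definition smooth_atlas ::
  "('a::{t2_space,second_countable_topology}, 'e::euclidean_space) chart set \<Rightarrow> bool" where
  "smooth_atlas A \<longleftrightarrow>
     (\<Union>(U, \<phi>)\<in>A. U) = UNIV \<and>
     (\<forall>(U, \<phi>)\<in>A. open U \<and> open (\<phi> ` U) \<and> homeomorphism U (\<phi> ` U) \<phi> (inv_into U \<phi>)) \<and>
     (\<forall>(U, \<phi>)\<in>A. \<forall>(V, \<psi>)\<in>A. smooth_on (\<phi> ` (U \<inter> V)) (\<psi> \<circ> inv_into U \<phi>))"

definition smooth_fun ::
  "('a::topological_space, 'e::euclidean_space) chart set \<Rightarrow> 'a set \<Rightarrow> ('a \<Rightarrow> real) \<Rightarrow> bool" where
  "smooth_fun A W h \<longleftrightarrow>
     open W \<and> (\<forall>(U, \<phi>)\<in>A. smooth_on (\<phi> ` (U \<inter> W)) (h \<circ> inv_into U \<phi>))"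

definition smooth_near ::
  "('a::topological_space, 'e::euclidean_space) chart set \<Rightarrow> 'a \<Rightarrow> ('a \<Rightarrow> real) \<Rightarrow> bool" where
  "smooth_near A p h \<longleftrightarrow> (\<exists>W. p \<in> W \<and> smooth_fun A W h)"

section \<open>Tangent vectors\<close>

text \<open>
  Tangent vectors are derivations of germs of smooth functions. The type below consists of
  all functionals on functions; it is introduced only to make them a real vector space.
\<close>

typedef 'a tvec = "UNIV :: (('a \<Rightarrow> real) \<Rightarrow> real) set"
  morphisms act Tvec by simp

setup_lifting type_definition_tvec

instantiation tvec :: (type) real_vector
begin

lift_definition zero_tvec :: "'a tvec" is "\<lambda>h. 0" .
lift_definition plus_tvec :: "'a tvec \<Rightarrow> 'a tvec \<Rightarrow> 'a tvec" is "\<lambda>u v h. u h + v h" .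
lift_definition minus_tvec :: "'a tvec \<Rightarrow> 'a tvec \<Rightarrow> 'a tvec" is "\<lambda>u v h. u h - v h" .
lift_definition uminus_tvec :: "'a tvec \<Rightarrow> 'a tvec" is "\<lambda>u h. - u h" .
lift_definition scaleR_tvec :: "real \<Rightarrow> 'a tvec \<Rightarrow> 'a tvec" is "\<lambda>a u h. a * u h" .

instance
  by standard (transfer; simp add: fun_eq_iff algebra_simps)+

end

text \<open>
  A derivation at \<open>p\<close> is normalised to vanish on functions that are not smooth near \<open>p\<close>,
  so that equality of tangent vectors is equality of functionals. That it depends only on
  the germ at \<open>p\<close> follows from the product rule applied to indicator functions of
  neighbourhoods of \<open>p\<close>.
\<close>

definition tangent_space ::
  "('a::topological_space, 'e::euclidean_space) chart set \<Rightarrow> 'a \<Rightarrow> 'a tvec set" where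
  "tangent_space A p = {v.
     (\<forall>h. \<not> smooth_near A p h \<longrightarrow> act v h = 0) \<and>
     (\<forall>h k a b. smooth_near A p h \<longrightarrow> smooth_near A p k \<longrightarrow>
        act v (\<lambda>q. a * h q + b * k q) = a * act v h + b * act v k) \<and>
     (\<forall>h k. smooth_near A p h \<longrightarrow> smooth_near A p k \<longrightarrow>
        act v (\<lambda>q. h q * k q) = h p * act v k + k p * act v h)}"

section \<open>Vector fields and tensor fields\<close>

text \<open>
  \<open>smooth_vf A W X\<close>: \<open>X\<close> is a smooth vector field on the open set \<open>W\<close>; its values outside
  \<open>W\<close> are irrelevant.
\<close>

type_synonym 'a vfield = "'a \<Rightarrow> 'a tvec"

definition smooth_vf ::
  "('a::topological_space, 'e::euclidean_space) chart set \<Rightarrow> 'a set \<Rightarrow> 'a vfield \<Rightarrow> bool" where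
  "smooth_vf A W X \<longleftrightarrow> open W \<and> (\<forall>p\<in>W. X p \<in> tangent_space A p) \<and>
     (\<forall>V h. V \<subseteq> W \<longrightarrow> smooth_fun A V h \<longrightarrow> smooth_fun A V (\<lambda>p. act (X p) h))"

definition lie ::
  "('a::topological_space, 'e::euclidean_space) chart set \<Rightarrow> 'a vfield \<Rightarrow> 'a vfield \<Rightarrow> 'a vfield" where
  "lie A X Y p = Tvec (\<lambda>h. if smooth_near A p h
     then act (X p) (\<lambda>q. act (Y q) h) - act (Y p) (\<lambda>q. act (X q) h) else 0)"

text \<open>
  A local extension of a tangent vector at \<open>p\<close> to a vector field. It is used only to
  evaluate at tangent vectors of \<open>p\<close> expressions that are tensorial, hence independent of
  the choice.
\<close>

definition ext ::
  "('a::topological_space, 'e::euclidean_space) chart set \<Rightarrow> 'a \<Rightarrow> 'a tvec \<Rightarrow> 'a vfield" where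
  "ext A p u = (SOME X. (\<exists>W. p \<in> W \<and> smooth_vf A W X) \<and> X p = u)"

definition lin_on :: "'v::real_vector set \<Rightarrow> ('v \<Rightarrow> 'w::real_vector) \<Rightarrow> bool" where
  "lin_on T F \<longleftrightarrow> (\<forall>u\<in>T. \<forall>v\<in>T. \<forall>a b. F (a *\<^sub>R u + b *\<^sub>R v) = a *\<^sub>R F u + b *\<^sub>R F v)"

definition tensor11 ::
  "('a::topological_space, 'e::euclidean_space) chart set \<Rightarrow> ('a \<Rightarrow> 'a tvec \<Rightarrow> 'a tvec) \<Rightarrow> bool" where
  "tensor11 A f \<longleftrightarrow>
     (\<forall>p. lin_on (tangent_space A p) (f p) \<and> f p ` tangent_space A p \<subseteq> tangent_space A p) \<and>
     (\<forall>W X. smooth_vf A W X \<longrightarrow> smooth_vf A W (\<lambda>p. f p (X p)))"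

definition one_form ::
  "('a::topological_space, 'e::euclidean_space) chart set \<Rightarrow> ('a \<Rightarrow> 'a tvec \<Rightarrow> real) \<Rightarrow> bool" where
  "one_form A \<eta> \<longleftrightarrow>
     (\<forall>p. lin_on (tangent_space A p) (\<eta> p)) \<and>
     (\<forall>W X. smooth_vf A W X \<longrightarrow> smooth_fun A W (\<lambda>p. \<eta> p (X p)))"

definition riemannian_metric ::
  "('a::topological_space, 'e::euclidean_space) chart set \<Rightarrow>
   ('a \<Rightarrow> 'a tvec \<Rightarrow> 'a tvec \<Rightarrow> real) \<Rightarrow> bool" where
  "riemannian_metric A g \<longleftrightarrow>
     (\<forall>p. \<forall>u\<in>tangent_space A p.
        lin_on (tangent_space A p) (g p u) \<and>
        (\<forall>v\<in>tangent_space A p. g p u v = g p v u) \<and>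
        (u \<noteq> 0 \<longrightarrow> g p u u > 0)) \<and>
     (\<forall>W X Y. smooth_vf A W X \<longrightarrow> smooth_vf A W Y \<longrightarrow> smooth_fun A W (\<lambda>p. g p (X p) (Y p)))"

section \<open>The Riemannian connection and its curvature\<close>

text \<open>
  Connections act on vector fields over arbitrary open sets, compatibly with restriction
  (locality follows from \<open>C\<^sup>\<infinity>\<close>-linearity and the Leibniz rule for indicator functions of
  open sets).
\<close>

definition connection ::
  "('a::topological_space, 'e::euclidean_space) chart set \<Rightarrow>
   ('a vfield \<Rightarrow> 'a vfield \<Rightarrow> 'a vfield) \<Rightarrow> bool" where
  "connection A nabla \<longleftrightarrow> (\<forall>W X Y. smooth_vf A W X \<longrightarrow> smooth_vf A W Y \<longrightarrow>
     smooth_vf A W (nabla X Y) \<and>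
     (\<forall>Z. smooth_vf A W Z \<longrightarrow> (\<forall>p\<in>W.
        nabla (\<lambda>q. X q + Z q) Y p = nabla X Y p + nabla Z Y p \<and>
        nabla X (\<lambda>q. Y q + Z q) p = nabla X Y p + nabla X Z p)) \<and>
     (\<forall>h. smooth_fun A W h \<longrightarrow> (\<forall>p\<in>W.
        nabla (\<lambda>q. h q *\<^sub>R X q) Y p = h p *\<^sub>R nabla X Y p \<and>
        nabla X (\<lambda>q. h q *\<^sub>R Y q) p = act (X p) h *\<^sub>R Y p + h p *\<^sub>R nabla X Y p)))"

definition levi_civita ::
  "('a::topological_space, 'e::euclidean_space) chart set \<Rightarrow>
   ('a \<Rightarrow> 'a tvec \<Rightarrow> 'a tvec \<Rightarrow> real) \<Rightarrow> ('a vfield \<Rightarrow> 'a vfield \<Rightarrow> 'a vfield) \<Rightarrow> bool" where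
  "levi_civita A g nabla \<longleftrightarrow> connection A nabla \<and>
     (\<forall>W X Y. smooth_vf A W X \<longrightarrow> smooth_vf A W Y \<longrightarrow> (\<forall>p\<in>W.
        nabla X Y p - nabla Y X p = lie A X Y p)) \<and>
     (\<forall>W X Y Z. smooth_vf A W X \<longrightarrow> smooth_vf A W Y \<longrightarrow> smooth_vf A W Z \<longrightarrow> (\<forall>p\<in>W.
        act (X p) (\<lambda>q. g q (Y q) (Z q)) = g p (nabla X Y p) (Z p) + g p (Y p) (nabla X Z p)))"

definition curvature ::
  "('a::topological_space, 'e::euclidean_space) chart set \<Rightarrow>
   ('a vfield \<Rightarrow> 'a vfield \<Rightarrow> 'a vfield) \<Rightarrow> 'a vfield \<Rightarrow> 'a vfield \<Rightarrow> 'a vfield \<Rightarrow> 'a vfield" where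
  "curvature A nabla X Y Z p =
     nabla X (nabla Y Z) p - nabla Y (nabla X Z) p - nabla (lie A X Y) Z p"

definition Riem ::
  "('a::topological_space, 'e::euclidean_space) chart set \<Rightarrow>
   ('a \<Rightarrow> 'a tvec \<Rightarrow> 'a tvec \<Rightarrow> real) \<Rightarrow> ('a vfield \<Rightarrow> 'a vfield \<Rightarrow> 'a vfield) \<Rightarrow>
   'a \<Rightarrow> 'a tvec \<Rightarrow> 'a tvec \<Rightarrow> 'a tvec \<Rightarrow> 'a tvec \<Rightarrow> real" where
  "Riem A g nabla p u v w z = g p (curvature A nabla (ext A p u) (ext A p v) (ext A p w) p) z"

text \<open>The sectional curvature of the plane spanned by \<open>u\<close> and \<open>v\<close>, for orthonormal \<open>u\<close>, \<open>v\<close>.\<close>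

definition sec_curv ::
  "('a::topological_space, 'e::euclidean_space) chart set \<Rightarrow>
   ('a \<Rightarrow> 'a tvec \<Rightarrow> 'a tvec \<Rightarrow> real) \<Rightarrow> ('a vfield \<Rightarrow> 'a vfield \<Rightarrow> 'a vfield) \<Rightarrow>
   'a \<Rightarrow> 'a tvec \<Rightarrow> 'a tvec \<Rightarrow> real" where
  "sec_curv A g nabla p u v = Riem A g nabla p u v v u"

definition orthonormal_frame ::
  "('a::topological_space, 'e::euclidean_space) chart set \<Rightarrow>
   ('a \<Rightarrow> 'a tvec \<Rightarrow> 'a tvec \<Rightarrow> real) \<Rightarrow> 'a \<Rightarrow> (nat \<Rightarrow> 'a tvec) \<Rightarrow> bool" where
  "orthonormal_frame A g p e \<longleftrightarrow>
     (\<forall>i\<in>{1..DIM('e)}. e i \<in> tangent_space A p) \<and>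
     (\<forall>i\<in>{1..DIM('e)}. \<forall>j\<in>{1..DIM('e)}. g p (e i) (e j) = (if i = j then 1 else 0))"

definition scalar_curvature ::
  "('a::topological_space, 'e::euclidean_space) chart set \<Rightarrow>
   ('a \<Rightarrow> 'a tvec \<Rightarrow> 'a tvec \<Rightarrow> real) \<Rightarrow> ('a vfield \<Rightarrow> 'a vfield \<Rightarrow> 'a vfield) \<Rightarrow> 'a \<Rightarrow> real" where
  "scalar_curvature A g nabla p = (THE t. \<forall>e. orthonormal_frame A g p e \<longrightarrow>
     t = (\<Sum>i=1..DIM('e). \<Sum>j=1..DIM('e).
            if i = j then 0 else sec_curv A g nabla p (e i) (e j)) / 2)"

section \<open>Exterior algebra\<close>

definition extd ::
  "('a::topological_space, 'e::euclidean_space) chart set \<Rightarrow> ('a \<Rightarrow> 'a tvec \<Rightarrow> real) \<Rightarrow>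
   'a vfield \<Rightarrow> 'a vfield \<Rightarrow> 'a \<Rightarrow> real" where
  "extd A \<eta> X Y p =
     (act (X p) (\<lambda>q. \<eta> q (Y q)) - act (Y p) (\<lambda>q. \<eta> q (X q)) - \<eta> p (lie A X Y p)) / 2"

text \<open>
  A \<open>k\<close>-form on a vector space is a function of sequences of vectors depending on the
  first \<open>k\<close> entries. The factor \<open>1 / (k + l)!\<close> goes with the factor \<open>1 / 2\<close> in \<open>extd\<close>.
\<close>

type_synonym 'v altform = "(nat \<Rightarrow> 'v) \<Rightarrow> real"

definition wedge :: "nat \<Rightarrow> nat \<Rightarrow> 'v altform \<Rightarrow> 'v altform \<Rightarrow> 'v altform" where
  "wedge k l \<omega> \<theta> v =
     (\<Sum>\<sigma> | \<sigma> permutes {..<k + l}.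
        of_int (sign \<sigma>) * \<omega> (\<lambda>i. v (\<sigma> i)) * \<theta> (\<lambda>i. v (\<sigma> (k + i)))) / fact (k + l)"

text \<open>Wedge product of a list of forms, each given with its degree.\<close>

primrec wedges :: "(nat \<times> 'v altform) list \<Rightarrow> 'v altform" where
  "wedges [] = (\<lambda>v. 1)"
| "wedges (x # xs) = wedge (fst x) (sum_list (map fst xs)) (snd x) (wedges xs)"

section \<open>Metric f-manifolds and S-manifolds\<close>

definition metric_f_manifold ::
  "('a::{t2_space,second_countable_topology}, 'e::euclidean_space) chart set \<Rightarrow> nat \<Rightarrow> nat \<Rightarrow>
   ('a \<Rightarrow> 'a tvec \<Rightarrow> 'a tvec) \<Rightarrow> (nat \<Rightarrow> 'a vfield) \<Rightarrow> (nat \<Rightarrow> 'a \<Rightarrow> 'a tvec \<Rightarrow> real) \<Rightarrow>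
   ('a \<Rightarrow> 'a tvec \<Rightarrow> 'a tvec \<Rightarrow> real) \<Rightarrow> bool" where
  "metric_f_manifold A n s f \<xi> \<eta> g \<longleftrightarrow>
     n \<ge> 1 \<and> s \<ge> 1 \<and> smooth_atlas A \<and> DIM('e) = 2 * n + s \<and>
     tensor11 A f \<and> riemannian_metric A g \<and>
     (\<forall>\<alpha>\<in>{1..s}. smooth_vf A UNIV (\<xi> \<alpha>) \<and> one_form A (\<eta> \<alpha>)) \<and>
     (\<forall>p. \<forall>u\<in>tangent_space A p.
        f p (f p u) = - u + (\<Sum>\<alpha>=1..s. \<eta> \<alpha> p u *\<^sub>R \<xi> \<alpha> p) \<and>
        (\<forall>\<alpha>\<in>{1..s}. \<eta> \<alpha> p (f p u) = 0 \<and> \<eta> \<alpha> p u = g p u (\<xi> \<alpha> p)) \<and>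
        (\<forall>v\<in>tangent_space A p.
           g p (f p u) (f p v) = g p u v - (\<Sum>\<alpha>=1..s. \<eta> \<alpha> p u * \<eta> \<alpha> p v) \<and>
           g p u (f p v) = - g p (f p u) v)) \<and>
     (\<forall>p. \<forall>\<alpha>\<in>{1..s}. f p (\<xi> \<alpha> p) = 0 \<and>
        (\<forall>\<beta>\<in>{1..s}. \<eta> \<alpha> p (\<xi> \<beta> p) = (if \<alpha> = \<beta> then 1 else 0)))"

definition nijenhuis ::
  "('a::topological_space, 'e::euclidean_space) chart set \<Rightarrow> ('a \<Rightarrow> 'a tvec \<Rightarrow> 'a tvec) \<Rightarrow>
   'a vfield \<Rightarrow> 'a vfield \<Rightarrow> 'a vfield" where
  "nijenhuis A f X Y p =
     f p (f p (lie A X Y p)) + lie A (\<lambda>q. f q (X q)) (\<lambda>q. f q (Y q)) p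
     - f p (lie A (\<lambda>q. f q (X q)) Y p) - f p (lie A X (\<lambda>q. f q (Y q)) p)"

definition normal_f_structure ::
  "('a::topological_space, 'e::euclidean_space) chart set \<Rightarrow> nat \<Rightarrow>
   ('a \<Rightarrow> 'a tvec \<Rightarrow> 'a tvec) \<Rightarrow> (nat \<Rightarrow> 'a vfield) \<Rightarrow> (nat \<Rightarrow> 'a \<Rightarrow> 'a tvec \<Rightarrow> real) \<Rightarrow> bool" where
  "normal_f_structure A s f \<xi> \<eta> \<longleftrightarrow>
     (\<forall>W X Y. smooth_vf A W X \<longrightarrow> smooth_vf A W Y \<longrightarrow> (\<forall>p\<in>W.
        nijenhuis A f X Y p + 2 *\<^sub>R (\<Sum>\<alpha>=1..s. extd A (\<eta> \<alpha>) X Y p *\<^sub>R \<xi> \<alpha> p) = 0))"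

definition S_manifold ::
  "('a::{t2_space,second_countable_topology}, 'e::euclidean_space) chart set \<Rightarrow> nat \<Rightarrow> nat \<Rightarrow>
   ('a \<Rightarrow> 'a tvec \<Rightarrow> 'a tvec) \<Rightarrow> (nat \<Rightarrow> 'a vfield) \<Rightarrow> (nat \<Rightarrow> 'a \<Rightarrow> 'a tvec \<Rightarrow> real) \<Rightarrow>
   ('a \<Rightarrow> 'a tvec \<Rightarrow> 'a tvec \<Rightarrow> real) \<Rightarrow> bool" where
  "S_manifold A n s f \<xi> \<eta> g \<longleftrightarrow>
     metric_f_manifold A n s f \<xi> \<eta> g \<and> normal_f_structure A s f \<xi> \<eta> \<and>
     (\<forall>\<alpha>\<in>{1..s}. \<forall>p. \<exists>v. (\<forall>i. v i \<in> tangent_space A p) \<and>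
        wedges (map (\<lambda>\<beta>. (1, \<lambda>w. \<eta> \<beta> p (w 0))) [1..<Suc s] @
                replicate n (2, \<lambda>w. extd A (\<eta> \<alpha>) (ext A p (w 0)) (ext A p (w 1)) p)) v \<noteq> 0) \<and>
     (\<forall>\<alpha>\<in>{1..s}. \<forall>W X Y. smooth_vf A W X \<longrightarrow> smooth_vf A W Y \<longrightarrow> (\<forall>p\<in>W.
        g p (X p) (f p (Y p)) = extd A (\<eta> \<alpha>) X Y p))"

definition distL ::
  "('a::topological_space, 'e::euclidean_space) chart set \<Rightarrow> nat \<Rightarrow> (nat \<Rightarrow> 'a vfield) \<Rightarrow>
   ('a \<Rightarrow> 'a tvec \<Rightarrow> 'a tvec \<Rightarrow> real) \<Rightarrow> 'a \<Rightarrow> 'a tvec set" where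
  "distL A s \<xi> g p = {u \<in> tangent_space A p. \<forall>w\<in>span {\<xi> \<alpha> p |\<alpha>. \<alpha> \<in> {1..s}}. g p u w = 0}"

text \<open>\<open>nabla\<close> is meant to be the Riemannian connection of \<open>g\<close>.\<close>

definition S_space_form ::
  "('a::{t2_space,second_countable_topology}, 'e::euclidean_space) chart set \<Rightarrow> nat \<Rightarrow> nat \<Rightarrow>
   ('a \<Rightarrow> 'a tvec \<Rightarrow> 'a tvec) \<Rightarrow> (nat \<Rightarrow> 'a vfield) \<Rightarrow> (nat \<Rightarrow> 'a \<Rightarrow> 'a tvec \<Rightarrow> real) \<Rightarrow>
   ('a \<Rightarrow> 'a tvec \<Rightarrow> 'a tvec \<Rightarrow> real) \<Rightarrow> ('a vfield \<Rightarrow> 'a vfield \<Rightarrow> 'a vfield) \<Rightarrow> real \<Rightarrow> bool" where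
  "S_space_form A n s f \<xi> \<eta> g nabla c \<longleftrightarrow>
     S_manifold A n s f \<xi> \<eta> g \<and>
     (\<forall>p. \<forall>u\<in>distL A s \<xi> g p. g p u u = 1 \<longrightarrow> sec_curv A g nabla p u (f p u) = c)"

end

theory Submission
  imports Defs
begin

text \<open>
  From normality and \<open>d\<eta>\<^sup>\<alpha> = \<Phi>\<close> one gets that every \<open>\<xi>\<^sub>\<alpha>\<close> is Killing with \<open>\<nabla>\<^sub>X\<xi>\<^sub>\<alpha> = -fX\<close> and that
  \<open>(\<nabla>\<^sub>Xf)Y = g(fX, fY) \<Sum>\<xi>\<^sub>\<alpha> + (\<Sum>\<eta>\<^sup>\<alpha>(Y)) f\<^sup>2X\<close>. Hence \<open>R(X, Y)\<xi>\<^sub>\<alpha>\<close> is explicit, and on the distribution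
  \<open>\<L>\<close> the tensor \<open>R - s R\<^sub>1\<close>, where \<open>R\<^sub>1\<close> has constant curvature \<open>1\<close>, has the symmetries of a Kaehler
  curvature tensor, with constant holomorphic sectional curvature \<open>c - s\<close>. Polarization then gives all
  sectional curvatures, and the sum over an orthonormal frame is evaluated by Parseval's identity.
\<close>

section \<open>Calculus of smooth maps\<close>

text \<open>Tangent vectors are derivations, so even the dimension of a tangent space must be
  derived, from Hadamard's lemma. Moreover \<open>Riem\<close> is evaluated on arbitrary extensions
  \<open>ext\<close>, so curvature must first be shown to depend only on values at \<open>p\<close>;
  afterwards all is linear algebra in one tangent space. The formula for \<nabla>f solves an
  overdetermined system: \<nabla>f is skew because f is, its cyclic sum vanishes because \<Phi> is
  closed, differentiating f f = -I + \<Sum> \<eta> \<otimes> \<xi> lets f pass from one argument to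
  another, and normality ties the first two arguments together. The proposed right-hand side obeys
  the same relations, and they force the difference to vanish. The factor s appears when that
  formula is differentiated again: each of the s forms \<eta> contributes the same multiple of
  \<Phi>. Subtracting s times the unit sphere tensor lowers the holomorphic curvature by s; adding
  it back gives (c - s)/4 + s = (c + 3 s)/4 for planes in the distribution orthogonal to the
  structure fields. A unit vector of that distribution and a structure field span a plane of
  curvature 1, two structure fields a plane of curvature 0.\<close>

lemma ck_on_cong:
  assumes "open S" "\<And>x. x \<in> S \<Longrightarrow> h x = k x"
  shows "ck_on n S h = ck_on n S k"
  using assms(2)
proof (induction n arbitrary: h k)
  case 0
  then show ?case by (simp cong: continuous_on_cong)
next
  case (Suc n)
  have imp: "ck_on (Suc n) S k" if hk: "\<And>x. x \<in> S \<Longrightarrow> h x = k x" and ck: "ck_on (Suc n) S h"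
    for h k :: "'a \<Rightarrow> 'b"
  proof -
    have d: "h differentiable (at x)" if "x \<in> S" for x
      using ck that by simp
    have eq: "frechet_derivative h (at x) = frechet_derivative k (at x)" if "x \<in> S" for x
      using frechet_derivative_transform_within_open[OF d[OF that] assms(1) that] hk by blast
    have "k differentiable (at x)" if "x \<in> S" for x
      using differentiable_transform_within[of h x UNIV _ k] d[OF that] hk
      by (meson assms(1) d differentiable_def has_derivative_transform_within_open that)
    moreover have "ck_on n S (\<lambda>x. frechet_derivative k (at x) v)" for v
      using Suc.IH[of "\<lambda>x. frechet_derivative h (at x) v" "\<lambda>x. frechet_derivative k (at x) v"] eq ck
      by simp
    ultimately show ?thesis by simp
  qed
  from imp[of h k] imp[of k h] Suc.prems show ?case by metis
qed

text \<open>\<open>ck_on\<close> refers to \<open>frechet_derivative\<close>, which is a choice. By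
  uniqueness of derivatives any exhibited derivative \<open>D\<close> may replace it, so the
  inductions below can work with explicit formulas.\<close>

lemma ck_on_SucI:
  assumes "open S" and der: "\<And>x. x \<in> S \<Longrightarrow> (h has_derivative D x) (at x)"
    and "\<And>v. ck_on n S (\<lambda>x. D x v)"
  shows "ck_on (Suc n) S h"
proof -
  have "ck_on n S (\<lambda>x. frechet_derivative h (at x) v)" for v
  proof -
    have "D x v = frechet_derivative h (at x) v" if "x \<in> S" for x
      using frechet_derivative_at[OF der[OF that]] by simp
    from ck_on_cong[OF assms(1) this, of "\<lambda>x. x" n] assms(3)[of v] show ?thesis
      by blast
  qed
  then show ?thesis
    using der unfolding ck_on.simps differentiable_def by blast
qed

lemma ck_on_subset: "ck_on n S h \<Longrightarrow> T \<subseteq> S \<Longrightarrow> ck_on n T h"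
  by (induction n arbitrary: h) (auto intro: continuous_on_subset)

lemma ck_on_Suc_imp: "ck_on (Suc n) S h \<Longrightarrow> ck_on n S h"
proof (induction n arbitrary: h)
  case 0
  then show ?case
    by (auto intro!: continuous_at_imp_continuous_on differentiable_imp_continuous_within)
next
  case (Suc n)
  then show ?case by (metis ck_on.simps(2))
qed

lemma ck_on_const: "ck_on n S (\<lambda>x. c)"
  by (induction n arbitrary: c) simp_all

lemma ck_on_id: "ck_on n S (\<lambda>x. x)"
  by (cases n) (simp_all add: ck_on_const)

lemma ck_on_bounded_linear:
  assumes "open S" "bounded_linear L"
  shows "ck_on n S h \<Longrightarrow> ck_on n S (\<lambda>x. L (h x))"
proof (induction n arbitrary: h)
  case 0
  then show ?case by (simp add: bounded_linear.continuous_on[OF assms(2)])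
next
  case (Suc n)
  have der: "((\<lambda>x. L (h x)) has_derivative (\<lambda>v. L (frechet_derivative h (at x) v))) (at x)"
    if "x \<in> S" for x
    using Suc.prems that
    by (intro bounded_linear.has_derivative[OF assms(2)]) (simp add: frechet_derivative_works[symmetric])
  have "ck_on n S (\<lambda>x. L (frechet_derivative h (at x) v))" for v
    using Suc by simp
  then show ?case
    using ck_on_SucI[OF assms(1) der] by blast
qed

lemma ck_on_add:
  assumes "open S"
  shows "ck_on n S h \<Longrightarrow> ck_on n S k \<Longrightarrow> ck_on n S (\<lambda>x. h x + k x)"
proof (induction n arbitrary: h k)
  case 0
  then show ?case by (simp add: continuous_on_add)
next
  case (Suc n)
  have der: "((\<lambda>x. h x + k x) has_derivative
      (\<lambda>v. frechet_derivative h (at x) v + frechet_derivative k (at x) v)) (at x)"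
    if "x \<in> S" for x
    using Suc.prems that
    by (intro has_derivative_add) (simp_all add: frechet_derivative_works[symmetric])
  have "ck_on n S (\<lambda>x. frechet_derivative h (at x) v + frechet_derivative k (at x) v)" for v
    using Suc by simp
  then show ?case
    using ck_on_SucI[OF assms(1) der] by blast
qed

lemma ck_on_sum:
  assumes "open S" "\<And>i. i \<in> I \<Longrightarrow> ck_on n S (h i)"
  shows "ck_on n S (\<lambda>x. \<Sum>i\<in>I. h i x)"
  using assms(2)
  by (induction I rule: infinite_finite_induct) (simp_all add: ck_on_const ck_on_add[OF assms(1)])

lemma ck_on_scaleR:
  fixes h :: "'e::euclidean_space \<Rightarrow> real"
  assumes "open S"
  shows "ck_on n S h \<Longrightarrow> ck_on n S k \<Longrightarrow> ck_on n S (\<lambda>x. h x *\<^sub>R k x)"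
proof (induction n arbitrary: h k)
  case 0
  then show ?case by (simp add: continuous_on_scaleR)
next
  case (Suc n)
  have der: "((\<lambda>x. h x *\<^sub>R k x) has_derivative
      (\<lambda>v. h x *\<^sub>R frechet_derivative k (at x) v + frechet_derivative h (at x) v *\<^sub>R k x)) (at x)"
    if "x \<in> S" for x
    using Suc.prems that
    by (intro has_derivative_scaleR) (simp_all add: frechet_derivative_works[symmetric])
  have "ck_on n S (\<lambda>x. h x *\<^sub>R frechet_derivative k (at x) v + frechet_derivative h (at x) v *\<^sub>R k x)" for v
    using Suc.prems ck_on_Suc_imp[OF Suc.prems(1)] ck_on_Suc_imp[OF Suc.prems(2)]
    by (intro ck_on_add[OF assms(1)] Suc.IH) simp_all
  then show ?case
    using ck_on_SucI[OF assms(1) der] by blast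
qed

lemma ck_on_compose:
  fixes h :: "'e::euclidean_space \<Rightarrow> 'd::euclidean_space"
  assumes "open S" "open T" "h ` S \<subseteq> T"
  shows "ck_on n T g \<Longrightarrow> ck_on n S h \<Longrightarrow> ck_on n S (\<lambda>x. g (h x))"
proof (induction n arbitrary: g)
  case 0
  then show ?case using continuous_on_compose2[OF _ _ assms(3)] by simp
next
  case (Suc n)
  have der0: "((\<lambda>x. g (h x)) has_derivative
      (\<lambda>v. frechet_derivative g (at (h x)) (frechet_derivative h (at x) v))) (at x)"
    if "x \<in> S" for x
  proof (rule has_derivative_compose[of h])
    show "(h has_derivative frechet_derivative h (at x)) (at x)"
      using Suc.prems that by (simp add: frechet_derivative_works[symmetric])
    show "(g has_derivative frechet_derivative g (at (h x))) (at (h x))"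
      using Suc.prems that assms(3) by (auto simp add: frechet_derivative_works[symmetric])
  qed
  \<comment> \<open>In the chain rule the direction itself varies with \<open>x\<close>, while
    \<open>ck_on\<close> controls derivatives in fixed directions only. Expanding in
    \<open>Basis\<close> leaves the fixed directions \<open>b\<close>, to which
    \<open>Suc.IH\<close> applies.\<close>
  have expand: "frechet_derivative g (at (h x)) (frechet_derivative h (at x) v) =
      (\<Sum>b\<in>Basis. (frechet_derivative h (at x) v \<bullet> b) *\<^sub>R frechet_derivative g (at (h x)) b)"
    if "x \<in> S" for x v
  proof -
    have "linear (frechet_derivative g (at (h x)))"
      using Suc.prems(1) that assms(3) by (intro linear_frechet_derivative) auto
    then have "frechet_derivative g (at (h x)) (\<Sum>b\<in>Basis. (frechet_derivative h (at x) v \<bullet> b) *\<^sub>R b) =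
      (\<Sum>b\<in>Basis. (frechet_derivative h (at x) v \<bullet> b) *\<^sub>R frechet_derivative g (at (h x)) b)"
      by (simp add: linear_sum linear_scale)
    then show ?thesis by (simp add: euclidean_representation)
  qed
  have der: "((\<lambda>x. g (h x)) has_derivative (\<lambda>v. \<Sum>b\<in>Basis.
      (frechet_derivative h (at x) v \<bullet> b) *\<^sub>R frechet_derivative g (at (h x)) b)) (at x)"
    if "x \<in> S" for x
    using der0[OF that] expand[OF that] by simp
  have "ck_on n S (\<lambda>x. \<Sum>b\<in>Basis. (frechet_derivative h (at x) v \<bullet> b) *\<^sub>R frechet_derivative g (at (h x)) b)" for v
    using Suc.prems ck_on_Suc_imp[OF Suc.prems(2)]
    by (intro ck_on_sum ck_on_scaleR ck_on_bounded_linear[OF _ bounded_linear_inner_left] Suc.IH assms(1))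
      simp_all
  then show ?case
    using ck_on_SucI[OF assms(1) der] by blast
qed

lemma smooth_on_frechet: "smooth_on S h \<Longrightarrow> smooth_on S (\<lambda>x. frechet_derivative h (at x) v)"
  unfolding smooth_on_def by (metis ck_on.simps(2))

lemma smooth_on_has_derivative:
  "smooth_on S h \<Longrightarrow> x \<in> S \<Longrightarrow> (h has_derivative frechet_derivative h (at x)) (at x)"
  unfolding smooth_on_def by (metis ck_on.simps(2) frechet_derivative_works)

lemma smooth_on_continuous: "smooth_on S h \<Longrightarrow> continuous_on S h"
  unfolding smooth_on_def by (metis ck_on.simps(1))

text \<open>Differentiating under the integral produces a factor \<open>t\<close> by the chain rule.
  The general weight \<open>w\<close> absorbs it, so the derivative is an integral of the same shape
  and the induction closes.\<close>

lemma ck_on_integral_ray: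
  fixes H :: "'e::euclidean_space \<Rightarrow> real" and w :: "real \<Rightarrow> real"
  assumes "smooth_on (ball x0 r) H" "continuous_on {0..1} w"
  shows "ck_on n (ball x0 r) (\<lambda>x. integral {0..1} (\<lambda>t. w t * H (x0 + t *\<^sub>R (x - x0))))"
  using assms
proof (induction n arbitrary: w H)
  let ?B = "ball x0 r"
  have ray: "x0 + t *\<^sub>R (x - x0) \<in> ?B" if "x \<in> ?B" "t \<in> {0..1}" for x t
  proof -
    have "\<bar>t\<bar> * norm (x - x0) \<le> norm (x - x0)"
      using that(2) by (intro mult_left_le_one_le) auto
    then show ?thesis
      using that(1) by (simp add: dist_norm norm_minus_commute)
  qed
  have cont: "continuous_on (?B \<times> {0..1}) (\<lambda>(x, t). w t * H (x0 + t *\<^sub>R (x - x0)))"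
    if "continuous_on ?B H" "continuous_on {0..1} w"
    for H :: "'e \<Rightarrow> real" and w :: "real \<Rightarrow> real"
  proof -
    have "continuous_on (?B \<times> {0..1}) (\<lambda>z. w (snd z))"
      by (rule continuous_on_compose2[OF that(2) continuous_on_snd[OF continuous_on_id]]) auto
    moreover have "continuous_on (?B \<times> {0..1}) (\<lambda>z. H (x0 + snd z *\<^sub>R (fst z - x0)))"
      by (rule continuous_on_compose2[OF that(1)]) (use ray in \<open>auto intro!: continuous_intros\<close>)
    ultimately show ?thesis
      unfolding case_prod_unfold by (intro continuous_intros)
  qed
  {
    case 0
    then show ?case
      using integral_continuous_on_param[of ?B 0 "1::real" "\<lambda>x t. w t * H (x0 + t *\<^sub>R (x - x0))"]
        cont[OF smooth_on_continuous] by simp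
  next
    case (Suc n)
    let ?D = "\<lambda>y. frechet_derivative H (at y)"
    let ?F = "\<lambda>x. integral {0..1} (\<lambda>t. w t * H (x0 + t *\<^sub>R (x - x0)))"
    \<comment> \<open>The Leibniz rule integrates the derivative as an element of the normed space
      of bounded linear maps, hence \<open>Blinfun\<close>; \<open>app\<close> and
      \<open>dapp\<close> return to fixed directions.\<close>
    let ?fx = "\<lambda>x t. Blinfun (\<lambda>v. (w t * t) * ?D (x0 + t *\<^sub>R (x - x0)) v)"
    have bl: "bounded_linear (\<lambda>v. (w t * t) * ?D (x0 + t *\<^sub>R (x - x0)) v)"
      if "x \<in> ?B" "t \<in> {0..1}" for x t
      using smooth_on_has_derivative[OF Suc.prems(1) ray[OF that]]
      by (intro bounded_linear_const_mult) (rule has_derivative_bounded_linear)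
    have app: "blinfun_apply (?fx x t) v = (w t * t) * ?D (x0 + t *\<^sub>R (x - x0)) v"
      if "x \<in> ?B" "t \<in> {0..1}" for x t v
      using bounded_linear_Blinfun_apply[OF bl[OF that]] by metis
    have d1: "((\<lambda>x. w t * H (x0 + t *\<^sub>R (x - x0))) has_derivative blinfun_apply (?fx x t)) (at x within ?B)"
      if "x \<in> ?B" "t \<in> cbox 0 1" for x t
    proof -
      have t: "t \<in> {0..1}" using that by simp
      have "((\<lambda>x. x0 + t *\<^sub>R (x - x0)) has_derivative (\<lambda>v. t *\<^sub>R v)) (at x)"
        by (auto intro!: derivative_eq_intros)
      from has_derivative_compose[OF this smooth_on_has_derivative[OF Suc.prems(1) ray[OF that(1) t]]]
      have "((\<lambda>x. w t * H (x0 + t *\<^sub>R (x - x0))) has_derivative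
          (\<lambda>v. w t * ?D (x0 + t *\<^sub>R (x - x0)) (t *\<^sub>R v))) (at x)"
        by (intro has_derivative_mult_right)
      moreover have "linear (?D (x0 + t *\<^sub>R (x - x0)))"
        using smooth_on_has_derivative[OF Suc.prems(1) ray[OF that(1) t]] has_derivative_linear by blast
      moreover have "blinfun_apply (?fx x t) = (\<lambda>v. (w t * t) * ?D (x0 + t *\<^sub>R (x - x0)) v)"
        using app[OF that(1) t] by (simp only: fun_eq_iff) simp
      ultimately show ?thesis
        by (simp only:) (simp add: linear_scale has_derivative_at_withinI mult.assoc)
    qed
    have d2: "(\<lambda>t. w t * H (x0 + t *\<^sub>R (x - x0))) integrable_on cbox 0 1" if "x \<in> ?B" for x
      using continuous_on_compose2[OF cont[OF smooth_on_continuous[OF Suc.prems(1)] Suc.prems(2)],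
          of "{0..1}" "\<lambda>t. (x, t)"] that
      by (intro integrable_continuous) (auto simp: continuous_on_Pair image_subset_iff)
    have wt: "continuous_on {0..1} (\<lambda>t. w t * t)"
      using Suc.prems(2) by (intro continuous_intros)
    have d3: "continuous_on (?B \<times> cbox 0 1) (\<lambda>(x, t). ?fx x t)"
    proof (rule continuous_on_blinfun_componentwise)
      fix i :: 'e assume "i \<in> Basis"
      show "continuous_on (?B \<times> cbox 0 1) (\<lambda>z. blinfun_apply (case z of (x, t) \<Rightarrow> ?fx x t) i)"
      proof (rule continuous_on_eq[of _ "\<lambda>(x, t). (w t * t) * ?D (x0 + t *\<^sub>R (x - x0)) i"])
        show "continuous_on (?B \<times> cbox 0 1) (\<lambda>(x, t). (w t * t) * ?D (x0 + t *\<^sub>R (x - x0)) i)"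
          using cont[OF smooth_on_continuous[OF smooth_on_frechet[OF Suc.prems(1), of i]] wt]
          by simp
      qed (auto simp: app)
    qed
    have der: "(?F has_derivative integral (cbox 0 1) (?fx x)) (at x)" if "x \<in> ?B" for x
      using leibniz_rule[OF d1 d2 d3 that convex_ball] that
      by (simp add: at_within_open[OF _ open_ball])
    have dapp: "frechet_derivative ?F (at x) v = integral {0..1} (\<lambda>t. (w t * t) * ?D (x0 + t *\<^sub>R (x - x0)) v)"
      if "x \<in> ?B" for x v
    proof -
      have "continuous_on (cbox 0 1) (?fx x)"
        using continuous_on_compose2[OF d3, of "cbox 0 1" "\<lambda>t. (x, t)"] that
        by (auto simp: continuous_on_Pair image_subset_iff)
      then have "?fx x integrable_on cbox 0 1" by (rule integrable_continuous)
      then have "blinfun_apply (integral (cbox 0 1) (?fx x)) v =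
          integral (cbox 0 1) (\<lambda>t. blinfun_apply (?fx x t) v)"
        by (rule blinfun_apply_integral)
      also have "\<dots> = integral (cbox 0 1) (\<lambda>t. (w t * t) * ?D (x0 + t *\<^sub>R (x - x0)) v)"
        using app[OF that] by (intro integral_cong) auto
      finally show ?thesis
        using frechet_derivative_at[OF der[OF that]] by simp
    qed
    have "ck_on n ?B (\<lambda>x. frechet_derivative ?F (at x) v)" for v
      by (subst ck_on_cong[OF open_ball dapp]) (use Suc.IH[OF smooth_on_frechet[OF Suc.prems(1)] wt] in auto)
    then show ?case
      using der unfolding ck_on.simps differentiable_def by blast
  }
qed

text \<open>The fundamental theorem of calculus along the segment from \<open>x0\<close> to
  \<open>x\<close>: the coefficients \<open>G b\<close> are the averages of the partial derivatives
  over that segment, hence smooth by \<open>ck_on_integral_ray\<close>.\<close>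

lemma hadamard:
  fixes H :: "'e::euclidean_space \<Rightarrow> real"
  assumes "smooth_on (ball x0 r) H"
  shows "\<exists>G. (\<forall>b. smooth_on (ball x0 r) (G b) \<and> G b x0 = frechet_derivative H (at x0) b) \<and>
    (\<forall>x\<in>ball x0 r. H x = H x0 + (\<Sum>b\<in>Basis. ((x - x0) \<bullet> b) * G b x))"
proof (intro exI conjI allI ballI)
  let ?D = "\<lambda>y. frechet_derivative H (at y)"
  let ?G = "\<lambda>b x. integral {0..1} (\<lambda>t. ?D (x0 + t *\<^sub>R (x - x0)) b)"
  show "smooth_on (ball x0 r) (?G b)" for b
    unfolding smooth_on_def
    using ck_on_integral_ray[OF smooth_on_frechet[OF assms, of b] continuous_on_const, of _ 1]
    by simp
  show "?G b x0 = ?D x0 b" for b by simp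
  show "H x = H x0 + (\<Sum>b\<in>Basis. ((x - x0) \<bullet> b) * ?G b x)" if "x \<in> ball x0 r" for x
  proof -
    have ray: "x0 + t *\<^sub>R (x - x0) \<in> ball x0 r" if "t \<in> {0..1}" for t
    proof -
      have "\<bar>t\<bar> * norm (x - x0) \<le> norm (x - x0)"
        using that by (intro mult_left_le_one_le) auto
      then show ?thesis
        using \<open>x \<in> ball x0 r\<close> by (simp add: dist_norm norm_minus_commute)
    qed
    have lin: "linear (?D (x0 + t *\<^sub>R (x - x0)))" if "t \<in> {0..1}" for t
      using smooth_on_has_derivative[OF assms ray[OF that]] has_derivative_linear by blast
    have "((\<lambda>t. H (x0 + t *\<^sub>R (x - x0))) has_vector_derivative ?D (x0 + t *\<^sub>R (x - x0)) (x - x0))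
        (at t within {0..1})" if "t \<in> {0..1}" for t
    proof -
      have "((\<lambda>t. x0 + t *\<^sub>R (x - x0)) has_derivative (\<lambda>u. u *\<^sub>R (x - x0))) (at t within {0..1})"
        by (auto intro!: derivative_eq_intros)
      from has_derivative_compose[OF this smooth_on_has_derivative[OF assms ray[OF that]]]
      show ?thesis
        unfolding has_vector_derivative_def by (simp add: linear_scale[OF lin[OF that]])
    qed
    then have ftc: "((\<lambda>t. ?D (x0 + t *\<^sub>R (x - x0)) (x - x0)) has_integral (H x - H x0)) {0..1}"
      using fundamental_theorem_of_calculus[of 0 1 "\<lambda>t. H (x0 + t *\<^sub>R (x - x0))"] by simp
    have int: "(\<lambda>t. ?D (x0 + t *\<^sub>R (x - x0)) b) integrable_on {0..1}" for b
      using ray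
      by (intro integrable_continuous_interval
          continuous_on_compose2[OF smooth_on_continuous[OF smooth_on_frechet[OF assms, of b]]]
          continuous_intros) auto
    have "H x - H x0 = integral {0..1} (\<lambda>t. ?D (x0 + t *\<^sub>R (x - x0)) (x - x0))"
      using ftc by (simp add: integral_unique)
    also have "\<dots> = integral {0..1} (\<lambda>t. \<Sum>b\<in>Basis. ((x - x0) \<bullet> b) * ?D (x0 + t *\<^sub>R (x - x0)) b)"
    proof (rule integral_cong)
      fix t :: real assume t: "t \<in> {0..1}"
      have "?D (x0 + t *\<^sub>R (x - x0)) (\<Sum>b\<in>Basis. ((x - x0) \<bullet> b) *\<^sub>R b) =
          (\<Sum>b\<in>Basis. ((x - x0) \<bullet> b) * ?D (x0 + t *\<^sub>R (x - x0)) b)"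
        by (simp add: linear_sum[OF lin[OF t]] linear_scale[OF lin[OF t]])
      then show "?D (x0 + t *\<^sub>R (x - x0)) (x - x0) =
          (\<Sum>b\<in>Basis. ((x - x0) \<bullet> b) * ?D (x0 + t *\<^sub>R (x - x0)) b)"
        by (simp only: euclidean_representation)
    qed
    also have "\<dots> = (\<Sum>b\<in>Basis. ((x - x0) \<bullet> b) * ?G b x)"
      using int by (subst integral_sum) (auto intro: integrable_on_mult_right)
    finally show ?thesis by simp
  qed
qed

section \<open>Charts and smooth functions on the manifold\<close>

lemma chart_open:
  assumes "smooth_atlas A" "(U, \<phi>) \<in> A"
  shows "open U" and "open (\<phi> ` U)" and "inj_on \<phi> U" and "continuous_on U \<phi>"
    and "continuous_on (\<phi> ` U) (inv_into U \<phi>)"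
proof -
  have "open U \<and> open (\<phi> ` U) \<and> homeomorphism U (\<phi> ` U) \<phi> (inv_into U \<phi>)"
    using assms unfolding smooth_atlas_def by fast
  then show "open U" "open (\<phi> ` U)" "continuous_on U \<phi>" "continuous_on (\<phi> ` U) (inv_into U \<phi>)"
    "inj_on \<phi> U"
    by (auto simp: homeomorphism_def intro: inj_on_inverseI)
qed

lemma chart_image_open:
  assumes "smooth_atlas A" "(U, \<phi>) \<in> A" "open W"
  shows "open (\<phi> ` (U \<inter> W))"
proof -
  note c = chart_open[OF assms(1,2)]
  have "\<phi> ` (U \<inter> W) = \<phi> ` U \<inter> inv_into U \<phi> -` W"
    using c(3) by (auto simp: inv_into_f_f)
  then show ?thesis
    using continuous_open_preimage[OF c(5) c(2) assms(3)] by simp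
qed

lemma chart_exists:
  assumes "smooth_atlas A"
  obtains U \<phi> where "(U, \<phi>) \<in> A" "p \<in> U"
proof -
  have "p \<in> (\<Union>(U, \<phi>)\<in>A. U)"
    using assms unfolding smooth_atlas_def by simp
  then show ?thesis using that by auto
qed

lemma smooth_fun_openD: "smooth_fun A W h \<Longrightarrow> open W"
  by (simp add: smooth_fun_def)

lemma smooth_fun_chartD:
  "smooth_fun A W h \<Longrightarrow> (U, \<phi>) \<in> A \<Longrightarrow> smooth_on (\<phi> ` (U \<inter> W)) (h \<circ> inv_into U \<phi>)"
  unfolding smooth_fun_def by fast

lemma smooth_funI:
  assumes "open W" "\<And>U \<phi>. (U, \<phi>) \<in> A \<Longrightarrow> smooth_on (\<phi> ` (U \<inter> W)) (h \<circ> inv_into U \<phi>)"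
  shows "smooth_fun A W h"
  using assms unfolding smooth_fun_def by blast

lemma smooth_on_subset: "smooth_on S h \<Longrightarrow> T \<subseteq> S \<Longrightarrow> smooth_on T h"
  unfolding smooth_on_def using ck_on_subset by blast

lemma smooth_fun_cong:
  assumes "smooth_atlas A" "smooth_fun A W h" "\<And>q. q \<in> W \<Longrightarrow> h q = k q"
  shows "smooth_fun A W k"
proof (rule smooth_funI)
  show "open W" using smooth_fun_openD[OF assms(2)] .
  fix U \<phi> assume ch: "(U, \<phi>) \<in> A"
  have ck: "ck_on n (\<phi> ` (U \<inter> W)) (h \<circ> inv_into U \<phi>)" for n
    using smooth_fun_chartD[OF assms(2) ch] unfolding smooth_on_def by blast
  have op: "open (\<phi> ` (U \<inter> W))"
    using chart_image_open[OF assms(1) ch smooth_fun_openD[OF assms(2)]] .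
  have eq: "(h \<circ> inv_into U \<phi>) x = (k \<circ> inv_into U \<phi>) x" if "x \<in> \<phi> ` (U \<inter> W)" for x
    using that chart_open(3)[OF assms(1) ch] assms(3) by (auto simp: inv_into_f_f)
  show "smooth_on (\<phi> ` (U \<inter> W)) (k \<circ> inv_into U \<phi>)"
    using ck_on_cong[OF op eq, of "\<lambda>x. x"] ck by (simp add: smooth_on_def comp_def)
qed

lemma smooth_fun_subset:
  assumes "smooth_fun A W h" "open V" "V \<subseteq> W"
  shows "smooth_fun A V h"
proof (rule smooth_funI[OF assms(2)])
  fix U \<phi> assume "(U, \<phi>) \<in> A"
  from smooth_fun_chartD[OF assms(1) this] show "smooth_on (\<phi> ` (U \<inter> V)) (h \<circ> inv_into U \<phi>)"
    by (rule smooth_on_subset) (use assms(3) in blast)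
qed

lemma smooth_fun_const: "open W \<Longrightarrow> smooth_fun A W (\<lambda>q. c)"
  by (auto simp: smooth_fun_def smooth_on_def comp_def ck_on_const)

lemma smooth_fun_add:
  assumes "smooth_atlas A" "smooth_fun A W h" "smooth_fun A W k"
  shows "smooth_fun A W (\<lambda>q. h q + k q)"
  using assms chart_image_open[OF assms(1)]
  by (auto simp: smooth_fun_def smooth_on_def comp_def intro!: ck_on_add)

lemma smooth_fun_mult:
  assumes "smooth_atlas A" "smooth_fun A W h" "smooth_fun A W k"
  shows "smooth_fun A W (\<lambda>q. h q * k q)"
proof -
  have "ck_on n (\<phi> ` (U \<inter> W)) (\<lambda>x. h (inv_into U \<phi> x) *\<^sub>R k (inv_into U \<phi> x))" if "(U, \<phi>) \<in> A" for n U \<phi>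
    using smooth_fun_chartD[OF assms(2) that] smooth_fun_chartD[OF assms(3) that]
      chart_image_open[OF assms(1) that smooth_fun_openD[OF assms(2)]]
    by (intro ck_on_scaleR) (auto simp: smooth_on_def comp_def)
  then show ?thesis
    using smooth_fun_openD[OF assms(2)] by (auto simp: smooth_fun_def smooth_on_def comp_def)
qed

lemma smooth_fun_cmult:
  assumes "smooth_atlas A" "smooth_fun A W h"
  shows "smooth_fun A W (\<lambda>q. c * h q)"
  using smooth_fun_mult[OF assms(1) smooth_fun_const assms(2)] smooth_fun_openD[OF assms(2)] by blast

lemma smooth_fun_diff:
  assumes "smooth_atlas A" "smooth_fun A W h" "smooth_fun A W k"
  shows "smooth_fun A W (\<lambda>q. h q - k q)"
  using smooth_fun_add[OF assms(1,2) smooth_fun_cmult[OF assms(1,3), of "-1"]] by simp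

lemma smooth_fun_sum:
  assumes "smooth_atlas A" "open W" "\<And>i. i \<in> I \<Longrightarrow> smooth_fun A W (h i)"
  shows "smooth_fun A W (\<lambda>q. \<Sum>i\<in>I. h i q)"
  using assms(3)
  by (induction I rule: infinite_finite_induct)
    (simp_all add: smooth_fun_const[OF assms(2)] smooth_fun_add[OF assms(1)])

text \<open>Smoothness is demanded in every chart. Read in another chart \<open>\<psi>\<close>, the
  function is \<open>G\<close> after a transition map, so the compatibility of charts reduces the
  claim to \<open>ck_on_compose\<close>.\<close>

lemma smooth_fun_chart_comp:
  fixes A :: "('a::{t2_space,second_countable_topology}, 'e::euclidean_space) chart set"
  assumes at: "smooth_atlas A" and ch: "(U, \<phi>) \<in> A" and G: "smooth_on T G" "open T"
    and V: "open V" "V \<subseteq> U" "\<phi> ` V \<subseteq> T"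
  shows "smooth_fun A V (\<lambda>q. G (\<phi> q))"
proof (rule smooth_funI[OF V(1)])
  fix U' \<psi> assume ch': "(U', \<psi>) \<in> A"
  have tr: "smooth_on (\<psi> ` (U' \<inter> U)) (\<phi> \<circ> inv_into U' \<psi>)"
    using at ch ch' unfolding smooth_atlas_def by fast
  have "ck_on n (\<psi> ` (U' \<inter> V)) (\<lambda>x. G ((\<phi> \<circ> inv_into U' \<psi>) x))" for n
  proof (rule ck_on_compose[where g = G and h = "\<phi> \<circ> inv_into U' \<psi>" and T = T])
    show "open (\<psi> ` (U' \<inter> V))" by (rule chart_image_open[OF at ch' V(1)])
    show "open T" "ck_on n T G" using G by (simp_all add: smooth_on_def)
    show "(\<phi> \<circ> inv_into U' \<psi>) ` \<psi> ` (U' \<inter> V) \<subseteq> T"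
      using V chart_open(3)[OF at ch'] by (auto simp: inv_into_f_f)
    show "ck_on n (\<psi> ` (U' \<inter> V)) (\<phi> \<circ> inv_into U' \<psi>)"
      using tr V(2) by (auto simp: smooth_on_def intro: ck_on_subset)
  qed
  then show "smooth_on (\<psi> ` (U' \<inter> V)) ((\<lambda>q. G (\<phi> q)) \<circ> inv_into U' \<psi>)"
    by (simp add: smooth_on_def comp_def)
qed

lemma smooth_nearI: "smooth_fun A W h \<Longrightarrow> p \<in> W \<Longrightarrow> smooth_near A p h"
  by (auto simp: smooth_near_def)

lemma smooth_near2:
  assumes "smooth_near A p h" "smooth_near A p k"
  obtains W where "p \<in> W" "smooth_fun A W h" "smooth_fun A W k"
proof -
  obtain V W where *: "p \<in> V" "p \<in> W" "smooth_fun A V h" "smooth_fun A W k"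
    using assms unfolding smooth_near_def by blast
  then have "open (V \<inter> W)" by (blast dest: smooth_fun_openD)
  with * show ?thesis
    using that[of "V \<inter> W"] smooth_fun_subset by blast
qed

lemma smooth_near_const: "smooth_near A p (\<lambda>q. c)"
  using smooth_nearI[OF smooth_fun_const[OF open_UNIV]] by blast

lemma smooth_near_add:
  assumes "smooth_atlas A" "smooth_near A p h" "smooth_near A p k"
  shows "smooth_near A p (\<lambda>q. h q + k q)"
proof -
  obtain W where "p \<in> W" "smooth_fun A W h" "smooth_fun A W k"
    using smooth_near2[OF assms(2,3)] .
  then show ?thesis using smooth_nearI[OF smooth_fun_add[OF assms(1)]] by blast
qed

lemma smooth_near_mult:
  assumes "smooth_atlas A" "smooth_near A p h" "smooth_near A p k"
  shows "smooth_near A p (\<lambda>q. h q * k q)"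
proof -
  obtain W where "p \<in> W" "smooth_fun A W h" "smooth_fun A W k"
    using smooth_near2[OF assms(2,3)] .
  then show ?thesis using smooth_nearI[OF smooth_fun_mult[OF assms(1)]] by blast
qed

lemma smooth_near_sum:
  "smooth_atlas A \<Longrightarrow> (\<And>i. i \<in> I \<Longrightarrow> smooth_near A p (h i)) \<Longrightarrow> smooth_near A p (\<lambda>q. \<Sum>i\<in>I. h i q)"
  by (induction I rule: infinite_finite_induct)
    (simp_all add: smooth_near_const smooth_near_add)

section \<open>Tangent vectors\<close>

lemma act_0 [simp]: "act 0 h = 0"
  and act_plus [simp]: "act (u + v) h = act u h + act v h"
  and act_minus [simp]: "act (u - v) h = act u h - act v h"
  and act_uminus [simp]: "act (- u) h = - act u h"
  and act_scaleR [simp]: "act (a *\<^sub>R u) h = a * act u h"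
  by (transfer; simp)+

lemma act_sum_left [simp]: "act (\<Sum>i\<in>I. u i) h = (\<Sum>i\<in>I. act (u i) h)"
  by (induction I rule: infinite_finite_induct) simp_all

lemma act_Tvec [simp]: "act (Tvec F) = F"
  by (simp add: Tvec_inverse)

lemma tvec_eqI: "(\<And>h. act u h = act v h) \<Longrightarrow> u = v"
  by (metis act_inject ext)

lemma subspace_tangent_space: "subspace (tangent_space A p)"
  by (rule subspaceI) (auto simp: tangent_space_def algebra_simps)

lemma act_not_smooth: "v \<in> tangent_space A p \<Longrightarrow> \<not> smooth_near A p h \<Longrightarrow> act v h = 0"
  by (simp add: tangent_space_def)

lemma act_lincomb:
  "v \<in> tangent_space A p \<Longrightarrow> smooth_near A p h \<Longrightarrow> smooth_near A p k \<Longrightarrow>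
    act v (\<lambda>q. a * h q + b * k q) = a * act v h + b * act v k"
  unfolding tangent_space_def by blast

lemma act_add:
  "v \<in> tangent_space A p \<Longrightarrow> smooth_near A p h \<Longrightarrow> smooth_near A p k \<Longrightarrow>
    act v (\<lambda>q. h q + k q) = act v h + act v k"
  using act_lincomb[of v A p h k 1 1] by simp

lemma act_diff:
  "v \<in> tangent_space A p \<Longrightarrow> smooth_near A p h \<Longrightarrow> smooth_near A p k \<Longrightarrow>
    act v (\<lambda>q. h q - k q) = act v h - act v k"
  using act_lincomb[of v A p h k 1 "-1"] by simp

lemma act_cmult:
  "v \<in> tangent_space A p \<Longrightarrow> smooth_near A p h \<Longrightarrow> act v (\<lambda>q. a * h q) = a * act v h"
  using act_lincomb[of v A p h h a 0] by simp

lemma act_mult: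
  "v \<in> tangent_space A p \<Longrightarrow> smooth_near A p h \<Longrightarrow> smooth_near A p k \<Longrightarrow>
    act v (\<lambda>q. h q * k q) = h p * act v k + k p * act v h"
  unfolding tangent_space_def by blast

lemma act_const:
  assumes "v \<in> tangent_space A p"
  shows "act v (\<lambda>q. c) = 0"
proof -
  have "act v (\<lambda>q. 1) = 0"
    using act_mult[OF assms smooth_near_const[of A p 1] smooth_near_const[of A p 1]] by simp
  then show ?thesis
    using act_cmult[OF assms smooth_near_const[of A p 1], of c] by simp
qed

lemma act_sum:
  assumes "smooth_atlas A" "v \<in> tangent_space A p" "\<And>i. i \<in> I \<Longrightarrow> smooth_near A p (h i)"
  shows "act v (\<lambda>q. \<Sum>i\<in>I. h i q) = (\<Sum>i\<in>I. act v (h i))"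
  using assms(3)
  by (induction I rule: infinite_finite_induct)
    (simp_all add: act_const[OF assms(2)] act_add[OF assms(2)] smooth_near_sum[OF assms(1)])

text \<open>Since the indicator function \<open>1\<^sub>V\<close> of a neighbourhood of \<open>p\<close> is smooth near \<open>p\<close> and
  idempotent, a derivation kills it.\<close>

lemma act_cong:
  assumes at: "smooth_atlas A" and v: "v \<in> tangent_space A p" and V: "open V" "p \<in> V"
    and eq: "\<And>q. q \<in> V \<Longrightarrow> h q = k q"
  shows "act v h = act v k"
proof -
  let ?i = "indicator V :: 'a \<Rightarrow> real"
  have i: "smooth_near A p ?i"
    using smooth_nearI[OF smooth_fun_cong[OF at smooth_fun_const[OF V(1), of A 1]] V(2)] by simp
  have "(\<lambda>q. ?i q * ?i q) = ?i" by (auto simp: indicator_def)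
  with act_mult[OF v i i] V(2) have i0: "act v ?i = 0" by simp
  have loc: "act v (\<lambda>q. ?i q * h q) = act v h" if "smooth_near A p h" for h
    using act_mult[OF v i that] V(2) i0 by simp
  have near: "smooth_near A p k" if h: "smooth_near A p h" and e: "\<And>q. q \<in> V \<Longrightarrow> h q = k q" for h k
  proof -
    obtain W where W: "p \<in> W" "smooth_fun A W h" using h by (auto simp: smooth_near_def)
    then have "open (W \<inter> V)" using V(1) by (blast dest: smooth_fun_openD)
    then have "smooth_fun A (W \<inter> V) k"
      using smooth_fun_cong[OF at smooth_fun_subset[OF W(2)]] e by blast
    then show ?thesis using smooth_nearI W V by blast
  qed
  have same: "(\<lambda>q. ?i q * h q) = (\<lambda>q. ?i q * k q)"
    using eq by (auto simp: indicator_def)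
  show ?thesis
  proof (cases "smooth_near A p h")
    case True
    with near[OF True eq] loc[of h] loc[of k] same show ?thesis by simp
  next
    case False
    then have "\<not> smooth_near A p k" using near[of k h] eq by auto
    with False show ?thesis by (simp add: act_not_smooth[OF v])
  qed
qed

section \<open>Coordinate vector fields and the dimension of tangent spaces\<close>

text \<open>The partial derivative in direction \<open>b\<close> of the chart; the value 0 on
  functions not smooth near \<open>q\<close> is the normalisation built into
  \<open>tangent_space\<close>.\<close>

definition coord_vec ::
  "('a::topological_space, 'e::euclidean_space) chart set \<Rightarrow> 'a set \<Rightarrow> ('a \<Rightarrow> 'e) \<Rightarrow> 'e \<Rightarrow> 'a vfield" where
  "coord_vec A U \<phi> b q = Tvec (\<lambda>h. if smooth_near A q h
     then frechet_derivative (h \<circ> inv_into U \<phi>) (at (\<phi> q)) b else 0)"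

lemma smooth_near_chart_derivative:
  assumes "(U, \<phi>) \<in> A" "q \<in> U" "smooth_near A q h"
  shows "((h \<circ> inv_into U \<phi>) has_derivative frechet_derivative (h \<circ> inv_into U \<phi>) (at (\<phi> q))) (at (\<phi> q))"
proof -
  obtain W where "q \<in> W" "smooth_fun A W h" using assms(3) by (auto simp: smooth_near_def)
  then show ?thesis
    using smooth_on_has_derivative[OF smooth_fun_chartD[OF _ assms(1)]] assms(2) by blast
qed

lemma coord_vec_tangent:
  assumes at: "smooth_atlas A" and ch: "(U, \<phi>) \<in> A" and q: "q \<in> U"
  shows "coord_vec A U \<phi> b q \<in> tangent_space A q"
proof -
  let ?i = "inv_into U \<phi>"
  note der = smooth_near_chart_derivative[OF ch q]
  have iq: "?i (\<phi> q) = q" using chart_open(3)[OF at ch] q by simp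
  have lin: "frechet_derivative ((\<lambda>q. a * h q + c * k q) \<circ> ?i) (at (\<phi> q)) b =
      a * frechet_derivative (h \<circ> ?i) (at (\<phi> q)) b + c * frechet_derivative (k \<circ> ?i) (at (\<phi> q)) b"
    if "smooth_near A q h" "smooth_near A q k" for a c h k
  proof -
    have "((\<lambda>x. a * (h \<circ> ?i) x + c * (k \<circ> ?i) x) has_derivative
        (\<lambda>v. a * frechet_derivative (h \<circ> ?i) (at (\<phi> q)) v + c * frechet_derivative (k \<circ> ?i) (at (\<phi> q)) v))
        (at (\<phi> q))"
      by (intro has_derivative_add has_derivative_mult_right der that)
    from fun_cong[OF frechet_derivative_at[OF this, symmetric], of b] show ?thesis by (simp add: comp_def)
  qed
  have mult: "frechet_derivative ((\<lambda>q. h q * k q) \<circ> ?i) (at (\<phi> q)) b =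
      h q * frechet_derivative (k \<circ> ?i) (at (\<phi> q)) b + k q * frechet_derivative (h \<circ> ?i) (at (\<phi> q)) b"
    if "smooth_near A q h" "smooth_near A q k" for h k
  proof -
    have "((\<lambda>x. (h \<circ> ?i) x * (k \<circ> ?i) x) has_derivative
        (\<lambda>v. (h \<circ> ?i) (\<phi> q) * frechet_derivative (k \<circ> ?i) (at (\<phi> q)) v +
          frechet_derivative (h \<circ> ?i) (at (\<phi> q)) v * (k \<circ> ?i) (\<phi> q))) (at (\<phi> q))"
      by (intro has_derivative_mult der that)
    from fun_cong[OF frechet_derivative_at[OF this, symmetric], of b] show ?thesis
      by (simp add: comp_def iq mult.commute)
  qed
  have near: "smooth_near A q (\<lambda>q. a * h q + c * k q)" if "smooth_near A q h" "smooth_near A q k" for a c h k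
    using that by (intro smooth_near_add[OF at] smooth_near_mult[OF at] smooth_near_const)
  show ?thesis
    unfolding tangent_space_def coord_vec_def
    using near smooth_near_mult[OF at] lin mult by simp
qed

lemma smooth_vf_coord_vec:
  assumes at: "smooth_atlas A" and ch: "(U, \<phi>) \<in> A"
  shows "smooth_vf A U (coord_vec A U \<phi> b)"
  unfolding smooth_vf_def
proof (intro conjI ballI allI impI)
  fix V h assume V: "V \<subseteq> U" and h: "smooth_fun A V h"
  let ?D = "\<lambda>x. frechet_derivative (h \<circ> inv_into U \<phi>) (at x) b"
  have UV: "U \<inter> V = V" using V by auto
  have oV: "open V" using h by (rule smooth_fun_openD)
  have "smooth_on (\<phi> ` V) ?D"
    using smooth_on_frechet[OF smooth_fun_chartD[OF h ch], of b] by (simp only: UV)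
  moreover have "open (\<phi> ` V)"
    using chart_image_open[OF at ch oV] by (simp only: UV)
  ultimately have "smooth_fun A V (\<lambda>q. ?D (\<phi> q))"
    by (rule smooth_fun_chart_comp[OF at ch _ _ oV V order_refl])
  then show "smooth_fun A V (\<lambda>q. act (coord_vec A U \<phi> b q) h)"
    by (rule smooth_fun_cong[OF at]) (simp add: coord_vec_def smooth_nearI[OF h])
qed (use chart_open(1)[OF at ch] coord_vec_tangent[OF at ch] in auto)

lemma smooth_fun_coordinate:
  fixes A :: "('a::{t2_space,second_countable_topology}, 'e::euclidean_space) chart set"
  assumes "smooth_atlas A" "(U, \<phi>) \<in> A"
  shows "smooth_fun A U (\<lambda>q. \<phi> q \<bullet> b)"
proof (rule smooth_fun_chart_comp[OF assms])
  show "smooth_on UNIV (\<lambda>x::'e. x \<bullet> b)"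
    using ck_on_bounded_linear[OF open_UNIV bounded_linear_inner_left ck_on_id]
    unfolding smooth_on_def by blast
qed (simp_all add: chart_open[OF assms])

lemma coord_vec_coordinate:
  assumes "smooth_atlas A" "(U, \<phi>) \<in> A" "p \<in> U" "b \<in> Basis" "b' \<in> Basis"
  shows "act (coord_vec A U \<phi> b p) (\<lambda>q. \<phi> q \<bullet> b') = (if b = b' then 1 else 0)"
proof -
  note c = chart_open[OF assms(1,2)]
  have "((\<lambda>x. x \<bullet> b') has_derivative (\<lambda>v. v \<bullet> b')) (at (\<phi> p))"
    by (auto intro!: derivative_eq_intros)
  then have "(((\<lambda>q. \<phi> q \<bullet> b') \<circ> inv_into U \<phi>) has_derivative (\<lambda>v. v \<bullet> b')) (at (\<phi> p))"
    by (rule has_derivative_transform_within_open[OF _ c(2)]) (use assms(3) in \<open>auto simp: f_inv_into_f\<close>)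
  from frechet_derivative_at[OF this, symmetric] show ?thesis
    using assms smooth_nearI[OF smooth_fun_coordinate[OF assms(1,2)] assms(3)]
    by (simp add: coord_vec_def inner_Basis)
qed

text \<open>By \<open>hadamard\<close>, near \<open>p\<close> the function \<open>h - h p\<close> is
  a sum of products of \<open>\<phi> q \<bullet> b - \<phi> p \<bullet> b\<close> with
  \<open>G b (\<phi> q)\<close>. The first factor vanishes at \<open>p\<close>, so the product rule
  leaves only its derivative times \<open>G b (\<phi> p)\<close>, and the latter is the partial
  derivative of \<open>h\<close>.\<close>

lemma tangent_vector_expansion:
  assumes at: "smooth_atlas A" and ch: "(U, \<phi>) \<in> A" and p: "p \<in> U" and v: "v \<in> tangent_space A p"
  shows "v = (\<Sum>b\<in>Basis. act v (\<lambda>q. \<phi> q \<bullet> b) *\<^sub>R coord_vec A U \<phi> b p)"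
proof (rule tvec_eqI)
  fix h
  note c = chart_open[OF at ch]
  let ?i = "inv_into U \<phi>" and ?x = "\<phi> p"
  show "act v h = act (\<Sum>b\<in>Basis. act v (\<lambda>q. \<phi> q \<bullet> b) *\<^sub>R coord_vec A U \<phi> b p) h"
  proof (cases "smooth_near A p h")
    case False
    then show ?thesis by (simp add: act_not_smooth[OF v] coord_vec_def)
  next
    case True
    then obtain W where W: "p \<in> W" "smooth_fun A W h" by (auto simp: smooth_near_def)
    have "open (\<phi> ` (U \<inter> W))" "?x \<in> \<phi> ` (U \<inter> W)"
      using chart_image_open[OF at ch smooth_fun_openD[OF W(2)]] W p by auto
    then obtain r where r: "r > 0" "ball ?x r \<subseteq> \<phi> ` (U \<inter> W)" by (meson openE)
    have "smooth_on (ball ?x r) (h \<circ> ?i)"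
      using smooth_fun_chartD[OF W(2) ch] r(2) ck_on_subset unfolding smooth_on_def by blast
    from hadamard[OF this] obtain G where
      G0: "\<forall>b. smooth_on (ball ?x r) (G b) \<and> G b ?x = frechet_derivative (h \<circ> ?i) (at ?x) b"
      and G3: "\<forall>x\<in>ball ?x r. (h \<circ> ?i) x = (h \<circ> ?i) ?x + (\<Sum>b\<in>Basis. ((x - ?x) \<bullet> b) * G b x)"
      by (elim exE conjE)
    note G = conjunct1[OF spec[OF G0]] conjunct2[OF spec[OF G0]] bspec[OF G3]
    let ?V = "U \<inter> \<phi> -` ball ?x r"
    have V: "open ?V" "p \<in> ?V" "?V \<subseteq> U" "\<phi> ` ?V \<subseteq> ball ?x r"
      using continuous_open_preimage[OF c(4) c(1) open_ball] p r(1) by auto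
    have sG: "smooth_near A p (\<lambda>q. G b (\<phi> q))" for b
      using smooth_nearI[OF smooth_fun_chart_comp[OF at ch G(1) open_ball V(1,3,4)] V(2)] .
    have sx: "smooth_near A p (\<lambda>q. \<phi> q \<bullet> b - ?x \<bullet> b)" for b
      by (rule smooth_nearI[OF smooth_fun_diff[OF at smooth_fun_coordinate[OF at ch] smooth_fun_const] p])
        (rule c(1))
    have dx: "act v (\<lambda>q. \<phi> q \<bullet> b - ?x \<bullet> b) = act v (\<lambda>q. \<phi> q \<bullet> b)" for b
      using act_diff[OF v smooth_nearI[OF smooth_fun_coordinate[OF at ch] p] smooth_near_const]
      by (simp add: act_const[OF v])
    have sm: "smooth_near A p (\<lambda>q. (\<phi> q \<bullet> b - ?x \<bullet> b) * G b (\<phi> q))" for b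
      by (rule smooth_near_mult[OF at sx sG])
    have ss: "smooth_near A p (\<lambda>q. \<Sum>b\<in>Basis. (\<phi> q \<bullet> b - ?x \<bullet> b) * G b (\<phi> q))"
      by (rule smooth_near_sum[OF at sm])
    have "act v h = act v (\<lambda>q. h p + (\<Sum>b\<in>Basis. (\<phi> q \<bullet> b - ?x \<bullet> b) * G b (\<phi> q)))"
    proof (rule act_cong[OF at v V(1,2)])
      fix q assume "q \<in> ?V"
      then have "\<phi> q \<in> ball ?x r" "?i (\<phi> q) = q" using c(3) by auto
      with G(3)[of "\<phi> q"] show "h q = h p + (\<Sum>b\<in>Basis. (\<phi> q \<bullet> b - ?x \<bullet> b) * G b (\<phi> q))"
        using c(3) p by (simp add: inner_diff_left)
    qed
    also have "\<dots> = (\<Sum>b\<in>Basis. act v (\<lambda>q. (\<phi> q \<bullet> b - ?x \<bullet> b) * G b (\<phi> q)))"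
      using act_add[OF v smooth_near_const ss] act_sum[OF at v sm]
      by (simp add: act_const[OF v])
    also have "\<dots> = (\<Sum>b\<in>Basis. act v (\<lambda>q. \<phi> q \<bullet> b) * G b ?x)"
      using act_mult[OF v sx sG] dx by (intro sum.cong) simp_all
    also have "\<dots> = act (\<Sum>b\<in>Basis. act v (\<lambda>q. \<phi> q \<bullet> b) *\<^sub>R coord_vec A U \<phi> b p) h"
      using True by (simp add: coord_vec_def G(2))
    finally show ?thesis .
  qed
qed

text \<open>Independence is seen by evaluating on the coordinate functions. The cardinality matters
  because \<open>scalar_curvature\<close> sums over \<open>DIM('e)\<close> orthonormal vectors,
  which thereby form a basis.\<close>

lemma tangent_space_basis:
  fixes A :: "('a::{t2_space,second_countable_topology}, 'e::euclidean_space) chart set"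
  assumes at: "smooth_atlas A"
  obtains B where "independent B" "span B = tangent_space A p" "finite B" "card B = DIM('e)"
proof -
  obtain U \<phi> where ch: "(U, \<phi>) \<in> A" "p \<in> U" using chart_exists[OF at] .
  let ?d = "\<lambda>b. coord_vec A U \<phi> b p"
  note dc = coord_vec_coordinate[OF at ch]
  have inj: "inj_on ?d Basis"
    by (rule inj_onI) (metis dc zero_neq_one)
  have "independent (?d ` Basis)"
  proof (rule independent_if_scalars_zero)
    fix u y assume *: "(\<Sum>y\<in>?d ` Basis. u y *\<^sub>R y) = 0" and "y \<in> ?d ` Basis"
    then obtain b where b: "b \<in> Basis" "y = ?d b" by auto
    have "0 = act (\<Sum>y\<in>?d ` Basis. u y *\<^sub>R y) (\<lambda>q. \<phi> q \<bullet> b)"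
      using * by simp
    also have "\<dots> = (\<Sum>b'\<in>Basis. u (?d b') * act (?d b') (\<lambda>q. \<phi> q \<bullet> b))"
      by (subst sum.reindex[OF inj]) simp
    also have "\<dots> = (\<Sum>b'\<in>Basis. if b' = b then u (?d b) else 0)"
      by (rule sum.cong) (auto simp: dc b)
    finally show "u y = 0" using b by simp
  qed simp
  moreover have "span (?d ` Basis) = tangent_space A p"
  proof
    show "span (?d ` Basis) \<subseteq> tangent_space A p"
      using coord_vec_tangent[OF at ch] by (intro span_minimal subspace_tangent_space) auto
    show "tangent_space A p \<subseteq> span (?d ` Basis)"
    proof
      fix v assume v: "v \<in> tangent_space A p"
      have "(\<Sum>b\<in>Basis. act v (\<lambda>q. \<phi> q \<bullet> b) *\<^sub>R ?d b) \<in> span (?d ` Basis)"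
        by (intro span_sum span_scale span_base) auto
      then show "v \<in> span (?d ` Basis)"
        using tangent_vector_expansion[OF at ch v] by simp
    qed
  qed
  ultimately show ?thesis
    using that[of "?d ` Basis"] card_image[OF inj] by simp
qed

section \<open>Vector fields\<close>

lemma smooth_vf_openD: "smooth_vf A W X \<Longrightarrow> open W"
  by (simp add: smooth_vf_def)

lemma smooth_vf_tangent: "smooth_vf A W X \<Longrightarrow> p \<in> W \<Longrightarrow> X p \<in> tangent_space A p"
  by (simp add: smooth_vf_def)

lemma smooth_vf_act: "smooth_vf A W X \<Longrightarrow> V \<subseteq> W \<Longrightarrow> smooth_fun A V h \<Longrightarrow> smooth_fun A V (\<lambda>p. act (X p) h)"
  by (simp add: smooth_vf_def)

lemma smooth_vf_subset: "smooth_vf A W X \<Longrightarrow> open V \<Longrightarrow> V \<subseteq> W \<Longrightarrow> smooth_vf A V X"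
  unfolding smooth_vf_def by blast

lemma smooth_vf_cong:
  assumes "smooth_atlas A" "smooth_vf A W X" "\<And>q. q \<in> W \<Longrightarrow> X q = Y q"
  shows "smooth_vf A W Y"
  unfolding smooth_vf_def
proof (intro conjI ballI allI impI)
  fix V h assume "V \<subseteq> W" "smooth_fun A V h"
  with smooth_vf_act[OF assms(2) this] show "smooth_fun A V (\<lambda>p. act (Y p) h)"
    by (elim smooth_fun_cong[OF assms(1)]) (use assms(3) in auto)
next
  fix p assume "p \<in> W"
  then show "Y p \<in> tangent_space A p"
    using smooth_vf_tangent[OF assms(2)] assms(3) by metis
qed (rule smooth_vf_openD[OF assms(2)])

lemma smooth_vf_add:
  assumes "smooth_atlas A" "smooth_vf A W X" "smooth_vf A W Y"
  shows "smooth_vf A W (\<lambda>q. X q + Y q)"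
  using assms unfolding smooth_vf_def
  by (auto intro: smooth_fun_add[OF assms(1)] subspace_add[OF subspace_tangent_space])

lemma smooth_vf_scaleR:
  assumes "smooth_atlas A" "smooth_fun A W h" "smooth_vf A W X"
  shows "smooth_vf A W (\<lambda>q. h q *\<^sub>R X q)"
  using assms unfolding smooth_vf_def
  by (auto intro!: smooth_fun_mult[OF assms(1)] subspace_scale[OF subspace_tangent_space]
      elim: smooth_fun_subset[OF assms(2)] dest: smooth_fun_openD)

lemma smooth_vf_cscale:
  assumes "smooth_atlas A" "smooth_vf A W X"
  shows "smooth_vf A W (\<lambda>q. c *\<^sub>R X q)"
  using smooth_vf_scaleR[OF assms(1) smooth_fun_const assms(2)] smooth_vf_openD[OF assms(2)] by blast

lemma smooth_vf_diff:
  assumes "smooth_atlas A" "smooth_vf A W X" "smooth_vf A W Y"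
  shows "smooth_vf A W (\<lambda>q. X q - Y q)"
  using smooth_vf_add[OF assms(1,2) smooth_vf_cscale[OF assms(1,3), of "-1"]] by simp

lemma smooth_vf_sum:
  assumes "smooth_atlas A" "finite I" "I \<noteq> {}" "\<And>i. i \<in> I \<Longrightarrow> smooth_vf A W (X i)"
  shows "smooth_vf A W (\<lambda>q. \<Sum>i\<in>I. X i q)"
  using assms(2-)
  by (induction I rule: finite_ne_induct) (simp_all add: smooth_vf_add[OF assms(1)])

text \<open>Freeze the coefficients of \<open>u\<close> with respect to the coordinate fields of a
  chart. This is what gives the choice in \<open>ext\<close> its content.\<close>

lemma vector_extension_exists:
  fixes A :: "('a::{t2_space,second_countable_topology}, 'e::euclidean_space) chart set"
  assumes at: "smooth_atlas A" and u: "u \<in> tangent_space A p"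
  shows "\<exists>X. (\<exists>W. p \<in> W \<and> smooth_vf A W X) \<and> X p = u"
proof -
  obtain U \<phi> where ch: "(U, \<phi>) \<in> A" "p \<in> U" using chart_exists[OF at] .
  let ?X = "\<lambda>q. \<Sum>b\<in>Basis. act u (\<lambda>q. \<phi> q \<bullet> b) *\<^sub>R coord_vec A U \<phi> b q"
  have "smooth_vf A U ?X"
    by (intro smooth_vf_sum[OF at] smooth_vf_cscale[OF at] smooth_vf_coord_vec[OF at ch(1)]) auto
  then show ?thesis
    using tangent_vector_expansion[OF at ch u] ch(2) by (intro exI[of _ ?X]) auto
qed

lemma ext_extends:
  fixes A :: "('a::{t2_space,second_countable_topology}, 'e::euclidean_space) chart set"
  assumes "smooth_atlas A" "u \<in> tangent_space A p"
  shows "\<exists>W. p \<in> W \<and> smooth_vf A W (ext A p u)" and "ext A p u p = u"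
  using someI_ex[OF vector_extension_exists[OF assms]] unfolding ext_def by blast+

section \<open>Inner products and algebraic curvature tensors on subspaces\<close>

lemma lin_onD: "lin_on T F \<Longrightarrow> u \<in> T \<Longrightarrow> v \<in> T \<Longrightarrow> F (a *\<^sub>R u + b *\<^sub>R v) = a *\<^sub>R F u + b *\<^sub>R F v"
  by (simp add: lin_on_def)

lemma lin_on_add: "lin_on T F \<Longrightarrow> u \<in> T \<Longrightarrow> v \<in> T \<Longrightarrow> F (u + v) = F u + F v"
  using lin_onD[of T F u v 1 1] by simp

lemma lin_on_diff: "lin_on T F \<Longrightarrow> u \<in> T \<Longrightarrow> v \<in> T \<Longrightarrow> F (u - v) = F u - F v"
  using lin_onD[of T F u v 1 "-1"] by simp

lemma lin_on_scale: "lin_on T F \<Longrightarrow> u \<in> T \<Longrightarrow> F (a *\<^sub>R u) = a *\<^sub>R F u"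
  using lin_onD[of T F u u a 0] by simp

lemma lin_on_uminus: "lin_on T F \<Longrightarrow> u \<in> T \<Longrightarrow> F (- u) = - F u"
  using lin_on_scale[of T F u "-1"] by simp

lemma lin_on_zero: "lin_on T F \<Longrightarrow> subspace T \<Longrightarrow> F 0 = 0"
  using lin_on_scale[of T F 0 0] subspace_0[of T] by simp

lemma lin_on_sum:
  assumes "lin_on T F" "subspace T" "\<And>i. i \<in> I \<Longrightarrow> u i \<in> T"
  shows "F (\<Sum>i\<in>I. u i) = (\<Sum>i\<in>I. F (u i))"
  using assms(3)
  by (induction I rule: infinite_finite_induct)
    (simp_all add: lin_on_zero[OF assms(1,2)] lin_on_add[OF assms(1)] subspace_sum[OF assms(2)])

text \<open>Everything is relative to a subspace \<open>T\<close>, since the type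
  \<open>tvec\<close> contains all functionals. The same locale then serves a tangent space and its
  subspace orthogonal to the structure fields.\<close>

locale inner_on =
  fixes T :: "'v::real_vector set" and g :: "'v \<Rightarrow> 'v \<Rightarrow> real"
  assumes sub: "subspace T"
    and sym: "u \<in> T \<Longrightarrow> v \<in> T \<Longrightarrow> g u v = g v u"
    and lin: "u \<in> T \<Longrightarrow> lin_on T (g u)"
    and pos: "u \<in> T \<Longrightarrow> u \<noteq> 0 \<Longrightarrow> g u u > 0"
begin

lemmas closed = subspace_add[OF sub] subspace_diff[OF sub] subspace_scale[OF sub]
  subspace_neg[OF sub] subspace_0[OF sub]

lemma lin_left: "v \<in> T \<Longrightarrow> lin_on T (\<lambda>u. g u v)"
  using lin[of v] by (simp add: lin_on_def sym closed)

lemmas right = lin_on_add[OF lin] lin_on_diff[OF lin] lin_on_scale[OF lin] lin_on_uminus[OF lin]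
  lin_on_zero[OF lin sub]
lemmas left = lin_on_add[OF lin_left] lin_on_diff[OF lin_left] lin_on_scale[OF lin_left]
  lin_on_uminus[OF lin_left] lin_on_zero[OF lin_left sub]

lemma eq_zeroI: "u \<in> T \<Longrightarrow> g u u = 0 \<Longrightarrow> u = 0"
  using pos by force

definition orthonormal :: "nat \<Rightarrow> (nat \<Rightarrow> 'v) \<Rightarrow> bool" where
  "orthonormal k e \<longleftrightarrow> (\<forall>i\<in>{1..k}. e i \<in> T) \<and>
     (\<forall>i\<in>{1..k}. \<forall>j\<in>{1..k}. g (e i) (e j) = (if i = j then 1 else 0))"

lemma orthonormal_coeff:
  assumes e: "orthonormal k e" and j: "j \<in> {1..k}"
  shows "g (\<Sum>i=1..k. a i *\<^sub>R e i) (e j) = a j"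
proof -
  have "g (\<Sum>i=1..k. a i *\<^sub>R e i) (e j) = (\<Sum>i=1..k. g (a i *\<^sub>R e i) (e j))"
    using e j by (intro lin_on_sum[OF lin_left sub]) (auto simp: orthonormal_def closed)
  also have "\<dots> = (\<Sum>i=1..k. if i = j then a j else 0)"
    using e j by (intro sum.cong) (auto simp: orthonormal_def left)
  finally show ?thesis using j by simp
qed

text \<open>One Gram-Schmidt step. It builds frames in \<open>orthonormal_exists\<close>; read
  backwards, together with the bound \<open>orthonormal_le\<close>, it shows in
  \<open>orthonormal_expansion\<close> that a system of maximal length spans.\<close>

lemma orthonormal_extend:
  assumes e: "orthonormal k e" and u: "u \<in> T" "u \<noteq> (\<Sum>i=1..k. g u (e i) *\<^sub>R e i)"
  shows "\<exists>e'. orthonormal (Suc k) e'"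
proof -
  let ?s = "\<Sum>i=1..k. g u (e i) *\<^sub>R e i"
  let ?r = "u - ?s"
  have s: "?s \<in> T" using e by (intro subspace_sum[OF sub]) (auto simp: orthonormal_def closed)
  have r: "?r \<in> T" "?r \<noteq> 0" using u s by (auto simp: closed)
  have ort: "g ?r (e j) = 0" if "j \<in> {1..k}" for j
    using orthonormal_coeff[OF e that, of "\<lambda>i. g u (e i)"] e that u(1) s
    by (simp add: orthonormal_def left)
  let ?n = "(1 / sqrt (g ?r ?r)) *\<^sub>R ?r"
  have n: "?n \<in> T" "g ?n ?n = 1"
    using pos[OF r] r by (simp_all add: closed left right)
  have no: "g ?n (e j) = 0" "g (e j) ?n = 0" if "j \<in> {1..k}" for j
    using ort[OF that] e that r n sym[of ?n "e j"] by (simp_all add: orthonormal_def left)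
  have "orthonormal (Suc k) (e(Suc k := ?n))"
    using e n no unfolding orthonormal_def by (auto simp: atLeastAtMostSuc_conv)
  then show ?thesis by blast
qed

lemma orthonormal_le:
  assumes B: "independent B" "span B = T" "finite B" and e: "orthonormal k e"
  shows "k \<le> card B"
proof -
  have inj: "inj_on e {1..k}"
    using e unfolding orthonormal_def inj_on_def by (metis zero_neq_one)
  have "independent (e ` {1..k})"
  proof (rule independent_if_scalars_zero)
    fix a y assume *: "(\<Sum>y\<in>e ` {1..k}. a y *\<^sub>R y) = 0" and "y \<in> e ` {1..k}"
    then obtain j where j: "j \<in> {1..k}" "y = e j" by auto
    have "(\<Sum>i=1..k. a (e i) *\<^sub>R e i) = 0"
      using * unfolding sum.reindex[OF inj] comp_def .
    then have "0 = g (\<Sum>i=1..k. a (e i) *\<^sub>R e i) (e j)"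
      using e j by (simp only: left orthonormal_def)
    then show "a y = 0" using orthonormal_coeff[OF e j(1), of "\<lambda>i. a (e i)"] j by simp
  qed simp
  moreover have "e ` {1..k} \<subseteq> span B" using e B(2) by (auto simp: orthonormal_def)
  ultimately have "card (e ` {1..k}) \<le> card B"
    using independent_span_bound[OF B(3)] by blast
  then show ?thesis using card_image[OF inj] by simp
qed

lemma orthonormal_exists:
  assumes B: "independent B" "span B = T" "finite B"
  shows "\<exists>e. orthonormal (card B) e"
proof -
  have "k \<le> card B \<Longrightarrow> \<exists>e. orthonormal k e" for k
  proof (induction k)
    case 0
    show ?case by (auto simp: orthonormal_def)
  next
    case (Suc k)
    then obtain e where e: "orthonormal k e" by auto
    have "\<not> B \<subseteq> span (e ` {1..k})"
    proof
      assume "B \<subseteq> span (e ` {1..k})"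
      then have "card B \<le> card (e ` {1..k})"
        using independent_span_bound[OF _ B(1)] by blast
      also have "\<dots> \<le> k" using card_image_le[of "{1..k}" e] by simp
      finally show False using Suc.prems by simp
    qed
    then obtain u where u: "u \<in> B" "u \<notin> span (e ` {1..k})" by blast
    have "(\<Sum>i=1..k. g u (e i) *\<^sub>R e i) \<in> span (e ` {1..k})"
      by (intro span_sum span_scale span_base) auto
    with u have "u \<noteq> (\<Sum>i=1..k. g u (e i) *\<^sub>R e i)" by metis
    moreover have "u \<in> T" using u B(2) span_base by blast
    ultimately show ?case using orthonormal_extend[OF e] by blast
  qed
  then show ?thesis by blast
qed

lemma orthonormal_expansion:
  assumes B: "independent B" "span B = T" "finite B" and e: "orthonormal (card B) e" and u: "u \<in> T"
  shows "u = (\<Sum>i=1..card B. g u (e i) *\<^sub>R e i)"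
  using orthonormal_extend[OF e u] orthonormal_le[OF B, of "Suc (card B)"] by auto

lemma parseval:
  assumes B: "independent B" "span B = T" "finite B" and e: "orthonormal (card B) e"
    and u: "u \<in> T" and v: "v \<in> T"
  shows "(\<Sum>i=1..card B. g u (e i) * g v (e i)) = g u v"
proof -
  have eT: "e i \<in> T" if "i \<in> {1..card B}" for i
    using e that by (simp add: orthonormal_def)
  have "g u v = g (\<Sum>i=1..card B. g u (e i) *\<^sub>R e i) v"
    using orthonormal_expansion[OF B e u] by simp
  also have "\<dots> = (\<Sum>i=1..card B. g (g u (e i) *\<^sub>R e i) v)"
    using eT by (intro lin_on_sum[OF lin_left[OF v] sub]) (auto simp: closed)
  also have "\<dots> = (\<Sum>i=1..card B. g u (e i) * g v (e i))"
    using eT v by (intro sum.cong) (auto simp: left sym)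
  finally show ?thesis ..
qed

end

section \<open>Algebraic curvature tensors and the Kaehler case\<close>

text \<open>Linearity is asked for in the last slot, where for \<open>Riem\<close> it is just
  linearity of the metric; the symmetries carry it to the other slots (\<open>lin3\<close>,
  \<open>lin2\<close>, \<open>lin1\<close>).\<close>

locale curvature_tensor =
  fixes T :: "'v::real_vector set" and R :: "'v \<Rightarrow> 'v \<Rightarrow> 'v \<Rightarrow> 'v \<Rightarrow> real"
  assumes sub: "subspace T"
    and lin4: "u \<in> T \<Longrightarrow> v \<in> T \<Longrightarrow> w \<in> T \<Longrightarrow> lin_on T (R u v w)"
    and skew12: "u \<in> T \<Longrightarrow> v \<in> T \<Longrightarrow> w \<in> T \<Longrightarrow> z \<in> T \<Longrightarrow> R u v w z = - R v u w z"
    and skew34: "u \<in> T \<Longrightarrow> v \<in> T \<Longrightarrow> w \<in> T \<Longrightarrow> z \<in> T \<Longrightarrow> R u v w z = - R u v z w"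
    and pair: "u \<in> T \<Longrightarrow> v \<in> T \<Longrightarrow> w \<in> T \<Longrightarrow> z \<in> T \<Longrightarrow> R u v w z = R w z u v"
    and bianchi: "u \<in> T \<Longrightarrow> v \<in> T \<Longrightarrow> w \<in> T \<Longrightarrow> z \<in> T \<Longrightarrow>
      R u v w z + R v w u z + R w u v z = 0"
begin

lemmas closed = subspace_add[OF sub] subspace_diff[OF sub] subspace_scale[OF sub]
  subspace_neg[OF sub] subspace_0[OF sub]

lemma lin3:
  assumes "u \<in> T" "v \<in> T" "z \<in> T"
  shows "lin_on T (\<lambda>w. R u v w z)"
  using lin4[OF assms] skew34[OF assms(1,2) _ assms(3)] closed by (simp add: lin_on_def)

lemma lin2:
  assumes "u \<in> T" "w \<in> T" "z \<in> T"
  shows "lin_on T (\<lambda>v. R u v w z)"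
  using lin4[OF assms(2,3,1)] pair[OF assms(1) _ assms(2,3)] closed by (simp add: lin_on_def)

lemma lin1:
  assumes "v \<in> T" "w \<in> T" "z \<in> T"
  shows "lin_on T (\<lambda>u. R u v w z)"
  using lin3[OF assms(2,3,1)] pair[OF _ assms] closed by (simp add: lin_on_def)

lemmas adds = lin_on_add[OF lin4] lin_on_add[OF lin3] lin_on_add[OF lin2] lin_on_add[OF lin1]
lemmas diffs = lin_on_diff[OF lin4] lin_on_diff[OF lin3] lin_on_diff[OF lin2] lin_on_diff[OF lin1]
lemmas scales = lin_on_scale[OF lin4] lin_on_scale[OF lin3] lin_on_scale[OF lin2] lin_on_scale[OF lin1]
lemmas uminuses = lin_on_uminus[OF lin4] lin_on_uminus[OF lin3] lin_on_uminus[OF lin2] lin_on_uminus[OF lin1]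

end

locale kaehler_curvature = inner_on T g + curvature_tensor T R
  for T :: "'v::real_vector set" and g R +
  fixes J :: "'v \<Rightarrow> 'v"
  assumes J_in: "u \<in> T \<Longrightarrow> J u \<in> T"
    and J_lin: "lin_on T J"
    and JJ: "u \<in> T \<Longrightarrow> J (J u) = - u"
    and g_JJ: "u \<in> T \<Longrightarrow> v \<in> T \<Longrightarrow> g (J u) (J v) = g u v"
    and kaehler: "u \<in> T \<Longrightarrow> v \<in> T \<Longrightarrow> w \<in> T \<Longrightarrow> z \<in> T \<Longrightarrow> R u v (J w) z = - R u v w (J z)"
begin

text \<open>Adding the values at \<open>x + y\<close> and \<open>x - y\<close> cancels what is odd
  in \<open>y\<close> and doubles the six terms containing two \<open>x\<close> and two
  \<open>y\<close>. By the symmetries four of these equal \<open>R x (J y) (J y) x\<close>, and with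
  the Bianchi identity (\<open>e6\<close>) the other two equal
  \<open>R x y y x + R x (J y) (J y) x\<close>. This explains the factors 4 and 12.\<close>

lemma polarization:
  assumes x: "x \<in> T" and y: "y \<in> T"
  shows "R (x + y) (J (x + y)) (J (x + y)) (x + y) + R (x - y) (J (x - y)) (J (x - y)) (x - y) =
    2 * R x (J x) (J x) x + 2 * R y (J y) (J y) y + 4 * R x y y x + 12 * R x (J y) (J y) x"
proof -
  note m = x y J_in[OF x] J_in[OF y]
  have e5: "R x (J y) (J x) y = R x (J y) (J y) x"
    using kaehler[of x "J y" x y] skew34[of x "J y" x "J y"] m by simp
  have e2: "R y (J x) (J y) x = R y (J x) (J x) y"
    using kaehler[of y "J x" y x] skew34[of y "J x" y "J x"] m by simp
  have e3: "R y (J x) (J x) y = R x (J y) (J y) x"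
    using skew12[of y "J x" "J x" y] skew34[of "J x" y "J x" y] kaehler[of "J x" y y x]
      pair[of "J x" y "J y" x] kaehler[of "J y" x x y] skew12[of "J y" x x "J y"]
      skew34[of x "J y" x "J y"] m by simp
  have e6: "R x (J x) (J y) y = R x y y x + R x (J y) (J y) x"
    using bianchi[of x "J x" "J y" y] pair[of "J x" "J y" x y] kaehler[of x y x "J y"]
      skew34[of x y x y] skew12[of "J y" x "J x" y] e5 m
    by (simp add: JJ uminuses)
  have e1: "R y (J y) (J x) x = R x (J x) (J y) y"
    using pair[of y "J y" "J x" x] skew12[of "J x" x y "J y"] skew34[of x "J x" y "J y"] m by simp
  show ?thesis
    using e1 e2 e3 e5 e6 m
    by (simp add: lin_on_add[OF J_lin] lin_on_diff[OF J_lin] adds diffs subspace_add[OF sub]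
        subspace_diff[OF sub])
qed

text \<open>Since \<open>J (J y) = - y\<close>, replacing \<open>y\<close> by \<open>J y\<close> in
  \<open>polarization\<close> exchanges the two unknown mixed terms, so there are two linear
  equations for them.\<close>

lemma sectional_curvature:
  assumes H: "\<And>u. u \<in> T \<Longrightarrow> R u (J u) (J u) u = H * (g u u)\<^sup>2"
    and x: "x \<in> T" and y: "y \<in> T"
  shows "R x y y x = H / 4 * (g x x * g y y - (g x y)\<^sup>2 + 3 * (g (J x) y)\<^sup>2)"
proof -
  note m = x y J_in[OF x] J_in[OF y]
  have 1: "R (J y) (J (J y)) (J (J y)) (J y) = R y (J y) (J y) y"
    using skew12[of "J y" y y "J y"] skew34[of y "J y" y "J y"] m by (simp add: JJ uminuses closed)
  have 2: "R x (J (J y)) (J (J y)) x = R x y y x"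
    using m by (simp add: JJ uminuses closed)
  have gJ: "g x (J y) = - g (J x) y"
    using g_JJ[of x "J y"] m by (simp add: JJ right)
  have n: "g (x + y) (x + y) = g x x + 2 * g x y + g y y"
    "g (x - y) (x - y) = g x x - 2 * g x y + g y y"
    "g (x + J y) (x + J y) = g x x - 2 * g (J x) y + g y y"
    "g (x - J y) (x - J y) = g x x + 2 * g (J x) y + g y y"
    using m sym[OF y x] sym[of "J y" x] gJ g_JJ[OF y y] by (simp_all add: left right closed)
  \<comment> \<open>Three times the equation for \<open>x\<close>, \<open>J y\<close> minus the one
    for \<open>x\<close>, \<open>y\<close> eliminates \<open>R x (J y) (J y) x\<close>; the
    coefficient 32 is 3 * 12 - 4.\<close>
  have "32 * R x y y x = 3 * (H * (g (x + J y) (x + J y))\<^sup>2 + H * (g (x - J y) (x - J y))\<^sup>2)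
      - (H * (g (x + y) (x + y))\<^sup>2 + H * (g (x - y) (x - y))\<^sup>2)
      - 4 * (H * (g x x)\<^sup>2) - 4 * (H * (g y y)\<^sup>2)"
    using polarization[OF x y] polarization[OF x m(4)] 1 2 H m
    by (simp add: closed)
  also have "\<dots> = 8 * (H * (g x x * g y y - (g x y)\<^sup>2 + 3 * (g (J x) y)\<^sup>2))"
    unfolding n by (simp add: power2_eq_square algebra_simps)
  finally show ?thesis by simp
qed

end

section \<open>Curvature tensors of S-space-forms at a point\<close>

text \<open>The interface between geometry and linear algebra at one point. The forms \<eta> are
  already expressed through \<open>g\<close> and \<open>\<xi>\<close>, and the set named
  \<open>L\<close> below is spelled out because the assumptions precede its definition.\<close>

locale s_curvature = inner_on T g + curvature_tensor T R
  for T :: "'v::real_vector set" and g R +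
  fixes f :: "'v \<Rightarrow> 'v" and \<xi> :: "nat \<Rightarrow> 'v" and s :: nat and c :: real
  assumes f_in: "u \<in> T \<Longrightarrow> f u \<in> T"
    and f_lin: "lin_on T f"
    and xi_in: "\<alpha> \<in> {1..s} \<Longrightarrow> \<xi> \<alpha> \<in> T"
    and xi_orthonormal: "\<alpha> \<in> {1..s} \<Longrightarrow> \<beta> \<in> {1..s} \<Longrightarrow> g (\<xi> \<alpha>) (\<xi> \<beta>) = (if \<alpha> = \<beta> then 1 else 0)"
    and ff: "u \<in> T \<Longrightarrow> f (f u) = - u + (\<Sum>\<alpha>=1..s. g u (\<xi> \<alpha>) *\<^sub>R \<xi> \<alpha>)"
    and g_ff: "u \<in> T \<Longrightarrow> v \<in> T \<Longrightarrow> g (f u) (f v) = g u v - (\<Sum>\<alpha>=1..s. g u (\<xi> \<alpha>) * g v (\<xi> \<alpha>))"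
    and g_f: "u \<in> T \<Longrightarrow> v \<in> T \<Longrightarrow> g u (f v) = - g (f u) v"
    and f_xi: "\<alpha> \<in> {1..s} \<Longrightarrow> f (\<xi> \<alpha>) = 0"
    and R_xi: "u \<in> T \<Longrightarrow> v \<in> T \<Longrightarrow> w \<in> T \<Longrightarrow> \<alpha> \<in> {1..s} \<Longrightarrow> R u v (\<xi> \<alpha>) w =
      (\<Sum>\<beta>=1..s. g v (\<xi> \<beta>)) * g (f u) (f w) - (\<Sum>\<beta>=1..s. g u (\<xi> \<beta>)) * g (f v) (f w)"
    and R_f: "u \<in> {u \<in> T. \<forall>\<alpha>\<in>{1..s}. g u (\<xi> \<alpha>) = 0} \<Longrightarrow> v \<in> {u \<in> T. \<forall>\<alpha>\<in>{1..s}. g u (\<xi> \<alpha>) = 0} \<Longrightarrow>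
      w \<in> {u \<in> T. \<forall>\<alpha>\<in>{1..s}. g u (\<xi> \<alpha>) = 0} \<Longrightarrow> z \<in> {u \<in> T. \<forall>\<alpha>\<in>{1..s}. g u (\<xi> \<alpha>) = 0} \<Longrightarrow>
      R u v (f w) z + R u v w (f z) =
      - real s * (g v w * g (f u) z - g u w * g (f v) z - g (f u) w * g v z + g (f v) w * g u z)"
    and R_hol: "u \<in> {u \<in> T. \<forall>\<alpha>\<in>{1..s}. g u (\<xi> \<alpha>) = 0} \<Longrightarrow> g u u = 1 \<Longrightarrow> R u (f u) (f u) u = c"
begin

definition L :: "'v set" where
  "L = {u \<in> T. \<forall>\<alpha>\<in>{1..s}. g u (\<xi> \<alpha>) = 0}"

lemma LD: "u \<in> L \<Longrightarrow> u \<in> T" and L_xi: "u \<in> L \<Longrightarrow> \<alpha> \<in> {1..s} \<Longrightarrow> g u (\<xi> \<alpha>) = 0"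
  by (auto simp: L_def)

lemma subspace_L: "subspace L"
  by (rule subspaceI) (auto simp: L_def left xi_in closed)

definition \<eta>s :: "'v \<Rightarrow> real" where
  "\<eta>s u = (\<Sum>\<alpha>=1..s. g u (\<xi> \<alpha>))"

lemma \<eta>s_L: "u \<in> L \<Longrightarrow> \<eta>s u = 0"
  by (simp add: \<eta>s_def L_xi)

lemma g_f_xi: "u \<in> T \<Longrightarrow> \<alpha> \<in> {1..s} \<Longrightarrow> g (f u) (\<xi> \<alpha>) = 0"
  using g_f[of u "\<xi> \<alpha>"] xi_in[of \<alpha>] f_xi[of \<alpha>] by (simp add: right)

lemma f_in_L: "u \<in> T \<Longrightarrow> f u \<in> L"
  by (simp add: L_def f_in g_f_xi)

text \<open>On \<open>L\<close> the Kaehler identity fails for \<open>R\<close> exactly as it fails for \<open>s\<close> times the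
  curvature tensor of the unit sphere.\<close>

definition B :: "'v \<Rightarrow> 'v \<Rightarrow> 'v \<Rightarrow> 'v \<Rightarrow> real" where
  "B u v w z = R u v w z - real s * (g v w * g u z - g u w * g v z)"

lemma kaehler_B: "kaehler_curvature L g B f"
proof (unfold_locales, goal_cases)
  case 1 show ?case by (rule subspace_L)
next
  case (2 u v) then show ?case by (simp add: sym LD)
next
  case (3 u) then show ?case using lin[of u] by (simp add: lin_on_def LD)
next
  case (4 u) then show ?case using pos[of u] by (simp add: LD)
next
  case (5 u v w)
  then have m: "u \<in> T" "v \<in> T" "w \<in> T" by (simp_all add: LD)
  show ?case
    using lin_onD[OF lin4[OF m]] lin_onD[OF lin[OF m(1)]] lin_onD[OF lin[OF m(2)]]
    by (simp add: lin_on_def B_def LD algebra_simps)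
next
  case (6 u v w z) then show ?case
    using skew12[of u v w z] by (simp add: B_def LD algebra_simps)
next
  case (7 u v w z) then show ?case
    using skew34[of u v w z] by (simp add: B_def LD algebra_simps)
next
  case (8 u v w z) then show ?case
    using pair[of u v w z] sym[of v z] sym[of u w] sym[of u z] sym[of v w]
    by (simp add: B_def LD algebra_simps)
next
  case (9 u v w z) then show ?case
    using bianchi[of u v w z] sym[of u v] sym[of u w] sym[of v w]
    by (simp add: B_def LD algebra_simps)
next
  case (10 u) then show ?case by (simp add: f_in_L LD)
next
  case 11 show ?case using f_lin by (simp add: lin_on_def LD)
next
  case (12 u) then show ?case using ff[of u] by (simp add: LD L_xi)
next
  case (13 u v) then show ?case using g_ff[of u v] by (simp add: LD L_xi)
next
  case (14 u v w z)
  then have m: "u \<in> T" "v \<in> T" "w \<in> T" "z \<in> T" by (simp_all add: LD)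
  show ?case
    using R_f[of u v w z] 14 g_f[OF m(1,3)] g_f[OF m(2,3)] g_f[OF m(1,4)] g_f[OF m(2,4)]
    by (simp add: B_def L_def algebra_simps)
qed

text \<open>Both sides are homogeneous of degree four, so it suffices to treat a unit vector
  \<open>v\<close>; there the sphere tensor has the value 1 on the orthonormal pair
  \<open>v\<close>, \<open>f v\<close>, and \<open>s\<close> times it is subtracted from
  \<open>c\<close>.\<close>

lemma hol_sectional_B:
  assumes u: "u \<in> L"
  shows "B u (f u) (f u) u = (c - real s) * (g u u)\<^sup>2"
proof (cases "u = 0")
  interpret K: kaehler_curvature L g B f by (rule kaehler_B)
  case True
  then show ?thesis
    using lin_on_zero[OF K.lin4 subspace_L, of u "f u" "f u"] lin_on_zero[OF lin sub, of 0] u K.J_in[OF u]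
    by (simp add: closed)
next
  interpret K: kaehler_curvature L g B f by (rule kaehler_B)
  case False
  have uT: "u \<in> T" by (rule LD[OF u])
  note p = pos[OF uT False]
  define a where "a = sqrt (g u u)"
  have a: "a > 0" "g u u = a\<^sup>2" using p by (simp_all add: a_def)
  define v where "v = (1 / a) *\<^sub>R u"
  have v: "v \<in> L" "v \<in> T" "u = a *\<^sub>R v" using u uT a by (auto simp: v_def closed subspace_scale[OF subspace_L])
  have gv: "g v v = 1" using uT a by (simp add: v_def left right closed power2_eq_square)
  have "g (f v) (f v) = 1" "g (f v) v = 0"
    using g_ff[OF v(2,2)] gv L_xi[OF v(1)] g_f[OF v(2,2)] sym[OF v(2) f_in[OF v(2)]] by simp_all
  moreover have "R v (f v) (f v) v = c" using R_hol[of v] v(1) gv by (simp add: L_def)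
  ultimately have "B v (f v) (f v) v = c - real s"
    using gv sym[OF v(2) f_in[OF v(2)]] by (simp add: B_def)
  moreover have "B u (f u) (f u) u = a ^ 4 * B v (f v) (f v) v"
    using v(1) K.J_in[OF v(1)]
    by (simp add: v(3) lin_on_scale[OF K.J_lin] K.scales K.closed power4_eq_xxxx mult.assoc)
  ultimately show ?thesis by (simp add: a(2) power_mult[symmetric])
qed

text \<open>Split each vector into \<open>P u\<close> in \<open>L\<close> and \<open>V u\<close> in
  the span of the structure vectors. A structure vector in the third slot is governed by
  \<open>R_xi\<close>, so the components \<open>V\<close> are removed one slot at a time, the
  symmetries bringing each slot into third position. What remains is \<open>R\<close> on
  \<open>L\<close>, where \<open>K.sectional_curvature\<close> applies to \<open>B\<close>;
  restoring the sphere part turns (c - s)/4 into (c + 3 s)/4.\<close>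

lemma sectional_curvature:
  assumes u: "u \<in> T" and v: "v \<in> T"
  shows "R u v v u = g (f u) (f u) * (\<eta>s v)\<^sup>2 - 2 * \<eta>s u * (g (f u) (f v) * \<eta>s v)
    + g (f v) (f v) * (\<eta>s u)\<^sup>2
    + (c + 3 * real s) / 4 * (g (f u) (f u) * g (f v) (f v) - (g (f u) (f v))\<^sup>2)
    + 3 * (c - real s) / 4 * (g (f u) v)\<^sup>2"
proof -
  interpret K: kaehler_curvature L g B f by (rule kaehler_B)
  define V where "V u = (\<Sum>\<alpha>=1..s. g u (\<xi> \<alpha>) *\<^sub>R \<xi> \<alpha>)" for u
  define P where "P u = - f (f u)" for u
  have split: "u = P u + V u" if "u \<in> T" for u
    using ff[OF that] by (simp add: P_def V_def)
  have VT: "V u \<in> T" for u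
    unfolding V_def by (intro subspace_sum[OF sub] subspace_scale[OF sub] xi_in) auto
  have PL: "P u \<in> L" if "u \<in> T" for u
    unfolding P_def by (intro subspace_neg[OF subspace_L] f_in_L f_in that)
  have PT: "P u \<in> T" if "u \<in> T" for u
    by (rule LD[OF PL[OF that]])
  have RV: "R a b (V w) z = \<eta>s w * (\<eta>s b * g (f a) (f z) - \<eta>s a * g (f b) (f z))"
    if "a \<in> T" "b \<in> T" "z \<in> T" for a b w z
  proof -
    have "R a b (V w) z = (\<Sum>\<alpha>=1..s. R a b (g w (\<xi> \<alpha>) *\<^sub>R \<xi> \<alpha>) z)"
      unfolding V_def by (rule lin_on_sum[OF lin3[OF that] sub]) (auto simp: closed xi_in)
    also have "\<dots> = (\<Sum>\<alpha>=1..s. g w (\<xi> \<alpha>) * (\<eta>s b * g (f a) (f z) - \<eta>s a * g (f b) (f z)))"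
      using that by (intro sum.cong) (auto simp: lin_on_scale[OF lin3] xi_in R_xi \<eta>s_def)
    also have "\<dots> = \<eta>s w * (\<eta>s b * g (f a) (f z) - \<eta>s a * g (f b) (f z))"
      by (simp add: \<eta>s_def sum_distrib_right)
    finally show ?thesis .
  qed
  have Rsplit: "R a b w z = R a b (P w) z + \<eta>s w * (\<eta>s b * g (f a) (f z) - \<eta>s a * g (f b) (f z))"
    if "a \<in> T" "b \<in> T" "w \<in> T" "z \<in> T" for a b w z
    using lin_on_add[OF lin3[OF that(1,2,4)] PT[OF that(3)] VT[of w]] split[OF that(3)] RV[OF that(1,2,4), of w]
    by simp
  have fV: "f (V w) = 0" for w
  proof -
    have "f (V w) = (\<Sum>\<alpha>=1..s. f (g w (\<xi> \<alpha>) *\<^sub>R \<xi> \<alpha>))"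
      unfolding V_def by (rule lin_on_sum[OF f_lin sub]) (auto simp: closed xi_in)
    then show ?thesis by (simp add: lin_on_scale[OF f_lin] xi_in f_xi)
  qed
  have fP: "f (P w) = f w" if "w \<in> T" for w
    using lin_on_add[OF f_lin PT[OF that] VT[of w]] split[OF that] fV[of w] by simp
  have gP: "g (P a) (P b) = g (f a) (f b)" if "a \<in> T" "b \<in> T" for a b
    using g_ff[OF PT[OF that(1)] PT[OF that(2)]] fP that L_xi[OF PL[OF that(1)]] by simp
  have gfP: "g (f (P a)) (P b) = g (f a) b" if "a \<in> T" "b \<in> T" for a b
    using g_f[OF PT[OF that(1)] PT[OF that(2)]] g_f[OF PT[OF that(1)] that(2)]
      fP[OF that(1)] fP[OF that(2)] by simp
  note m = u v PT[OF u] PT[OF v]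
  have 1: "R u v v u = R u v (P v) u + \<eta>s v * (\<eta>s v * g (f u) (f u) - \<eta>s u * g (f v) (f u))"
    by (rule Rsplit[OF u v v u])
  have 2: "R u v u (P v) = R u v (P u) (P v) + \<eta>s u * (\<eta>s v * g (f u) (f v) - \<eta>s u * g (f v) (f v))"
    using Rsplit[of u v u "P v"] m fP[OF v] by simp
  \<comment> \<open>Now the first two arguments lie in \<open>L\<close>, where
    \<open>\<eta>s\<close> vanishes, so \<open>Rsplit\<close> yields no further correction.\<close>
  have 3: "R (P u) (P v) u v = R (P u) (P v) (P u) v"
    using Rsplit[of "P u" "P v" u v] m \<eta>s_L[OF PL[OF u]] \<eta>s_L[OF PL[OF v]] by simp
  have 4: "R (P u) (P v) v (P u) = R (P u) (P v) (P v) (P u)"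
    using Rsplit[of "P u" "P v" v "P u"] m \<eta>s_L[OF PL[OF u]] \<eta>s_L[OF PL[OF v]] by simp
  have 5: "R (P u) (P v) (P v) (P u) = (c - real s) / 4 * (g (P u) (P u) * g (P v) (P v) - (g (P u) (P v))\<^sup>2
      + 3 * (g (f (P u)) (P v))\<^sup>2) + real s * (g (P u) (P u) * g (P v) (P v) - (g (P u) (P v))\<^sup>2)"
    using K.sectional_curvature[OF hol_sectional_B PL[OF u] PL[OF v]] sym[OF m(3,4)]
    by (simp add: B_def power2_eq_square algebra_simps)
  have "R u v v u = R (P u) (P v) (P v) (P u) + g (f u) (f u) * (\<eta>s v)\<^sup>2
      - 2 * \<eta>s u * (g (f u) (f v) * \<eta>s v) + g (f v) (f v) * (\<eta>s u)\<^sup>2"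
    using 1 2 3 4 skew34[of u v "P v" u] skew34[of "P u" "P v" "P u" v] pair[of u v "P u" "P v"]
      m sym[OF f_in[OF u] f_in[OF v]]
    by (simp add: power2_eq_square algebra_simps)
  then show ?thesis
    unfolding 5 gP[OF u u] gP[OF v v] gP[OF u v] gfP[OF u v] by (simp add: field_simps)
qed

text \<open>The frame need not be adapted to \<open>L\<close>, so the sums are organised by
  matrices: \<open>F\<close> is the matrix of the orthogonal projection onto \<open>L\<close>, hence
  idempotent (\<open>S4\<close>) with trace 2n (\<open>S1\<close>); \<open>h\<close> is the
  coordinate vector of \<open>x\<close>, of squared length s (\<open>S2\<close>) and annihilated by
  \<open>F\<close> (\<open>S3\<close>); the rows of \<open>w\<close> have the squared lengths
  \<open>F i i\<close> (\<open>S5\<close>).\<close>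

lemma scalar_curvature:
  assumes Bs: "independent Bs" "span Bs = T" "finite Bs" "card Bs = 2 * n + s"
    and e: "orthonormal (2 * n + s) e"
  shows "(\<Sum>i=1..2 * n + s. \<Sum>j=1..2 * n + s. if i = j then 0 else R (e i) (e j) (e j) (e i)) / 2 =
    real n * (real n - 1) * (c + 3 * real s) / 2 + real n * (c + 2 * real s)"
proof -
  let ?N = "2 * n + s"
  note pars = parseval[OF Bs(1-3), unfolded Bs(4), OF e]
  have eT: "e i \<in> T" if "i \<in> {1..?N}" for i using e that by (simp add: orthonormal_def)
  define F where "F i j = g (f (e i)) (f (e j))" for i j
  define h where "h i = \<eta>s (e i)" for i
  define w where "w i j = g (f (e i)) (e j)" for i j
  \<comment> \<open>As \<open>\<eta>s\<close> is the inner product with this vector, sums involving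
    \<open>h\<close> become instances of Parseval's identity.\<close>
  define x where "x = (\<Sum>\<alpha>=1..s. \<xi> \<alpha>)"
  have xT: "x \<in> T" unfolding x_def by (intro subspace_sum[OF sub] xi_in) auto
  have gx: "g x u = \<eta>s u" if "u \<in> T" for u
    unfolding x_def \<eta>s_def using that
    by (subst lin_on_sum[OF lin_left[OF that] sub]) (auto simp: xi_in sym intro!: sum.cong)
  have fx: "f x = 0"
    unfolding x_def by (subst lin_on_sum[OF f_lin sub]) (auto simp: xi_in f_xi)
  have S1: "(\<Sum>i=1..?N. F i i) = 2 * real n"
  proof -
    have "(\<Sum>i=1..?N. F i i) = (\<Sum>i=1..?N. 1 - (\<Sum>\<alpha>=1..s. g (\<xi> \<alpha>) (e i) * g (\<xi> \<alpha>) (e i)))"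
      using e by (intro sum.cong) (auto simp: F_def g_ff eT orthonormal_def sym xi_in intro!: sum.cong)
    also have "\<dots> = real ?N - (\<Sum>\<alpha>=1..s. \<Sum>i=1..?N. g (\<xi> \<alpha>) (e i) * g (\<xi> \<alpha>) (e i))"
      by (simp only: sum_subtractf sum.swap[of _ "{1..s}"]) simp
    also have "(\<Sum>\<alpha>=1..s. \<Sum>i=1..?N. g (\<xi> \<alpha>) (e i) * g (\<xi> \<alpha>) (e i)) = (\<Sum>\<alpha>=1..s. 1)"
    proof (rule sum.cong[OF refl])
      fix \<alpha> assume a: "\<alpha> \<in> {1..s}"
      show "(\<Sum>i=1..?N. g (\<xi> \<alpha>) (e i) * g (\<xi> \<alpha>) (e i)) = 1"
        using pars[OF xi_in[OF a] xi_in[OF a]] xi_orthonormal[OF a a] by simp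
    qed
    finally show ?thesis by simp
  qed
  have S2: "(\<Sum>j=1..?N. (h j)\<^sup>2) = real s"
  proof -
    have "(\<Sum>j=1..?N. (h j)\<^sup>2) = (\<Sum>j=1..?N. g x (e j) * g x (e j))"
      by (intro sum.cong) (simp_all add: h_def gx eT power2_eq_square)
    also have "\<dots> = \<eta>s x" by (simp only: pars[OF xT xT] gx[OF xT])
    also have "\<dots> = (\<Sum>\<alpha>=1..s. \<Sum>\<beta>=1..s. g (\<xi> \<beta>) (\<xi> \<alpha>))"
      unfolding \<eta>s_def by (intro sum.cong) (simp_all add: gx \<eta>s_def xi_in sym)
    also have "\<dots> = (\<Sum>\<alpha>=1..s. \<Sum>\<beta>=1..s. if \<beta> = \<alpha> then 1 else 0)"
      by (intro sum.cong) (auto simp: xi_orthonormal)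
    finally show ?thesis by simp
  qed
  have F_alt: "F i j = - g (f (f (e i))) (e j)" if "i \<in> {1..?N}" "j \<in> {1..?N}" for i j
    using g_f[OF f_in[OF eT[OF that(1)]] eT[OF that(2)]] by (simp add: F_def)
  have S3: "(\<Sum>j=1..?N. F i j * h j) = 0" if i: "i \<in> {1..?N}" for i
  proof -
    have "(\<Sum>j=1..?N. F i j * h j) = - (\<Sum>j=1..?N. g (f (f (e i))) (e j) * g x (e j))"
      unfolding sum_negf[symmetric] using i by (intro sum.cong) (simp_all add: F_alt h_def gx eT)
    also have "\<dots> = - g (f (f (e i))) x" by (simp only: pars[OF f_in[OF f_in[OF eT[OF i]]] xT])
    also have "\<dots> = g (f (e i)) (f x)" using g_f[OF f_in[OF eT[OF i]] xT] by simp
    finally show ?thesis using fx f_in[OF eT[OF i]] by (simp add: right)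
  qed
  have S4: "(\<Sum>j=1..?N. (F i j)\<^sup>2) = F i i" if i: "i \<in> {1..?N}" for i
  proof -
    note ffe = f_in[OF f_in[OF eT[OF i]]]
    have "(\<Sum>j=1..?N. (F i j)\<^sup>2) = (\<Sum>j=1..?N. g (f (f (e i))) (e j) * g (f (f (e i))) (e j))"
      using i by (intro sum.cong) (simp_all add: F_alt power2_eq_square)
    also have "\<dots> = g (f (f (e i))) (f (f (e i)))" by (rule pars[OF ffe ffe])
    also have "\<dots> = F i i"
      using g_ff[OF f_in[OF eT[OF i]] f_in[OF eT[OF i]]] g_f_xi[OF eT[OF i]] by (simp add: F_def)
    finally show ?thesis .
  qed
  have S5: "(\<Sum>j=1..?N. (w i j)\<^sup>2) = F i i" if i: "i \<in> {1..?N}" for i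
    using pars[OF f_in[OF eT[OF i]] f_in[OF eT[OF i]]] by (simp add: w_def F_def power2_eq_square)
  have diag: "R u u u u = 0" if "u \<in> T" for u
    using skew12[OF that that that that] by simp
  \<comment> \<open>For \<open>i = j\<close> the right-hand side is the value of \<open>R\<close> on
    four equal vectors, which is 0 by \<open>diag\<close>; the double sum can therefore run over all
    pairs.\<close>
  have K: "(if i = j then 0 else R (e i) (e j) (e j) (e i)) =
      F i i * (h j)\<^sup>2 - 2 * h i * (F i j * h j) + F j j * (h i)\<^sup>2
      + (c + 3 * real s) / 4 * (F i i * F j j - (F i j)\<^sup>2) + 3 * (c - real s) / 4 * (w i j)\<^sup>2"
    if "i \<in> {1..?N}" "j \<in> {1..?N}" for i j
    using sectional_curvature[OF eT[OF that(1)] eT[OF that(2)]] diag[OF eT[OF that(1)]]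
    by (auto simp: F_def h_def w_def)
  have "(\<Sum>i=1..?N. \<Sum>j=1..?N. if i = j then 0 else R (e i) (e j) (e j) (e i)) =
      (\<Sum>i=1..?N. \<Sum>j=1..?N. F i i * (h j)\<^sup>2 - 2 * h i * (F i j * h j) + F j j * (h i)\<^sup>2
      + (c + 3 * real s) / 4 * (F i i * F j j - (F i j)\<^sup>2) + 3 * (c - real s) / 4 * (w i j)\<^sup>2)"
    by (intro sum.cong K refl)
  also have "\<dots> = (\<Sum>i=1..?N. F i i * real s + 2 * real n * (h i)\<^sup>2
      + (c + 3 * real s) / 4 * (F i i * (2 * real n) - F i i) + 3 * (c - real s) / 4 * F i i)"
    by (intro sum.cong refl)
      (simp only: sum.distrib sum_subtractf sum_distrib_left[symmetric] sum_distrib_right[symmetric]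
        S1 S2 S3 S4 S5 mult_zero_right diff_zero)
  also have "\<dots> = 4 * real n * real s + (c + 3 * real s) / 4 * (4 * (real n)\<^sup>2 - 2 * real n)
      + 3 * (c - real s) / 4 * (2 * real n)"
    by (simp only: sum.distrib sum_subtractf sum_distrib_left[symmetric] sum_distrib_right[symmetric] S1 S2)
      (simp add: power2_eq_square algebra_simps)
  finally show ?thesis by (simp add: power2_eq_square field_simps)
qed

end

section \<open>Brackets, connections and curvature of vector fields\<close>

lemma act_lie:
  "smooth_near A p h \<Longrightarrow>
    act (lie A X Y p) h = act (X p) (\<lambda>q. act (Y q) h) - act (Y p) (\<lambda>q. act (X q) h)"
  by (simp add: lie_def)

lemma act_lie_not_smooth: "\<not> smooth_near A p h \<Longrightarrow> act (lie A X Y p) h = 0"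
  by (simp add: lie_def)

lemma lie_swap: "lie A Y X p = - lie A X Y p"
  by (rule tvec_eqI) (simp add: lie_def)

lemma lie_zero:
  assumes "X p \<in> tangent_space A p"
  shows "lie A X (\<lambda>q. 0) p = 0"
  by (rule tvec_eqI) (simp add: lie_def act_const[OF assms])

text \<open>The rules for connections want all fields smooth on one common open set, whereas each
  \<open>ext A p u\<close> comes with its own neighbourhood; finitely many can be
  intersected.\<close>

lemma vector_fields_exist:
  fixes A :: "('a::{t2_space,second_countable_topology}, 'e::euclidean_space) chart set"
  assumes at: "smooth_atlas A" and "finite U" "U \<subseteq> tangent_space A p"
  shows "\<exists>W. p \<in> W \<and> open W \<and> (\<forall>u\<in>U. smooth_vf A W (ext A p u))"
  using assms(2,3)
proof (induction U)
  case empty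
  show ?case by (intro exI[of _ UNIV]) simp
next
  case (insert u U)
  then obtain W where W: "p \<in> W" "open W" "\<forall>u\<in>U. smooth_vf A W (ext A p u)" by auto
  obtain V where V: "p \<in> V" "smooth_vf A V (ext A p u)"
    using ext_extends(1)[OF at] insert.prems by blast
  have "open (W \<inter> V)" using W V smooth_vf_openD by blast
  then show ?case
    using W V smooth_vf_subset[of A W _ "W \<inter> V"] smooth_vf_subset[of A V _ "W \<inter> V"]
    by (intro exI[of _ "W \<inter> V"]) auto
qed

section \<open>The Levi-Civita connection and the symmetries of its curvature\<close>

locale riemannian_connection =
  fixes A :: "('a::{t2_space,second_countable_topology}, 'e::euclidean_space) chart set"
    and g :: "'a \<Rightarrow> 'a tvec \<Rightarrow> 'a tvec \<Rightarrow> real"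
    and nabla :: "'a vfield \<Rightarrow> 'a vfield \<Rightarrow> 'a vfield"
  assumes atlas: "smooth_atlas A" and metric: "riemannian_metric A g" and lc: "levi_civita A g nabla"
begin

sublocale I: inner_on "tangent_space A p" "g p" for p
  using metric subspace_tangent_space by unfold_locales (auto simp: riemannian_metric_def)

lemma connection: "connection A nabla"
  using lc by (simp add: levi_civita_def)

lemma smooth_nabla: "smooth_vf A W X \<Longrightarrow> smooth_vf A W Y \<Longrightarrow> smooth_vf A W (nabla X Y)"
  using connection unfolding connection_def by blast

lemma nabla_add_right:
  "smooth_vf A W X \<Longrightarrow> smooth_vf A W Y \<Longrightarrow> smooth_vf A W Z \<Longrightarrow> p \<in> W \<Longrightarrow>
    nabla X (\<lambda>q. Y q + Z q) p = nabla X Y p + nabla X Z p"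
  using connection unfolding connection_def by blast

lemma nabla_scale_left:
  "smooth_vf A W X \<Longrightarrow> smooth_vf A W Y \<Longrightarrow> smooth_fun A W h \<Longrightarrow> p \<in> W \<Longrightarrow>
    nabla (\<lambda>q. h q *\<^sub>R X q) Y p = h p *\<^sub>R nabla X Y p"
  using connection unfolding connection_def by blast

lemma nabla_scale_right:
  "smooth_vf A W X \<Longrightarrow> smooth_vf A W Y \<Longrightarrow> smooth_fun A W h \<Longrightarrow> p \<in> W \<Longrightarrow>
    nabla X (\<lambda>q. h q *\<^sub>R Y q) p = act (X p) h *\<^sub>R Y p + h p *\<^sub>R nabla X Y p"
  using connection unfolding connection_def by blast

lemma nabla_cscale_left:
  assumes "smooth_vf A W X" "smooth_vf A W Y" "p \<in> W"
  shows "nabla (\<lambda>q. c *\<^sub>R X q) Y p = c *\<^sub>R nabla X Y p"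
  by (rule nabla_scale_left[OF assms(1,2) smooth_fun_const assms(3)])
    (rule smooth_vf_openD[OF assms(1)])

lemma nabla_cscale_right:
  assumes "smooth_vf A W X" "smooth_vf A W Y" "p \<in> W"
  shows "nabla X (\<lambda>q. c *\<^sub>R Y q) p = c *\<^sub>R nabla X Y p"
  using nabla_scale_right[OF assms(1,2) smooth_fun_const[OF smooth_vf_openD[OF assms(1)]] assms(3), of c]
    act_const[OF smooth_vf_tangent[OF assms(1,3)]] by simp

lemma nabla_diff_right:
  assumes "smooth_vf A W X" "smooth_vf A W Y" "smooth_vf A W Z" "p \<in> W"
  shows "nabla X (\<lambda>q. Y q - Z q) p = nabla X Y p - nabla X Z p"
  using nabla_add_right[OF assms(1,2) smooth_vf_cscale[OF atlas assms(3), of "-1"] assms(4)]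
    nabla_cscale_right[OF assms(1,3,4), of "-1"] by simp

text \<open>Multiplying by the indicator function of \<open>W\<close> turns fields that agree on \<open>W\<close> into
  equal functions.\<close>

lemma nabla_cong:
  assumes X: "smooth_vf A W X" "smooth_vf A W X'" and Y: "smooth_vf A W Y" "smooth_vf A W Y'"
    and eq: "\<And>q. q \<in> W \<Longrightarrow> X q = X' q" "\<And>q. q \<in> W \<Longrightarrow> Y q = Y' q" and p: "p \<in> W"
  shows "nabla X Y p = nabla X' Y' p"
proof -
  let ?i = "indicator W :: 'a \<Rightarrow> real"
  have oW: "open W" by (rule smooth_vf_openD[OF X(1)])
  have i: "smooth_fun A W ?i"
    by (rule smooth_fun_cong[OF atlas smooth_fun_const[OF oW, of A 1]]) simp
  have i1: "?i p = 1" using p by simp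
  have i0: "act v ?i = 0" if "v \<in> tangent_space A p" for v
    using act_cong[OF atlas that oW p, of ?i "\<lambda>q. 1"] act_const[OF that] by simp
  have "(\<lambda>q. ?i q *\<^sub>R X q) = (\<lambda>q. ?i q *\<^sub>R X' q)" "(\<lambda>q. ?i q *\<^sub>R Y q) = (\<lambda>q. ?i q *\<^sub>R Y' q)"
    using eq by (auto simp: indicator_def fun_eq_iff)
  then have "nabla X Y p = nabla X' Y p" "nabla X' Y p = nabla X' Y' p"
    using nabla_scale_left[OF X(1) Y(1) i p] nabla_scale_left[OF X(2) Y(1) i p]
      nabla_scale_right[OF X(2) Y(1) i p] nabla_scale_right[OF X(2) Y(2) i p]
      i0[OF smooth_vf_tangent[OF X(2) p]] i1 by simp_all
  then show ?thesis by simp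
qed

lemma torsion_free:
  "smooth_vf A W X \<Longrightarrow> smooth_vf A W Y \<Longrightarrow> p \<in> W \<Longrightarrow> lie A X Y p = nabla X Y p - nabla Y X p"
  using lc unfolding levi_civita_def by metis

lemma metric_compatible:
  "smooth_vf A W X \<Longrightarrow> smooth_vf A W Y \<Longrightarrow> smooth_vf A W Z \<Longrightarrow> p \<in> W \<Longrightarrow>
    act (X p) (\<lambda>q. g q (Y q) (Z q)) = g p (nabla X Y p) (Z p) + g p (Y p) (nabla X Z p)"
  using lc unfolding levi_civita_def by blast

lemma smooth_metric:
  "smooth_vf A W X \<Longrightarrow> smooth_vf A W Y \<Longrightarrow> smooth_fun A W (\<lambda>p. g p (X p) (Y p))"
  using metric unfolding riemannian_metric_def by blast

text \<open>Vanishing torsion writes the bracket as a difference of covariant derivatives, which are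
  smooth fields; no coordinate computation is involved.\<close>

lemma smooth_lie:
  assumes "smooth_vf A W X" "smooth_vf A W Y"
  shows "smooth_vf A W (lie A X Y)"
  by (rule smooth_vf_cong[OF atlas smooth_vf_diff[OF atlas smooth_nabla[OF assms] smooth_nabla[OF assms(2,1)]]])
    (simp add: torsion_free[OF assms])

text \<open>On a smooth \<open>h\<close> the third derivatives cancel in pairs. The inner bracket
  may be expanded under an outer derivative only near points where \<open>h\<close> is smooth, hence
  the set \<open>W \<inter> V\<close> and \<open>act_cong\<close>.\<close>

lemma jacobi:
  assumes X: "smooth_vf A W X" and Y: "smooth_vf A W Y" and Z: "smooth_vf A W Z" and p: "p \<in> W"
  shows "lie A (lie A X Y) Z p + lie A (lie A Y Z) X p + lie A (lie A Z X) Y p = 0"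
proof (rule tvec_eqI)
  fix h
  show "act (lie A (lie A X Y) Z p + lie A (lie A Y Z) X p + lie A (lie A Z X) Y p) h = act 0 h"
  proof (cases "smooth_near A p h")
    case False
    then show ?thesis by (simp add: act_lie_not_smooth)
  next
    case True
    then obtain V where V: "p \<in> V" "smooth_fun A V h" by (auto simp: smooth_near_def)
    have oW: "open W" by (rule smooth_vf_openD[OF X])
    have "open (W \<inter> V)" using oW smooth_fun_openD[OF V(2)] by blast
    then have h: "smooth_fun A (W \<inter> V) h" using smooth_fun_subset[OF V(2)] by blast
    have pV: "p \<in> W \<inter> V" using p V(1) by simp
    have s1: "smooth_fun A (W \<inter> V) (\<lambda>q. act (Y q) h)" if "smooth_vf A W Y" for Y
      using smooth_vf_act[OF that _ h] by simp
    have s2: "smooth_near A p (\<lambda>q. act (X q) (\<lambda>q. act (Y q) h))"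
      if "smooth_vf A W X" "smooth_vf A W Y" for X Y
      using smooth_nearI[OF smooth_vf_act[OF that(1) _ s1[OF that(2)]] pV] by simp
    have d: "act (lie A (lie A X Y) Z p) h =
        act (X p) (\<lambda>q. act (Y q) (\<lambda>q. act (Z q) h)) - act (Y p) (\<lambda>q. act (X q) (\<lambda>q. act (Z q) h))
        - (act (Z p) (\<lambda>q. act (X q) (\<lambda>q. act (Y q) h)) - act (Z p) (\<lambda>q. act (Y q) (\<lambda>q. act (X q) h)))"
      if X: "smooth_vf A W X" and Y: "smooth_vf A W Y" and Z: "smooth_vf A W Z" for X Y Z
    proof -
      note tZ = smooth_vf_tangent[OF Z p]
      have "act (Z p) (\<lambda>q. act (lie A X Y q) h) =
          act (Z p) (\<lambda>q. act (X q) (\<lambda>q. act (Y q) h) - act (Y q) (\<lambda>q. act (X q) h))"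
        by (rule act_cong[OF atlas tZ \<open>open (W \<inter> V)\<close> pV]) (simp add: act_lie smooth_nearI[OF h])
      then show ?thesis
        by (simp add: act_lie True smooth_nearI[OF s1[OF Z] pV] act_diff[OF tZ s2[OF X Y] s2[OF Y X]])
    qed
    show ?thesis by (simp add: d[OF X Y Z] d[OF Y Z X] d[OF Z X Y])
  qed
qed

lemma smooth_curvature:
  assumes "smooth_vf A W X" "smooth_vf A W Y" "smooth_vf A W Z" "p \<in> W"
  shows "curvature A nabla X Y Z p \<in> tangent_space A p"
  using smooth_vf_tangent[OF smooth_nabla[OF assms(1) smooth_nabla[OF assms(2,3)]] assms(4)]
    smooth_vf_tangent[OF smooth_nabla[OF assms(2) smooth_nabla[OF assms(1,3)]] assms(4)]
    smooth_vf_tangent[OF smooth_nabla[OF smooth_lie[OF assms(1,2)] assms(3)] assms(4)]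
  by (simp add: curvature_def I.closed)

definition Rm :: "'a vfield \<Rightarrow> 'a vfield \<Rightarrow> 'a vfield \<Rightarrow> 'a vfield \<Rightarrow> 'a \<Rightarrow> real" where
  "Rm X Y Z V p = g p (curvature A nabla X Y Z p) (V p)"

lemma Rm_expand:
  assumes "smooth_vf A W X" "smooth_vf A W Y" "smooth_vf A W Z" "smooth_vf A W V" "p \<in> W"
  shows "Rm X Y Z V p = g p (nabla X (nabla Y Z) p) (V p) - g p (nabla Y (nabla X Z) p) (V p)
    - g p (nabla (lie A X Y) Z p) (V p)"
  using smooth_vf_tangent[OF smooth_nabla[OF assms(1) smooth_nabla[OF assms(2,3)]] assms(5)]
    smooth_vf_tangent[OF smooth_nabla[OF assms(2) smooth_nabla[OF assms(1,3)]] assms(5)]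
    smooth_vf_tangent[OF smooth_nabla[OF smooth_lie[OF assms(1,2)] assms(3)] assms(5)]
    smooth_vf_tangent[OF assms(4,5)]
  by (simp add: Rm_def curvature_def I.left I.closed)

lemma Rm_skew12:
  assumes "smooth_vf A W X" "smooth_vf A W Y" "smooth_vf A W Z" "smooth_vf A W V" "p \<in> W"
  shows "Rm X Y Z V p = - Rm Y X Z V p"
proof -
  have "lie A Y X = (\<lambda>q. (-1) *\<^sub>R lie A X Y q)"
    by (rule ext) (subst lie_swap, simp)
  then have "nabla (lie A Y X) Z p = - nabla (lie A X Y) Z p"
    using nabla_cscale_left[OF smooth_lie[OF assms(1,2)] assms(3,5), of "-1"] by simp
  then have "curvature A nabla X Y Z p = - curvature A nabla Y X Z p"
    by (simp add: curvature_def)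
  then show ?thesis
    using smooth_curvature[OF assms(2,1,3,5)] smooth_vf_tangent[OF assms(4,5)]
    by (simp add: Rm_def I.left)
qed

text \<open>Apply \<open>X Y - Y X - [X, Y]\<close>, which kills every function, to
  \<open>g(Z, V)\<close>. Metric compatibility expands the result to
  \<open>Rm X Y Z V p + Rm X Y V Z p\<close>, the products of first derivatives cancelling.\<close>

lemma Rm_skew34:
  assumes X: "smooth_vf A W X" and Y: "smooth_vf A W Y" and Z: "smooth_vf A W Z" and V: "smooth_vf A W V"
    and p: "p \<in> W"
  shows "Rm X Y Z V p = - Rm X Y V Z p"
proof -
  have oW: "open W" by (rule smooth_vf_openD[OF X])
  have D: "act (X p) (\<lambda>q. act (Y q) (\<lambda>q. g q (Z q) (V q))) =
      g p (nabla X (nabla Y Z) p) (V p) + g p (nabla Y Z p) (nabla X V p)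
      + (g p (nabla X Z p) (nabla Y V p) + g p (Z p) (nabla X (nabla Y V) p))"
    if X: "smooth_vf A W X" and Y: "smooth_vf A W Y" for X Y
  proof -
    note tX = smooth_vf_tangent[OF X p]
    note YZ = smooth_nabla[OF Y Z] and YV = smooth_nabla[OF Y V]
    have "act (X p) (\<lambda>q. act (Y q) (\<lambda>q. g q (Z q) (V q))) =
        act (X p) (\<lambda>q. g q (nabla Y Z q) (V q) + g q (Z q) (nabla Y V q))"
      by (rule act_cong[OF atlas tX oW p]) (rule metric_compatible[OF Y Z V])
    also have "\<dots> = act (X p) (\<lambda>q. g q (nabla Y Z q) (V q)) + act (X p) (\<lambda>q. g q (Z q) (nabla Y V q))"
      by (rule act_add[OF tX smooth_nearI[OF smooth_metric[OF YZ V] p] smooth_nearI[OF smooth_metric[OF Z YV] p]])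
    finally show ?thesis
      by (simp only: metric_compatible[OF X YZ V p] metric_compatible[OF X Z YV p])
  qed
  have "act (lie A X Y p) (\<lambda>q. g q (Z q) (V q)) =
      g p (nabla (lie A X Y) Z p) (V p) + g p (Z p) (nabla (lie A X Y) V p)"
    by (rule metric_compatible[OF smooth_lie[OF X Y] Z V p])
  moreover have "act (lie A X Y p) (\<lambda>q. g q (Z q) (V q)) =
      act (X p) (\<lambda>q. act (Y q) (\<lambda>q. g q (Z q) (V q))) - act (Y p) (\<lambda>q. act (X q) (\<lambda>q. g q (Z q) (V q)))"
    by (rule act_lie[OF smooth_nearI[OF smooth_metric[OF Z V] p]])
  moreover have s: "g p (Z p) (U p) = g p (U p) (Z p)" if "smooth_vf A W U" for U
    using I.sym[OF smooth_vf_tangent[OF Z p] smooth_vf_tangent[OF that p]] .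
  ultimately show ?thesis
    using D[OF X Y] D[OF Y X] s[OF smooth_nabla[OF X smooth_nabla[OF Y V]]]
      s[OF smooth_nabla[OF Y smooth_nabla[OF X V]]] s[OF smooth_nabla[OF smooth_lie[OF X Y] V]]
    unfolding Rm_expand[OF X Y Z V p] Rm_expand[OF X Y V Z p] by linarith
qed

text \<open>Regroup the nine terms so that each group has the shape treated in \<open>N\<close>,
  where vanishing torsion turns it into a double bracket; the sum is then the Jacobi
  identity.\<close>

lemma Rm_bianchi:
  assumes X: "smooth_vf A W X" and Y: "smooth_vf A W Y" and Z: "smooth_vf A W Z" and V: "smooth_vf A W V"
    and p: "p \<in> W"
  shows "Rm X Y Z V p + Rm Y Z X V p + Rm Z X Y V p = 0"
proof -
  have N: "nabla X (nabla Y Z) p - nabla X (nabla Z Y) p - nabla (lie A Y Z) X p = - lie A (lie A Y Z) X p"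
    if X: "smooth_vf A W X" and Y: "smooth_vf A W Y" and Z: "smooth_vf A W Z" for X Y Z
  proof -
    note YZ = smooth_nabla[OF Y Z] and ZY = smooth_nabla[OF Z Y]
    have "nabla X (nabla Y Z) p - nabla X (nabla Z Y) p = nabla X (\<lambda>q. nabla Y Z q - nabla Z Y q) p"
      by (rule nabla_diff_right[OF X YZ ZY p, symmetric])
    also have "\<dots> = nabla X (lie A Y Z) p"
      by (rule nabla_cong[OF X X smooth_vf_diff[OF atlas YZ ZY] smooth_lie[OF Y Z] refl _ p])
        (simp add: torsion_free[OF Y Z])
    finally show ?thesis by (simp add: torsion_free[OF smooth_lie[OF Y Z] X p])
  qed
  have "curvature A nabla X Y Z p + curvature A nabla Y Z X p + curvature A nabla Z X Y p =
      (nabla X (nabla Y Z) p - nabla X (nabla Z Y) p - nabla (lie A Y Z) X p)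
      + (nabla Y (nabla Z X) p - nabla Y (nabla X Z) p - nabla (lie A Z X) Y p)
      + (nabla Z (nabla X Y) p - nabla Z (nabla Y X) p - nabla (lie A X Y) Z p)"
    unfolding curvature_def by simp
  also have "\<dots> = - (lie A (lie A X Y) Z p + lie A (lie A Y Z) X p + lie A (lie A Z X) Y p)"
    unfolding N[OF X Y Z] N[OF Y Z X] N[OF Z X Y] by simp
  also have "\<dots> = 0" using jacobi[OF X Y Z p] by simp
  finally have 0: "curvature A nabla X Y Z p + curvature A nabla Y Z X p + curvature A nabla Z X Y p = 0" .
  have "Rm X Y Z V p + Rm Y Z X V p + Rm Z X Y V p =
      g p (curvature A nabla X Y Z p + curvature A nabla Y Z X p + curvature A nabla Z X Y p) (V p)"
    using smooth_curvature[OF X Y Z p] smooth_curvature[OF Y Z X p] smooth_curvature[OF Z X Y p]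
      smooth_vf_tangent[OF V p] by (simp add: Rm_def I.left I.closed)
  then show ?thesis using 0 smooth_vf_tangent[OF V p] by (simp add: I.left)
qed

text \<open>The classical combination of the Bianchi identities for the four cyclic rotations of
  \<open>X, Y, Z, V\<close>, compared through the two skew symmetries.\<close>

lemma Rm_pair:
  assumes X: "smooth_vf A W X" and Y: "smooth_vf A W Y" and Z: "smooth_vf A W Z" and V: "smooth_vf A W V"
    and p: "p \<in> W"
  shows "Rm X Y Z V p = Rm Z V X Y p"
  using Rm_bianchi[OF X Y Z V p] Rm_bianchi[OF Y Z V X p] Rm_bianchi[OF Z V X Y p] Rm_bianchi[OF V X Y Z p]
    Rm_skew34[OF X Y Z V p] Rm_skew34[OF Y Z V X p] Rm_skew34[OF Z V X Y p] Rm_skew34[OF V X Y Z p]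
    Rm_skew34[OF X Z Y V p] Rm_skew34[OF Y V Z X p] Rm_skew12[OF X Z Y V p] Rm_skew12[OF Y V Z X p]
    Rm_skew12[OF X Z V Y p] Rm_skew12[OF Y V X Z p] Rm_skew34[OF Z X Y V p] Rm_skew34[OF V Y Z X p]
  by linarith

text \<open>\<open>Rm\<close> visibly depends only on the value of its last argument at \<open>p\<close>; by its symmetries the
  same holds for all arguments.\<close>

lemma Rm_pointwise:
  assumes X: "smooth_vf A W X" "smooth_vf A W X'" and Y: "smooth_vf A W Y" "smooth_vf A W Y'"
    and Z: "smooth_vf A W Z" "smooth_vf A W Z'" and V: "smooth_vf A W V" and p: "p \<in> W"
    and eq: "X p = X' p" "Y p = Y' p" "Z p = Z' p"
  shows "Rm X Y Z V p = Rm X' Y' Z' V p"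
proof -
  have 3: "Rm X Y Z V p = Rm X Y Z' V p"
    if "smooth_vf A W X" "smooth_vf A W Y" "smooth_vf A W Z" "smooth_vf A W Z'" "smooth_vf A W V" "Z p = Z' p"
    for X Y Z Z' V
    using Rm_skew34[OF that(1,2,3,5) p] Rm_skew34[OF that(1,2,4,5) p] that(6) by (simp add: Rm_def)
  have "Rm X Y Z V p = Rm X Y Z' V p" by (rule 3[OF X(1) Y(1) Z V eq(3)])
  also have "\<dots> = Rm Z' V X Y p" by (rule Rm_pair[OF X(1) Y(1) Z(2) V p])
  also have "\<dots> = Rm Z' V X Y' p" by (simp add: Rm_def eq(2))
  also have "\<dots> = Rm Z' V X' Y' p" by (rule 3[OF Z(2) V X Y(2) eq(1)])
  also have "\<dots> = Rm X' Y' Z' V p" by (rule Rm_pair[OF Z(2) V X(2) Y(2) p])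
  finally show ?thesis .
qed

text \<open>This removes the arbitrary choice \<open>ext\<close> from \<open>Riem\<close>: curvature
  at \<open>p\<close> may be computed with convenient fields, in particular
  \<open>\<xi> \<alpha>\<close> and images under \<open>f\<close>.\<close>

lemma Riem_eq_Rm:
  assumes X: "smooth_vf A W X" and Y: "smooth_vf A W Y" and Z: "smooth_vf A W Z" and V: "smooth_vf A W V"
    and p: "p \<in> W"
  shows "Riem A g nabla p (X p) (Y p) (Z p) (V p) = Rm X Y Z V p"
proof -
  have t: "X p \<in> tangent_space A p" "Y p \<in> tangent_space A p" "Z p \<in> tangent_space A p"
    using smooth_vf_tangent p X Y Z by blast+
  then have "finite {X p, Y p, Z p}" "{X p, Y p, Z p} \<subseteq> tangent_space A p" by simp_all
  from vector_fields_exist[OF atlas this] obtain W' where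
    W': "p \<in> W'" "open W'" "\<forall>u\<in>{X p, Y p, Z p}. smooth_vf A W' (ext A p u)" by blast
  have o: "open (W \<inter> W')" using smooth_vf_openD[OF X] W'(2) by blast
  have r: "smooth_vf A (W \<inter> W') U" if "smooth_vf A W U" for U
    using smooth_vf_subset[OF that o] by simp
  have r': "smooth_vf A (W \<inter> W') (ext A p u)" if "u \<in> {X p, Y p, Z p}" for u
    using smooth_vf_subset[OF bspec[OF W'(3) that] o] by simp
  have "Rm (ext A p (X p)) (ext A p (Y p)) (ext A p (Z p)) V p = Rm X Y Z V p"
    by (rule Rm_pointwise[OF r' r[OF X] r' r[OF Y] r' r[OF Z] r[OF V]])
      (use p W'(1) ext_extends(2)[OF atlas] t in auto)
  then show ?thesis by (simp add: Riem_def Rm_def)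
qed

lemma curvature_tensor_Riem: "curvature_tensor (tangent_space A p) (Riem A g nabla p)"
proof -
  let ?T = "tangent_space A p" and ?R = "Riem A g nabla p" and ?e = "ext A p"
  have red: "\<exists>W. p \<in> W \<and> smooth_vf A W (?e u) \<and> smooth_vf A W (?e v) \<and> smooth_vf A W (?e w) \<and>
      smooth_vf A W (?e z)" if "u \<in> ?T" "v \<in> ?T" "w \<in> ?T" "z \<in> ?T" for u v w z
  proof -
    have "finite {u, v, w, z}" "{u, v, w, z} \<subseteq> tangent_space A p" using that by simp_all
    from vector_fields_exist[OF atlas this] show ?thesis by simp blast
  qed
  have R: "?R u v w z = Rm (?e u) (?e v) (?e w) (?e z) p"
    if "z \<in> ?T" for u v w z
    by (simp add: Riem_def Rm_def ext_extends(2)[OF atlas that])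
  show ?thesis
  proof (unfold_locales, goal_cases)
    case 1 show ?case by (rule subspace_tangent_space)
  next
    case (2 u v w)
    from red[OF this 2(3)] obtain W where W: "p \<in> W" "smooth_vf A W (?e u)" "smooth_vf A W (?e v)"
      "smooth_vf A W (?e w)" by blast
    have "curvature A nabla (?e u) (?e v) (?e w) p \<in> ?T"
      by (rule smooth_curvature[OF W(2-4,1)])
    then show ?case using I.lin unfolding Riem_def by blast
  next
    case (3 u v w z)
    from red[OF this] show ?case using 3 by (auto simp: R intro: Rm_skew12)
  next
    case (4 u v w z)
    from red[OF this] show ?case using 4 by (auto simp: R intro: Rm_skew34)
  next
    case (5 u v w z)
    from red[OF this] show ?case using 5 by (auto simp: R intro: Rm_pair)
  next
    case (6 u v w z)
    from red[OF this] show ?case using 6 by (auto simp: R intro: Rm_bianchi)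
  qed
qed

end

section \<open>S-manifolds\<close>

text \<open>The algebra behind the formula for \<open>\<nabla>f\<close>: \<open>F\<close> stands for the action of \<open>f\<close> on vector
  fields and \<open>D\<close> for the difference of the two sides.\<close>

lemma f_trilinear_vanishes:
  fixes D :: "'v \<Rightarrow> 'v \<Rightarrow> 'v \<Rightarrow> real"
  assumes F: "\<And>x. x \<in> S \<Longrightarrow> F x \<in> S"
    and skew: "\<And>x y z. x \<in> S \<Longrightarrow> y \<in> S \<Longrightarrow> z \<in> S \<Longrightarrow> D x y z = - D x z y"
    and cyc: "\<And>x y z. x \<in> S \<Longrightarrow> y \<in> S \<Longrightarrow> z \<in> S \<Longrightarrow> D x y z + D y z x + D z x y = 0"
    and move: "\<And>x y z. x \<in> S \<Longrightarrow> y \<in> S \<Longrightarrow> z \<in> S \<Longrightarrow> D x (F y) z = D x y (F z)"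
    and normal: "\<And>x y z. x \<in> S \<Longrightarrow> y \<in> S \<Longrightarrow> z \<in> S \<Longrightarrow>
      D (F x) y z - D (F y) x z - D y x (F z) + D x y (F z) = 0"
    and x: "x \<in> S" and y: "y \<in> S" and z: "z \<in> S"
  shows "D x y (F z) = 0"
proof -
  have skewP: "D x y (F z) = - D x z (F y)" if "x \<in> S" "y \<in> S" "z \<in> S" for x y z
    using skew[of x y "F z"] move[of x z y] F that by simp
  \<comment> \<open>In terms of \<open>E\<close>, the assumption \<open>normal\<close> says that
    \<open>E\<close> is symmetric in its first two arguments. It is also skew in the last two, and
    both together force \<open>E = 0\<close>.\<close>
  define E where "E x y z = D (F x) y z + D x y (F z)" for x y z
  have Esym: "E x y z = E y x z" if "x \<in> S" "y \<in> S" "z \<in> S" for x y z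
    using normal[OF that] by (simp add: E_def)
  have Eskew: "E x y z = - E x z y" if "x \<in> S" "y \<in> S" "z \<in> S" for x y z
    using skew[of "F x" y z] skewP[OF that] F that by (simp add: E_def)
  have E0: "E x y z = 0" if "x \<in> S" "y \<in> S" "z \<in> S" for x y z
    using Esym[of x y z] Eskew[of y x z] Esym[of y z x] Eskew[of z y x] Esym[of z x y] Eskew[of x z y] that
    by simp
  \<comment> \<open>The cyclic identity for \<open>F x\<close>, \<open>y\<close>, \<open>z\<close>,
    with \<open>E0\<close> used on the first term and \<open>move\<close> on the third. Adding two
    cyclic instances of \<open>P\<close> leaves twice the wanted term equal to 0.\<close>
  have P: "D y z (F x) + D z x (F y) = D x y (F z)" if "x \<in> S" "y \<in> S" "z \<in> S" for x y z
    using cyc[of "F x" y z] E0[OF that] move[of z x y] F that by (simp add: E_def)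
  show ?thesis
    using P[OF y z x] P[OF z x y] by simp
qed

section \<open>Structure equations of S-manifolds: bracket relations and \<nabla>\<xi>\<close>

locale s_manifold = riemannian_connection A g nabla
  for A :: "('a::{t2_space,second_countable_topology}, 'e::euclidean_space) chart set" and g nabla +
  fixes n s :: nat and f :: "'a \<Rightarrow> 'a tvec \<Rightarrow> 'a tvec" and \<xi> :: "nat \<Rightarrow> 'a vfield"
    and \<eta> :: "nat \<Rightarrow> 'a \<Rightarrow> 'a tvec \<Rightarrow> real"
  assumes S: "S_manifold A n s f \<xi> \<eta> g"
begin

lemma metric_f: "metric_f_manifold A n s f \<xi> \<eta> g"
  using S by (simp add: S_manifold_def)

lemma s_ge_1: "s \<ge> 1" and dimension: "DIM('e) = 2 * n + s" and tensor_f: "tensor11 A f"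
  using metric_f by (simp_all add: metric_f_manifold_def)

lemma f_lin: "lin_on (tangent_space A p) (f p)"
  and f_in: "u \<in> tangent_space A p \<Longrightarrow> f p u \<in> tangent_space A p"
  and smooth_f: "smooth_vf A W X \<Longrightarrow> smooth_vf A W (\<lambda>q. f q (X q))"
  using tensor_f by (auto simp: tensor11_def)

lemma f_diff: "u \<in> tangent_space A p \<Longrightarrow> v \<in> tangent_space A p \<Longrightarrow> f p (u - v) = f p u - f p v"
  by (rule lin_on_diff[OF f_lin])

lemma f_0 [simp]: "f p 0 = 0"
  by (rule lin_on_zero[OF f_lin subspace_tangent_space])

lemma smooth_xi:
  assumes "\<alpha> \<in> {1..s}" "open W"
  shows "smooth_vf A W (\<xi> \<alpha>)"
proof -
  have "smooth_vf A UNIV (\<xi> \<alpha>)" using metric_f assms(1) unfolding metric_f_manifold_def by blast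
  then show ?thesis using smooth_vf_subset assms(2) by blast
qed

lemma xi_in: "\<alpha> \<in> {1..s} \<Longrightarrow> \<xi> \<alpha> p \<in> tangent_space A p"
  using smooth_vf_tangent[OF smooth_xi[OF _ open_UNIV]] by blast

lemma f_xi [simp]: "\<alpha> \<in> {1..s} \<Longrightarrow> f p (\<xi> \<alpha> p) = 0"
  using metric_f unfolding metric_f_manifold_def by blast

lemma f_xi_field: "\<alpha> \<in> {1..s} \<Longrightarrow> (\<lambda>q. f q (\<xi> \<alpha> q)) = (\<lambda>q. 0)"
  by simp

lemma eta_eq: "u \<in> tangent_space A p \<Longrightarrow> \<alpha> \<in> {1..s} \<Longrightarrow> \<eta> \<alpha> p u = g p u (\<xi> \<alpha> p)"
  using metric_f unfolding metric_f_manifold_def by blast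

lemma xi_orthonormal:
  "\<alpha> \<in> {1..s} \<Longrightarrow> \<beta> \<in> {1..s} \<Longrightarrow> g p (\<xi> \<alpha> p) (\<xi> \<beta> p) = (if \<alpha> = \<beta> then 1 else 0)"
proof -
  assume a: "\<alpha> \<in> {1..s}" "\<beta> \<in> {1..s}"
  then have "\<eta> \<beta> p (\<xi> \<alpha> p) = (if \<beta> = \<alpha> then 1 else 0)"
    using metric_f unfolding metric_f_manifold_def by blast
  then show ?thesis using eta_eq[OF xi_in[OF a(1)] a(2)] by simp
qed

lemma ff:
  assumes "u \<in> tangent_space A p"
  shows "f p (f p u) = - u + (\<Sum>\<alpha>=1..s. g p u (\<xi> \<alpha> p) *\<^sub>R \<xi> \<alpha> p)"
proof -
  have "f p (f p u) = - u + (\<Sum>\<alpha>=1..s. \<eta> \<alpha> p u *\<^sub>R \<xi> \<alpha> p)"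
    using metric_f assms unfolding metric_f_manifold_def by blast
  then show ?thesis by (simp add: eta_eq[OF assms])
qed

lemma g_ff:
  assumes "u \<in> tangent_space A p" "v \<in> tangent_space A p"
  shows "g p (f p u) (f p v) = g p u v - (\<Sum>\<alpha>=1..s. g p u (\<xi> \<alpha> p) * g p v (\<xi> \<alpha> p))"
proof -
  have "g p (f p u) (f p v) = g p u v - (\<Sum>\<alpha>=1..s. \<eta> \<alpha> p u * \<eta> \<alpha> p v)"
    using metric_f assms unfolding metric_f_manifold_def by blast
  then show ?thesis by (simp add: eta_eq assms)
qed

lemma g_f: "u \<in> tangent_space A p \<Longrightarrow> v \<in> tangent_space A p \<Longrightarrow> g p u (f p v) = - g p (f p u) v"
  using metric_f unfolding metric_f_manifold_def by blast

lemma g_f_xi: "u \<in> tangent_space A p \<Longrightarrow> \<alpha> \<in> {1..s} \<Longrightarrow> g p (f p u) (\<xi> \<alpha> p) = 0"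
  using g_f[of u p "\<xi> \<alpha> p"] xi_in[of \<alpha> p] by (simp add: I.right)

lemma g_ff_left:
  assumes "u \<in> tangent_space A p" "v \<in> tangent_space A p"
  shows "g p (f p (f p u)) v = - g p u v + (\<Sum>\<alpha>=1..s. g p u (\<xi> \<alpha> p) * g p v (\<xi> \<alpha> p))"
  using g_f[OF f_in[OF assms(1)] assms(2)] g_ff[OF assms] by simp

lemma smooth_act_fun:
  "smooth_vf A W X \<Longrightarrow> smooth_fun A W h \<Longrightarrow> smooth_fun A W (\<lambda>q. act (X q) h)"
  by (rule smooth_vf_act[OF _ order_refl])

lemma d_eta:
  assumes X: "smooth_vf A W X" and Y: "smooth_vf A W Y" and p: "p \<in> W" and \<alpha>: "\<alpha> \<in> {1..s}"
  shows "2 * g p (X p) (f p (Y p)) = act (X p) (\<lambda>q. g q (Y q) (\<xi> \<alpha> q)) - act (Y p) (\<lambda>q. g q (X q) (\<xi> \<alpha> q))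
    - g p (lie A X Y p) (\<xi> \<alpha> p)"
proof -
  have oW: "open W" by (rule smooth_vf_openD[OF X])
  have "g p (X p) (f p (Y p)) = extd A (\<eta> \<alpha>) X Y p"
    using S X Y p \<alpha> unfolding S_manifold_def by blast
  moreover have "act (X p) (\<lambda>q. \<eta> \<alpha> q (Y q)) = act (X p) (\<lambda>q. g q (Y q) (\<xi> \<alpha> q))"
    by (rule act_cong[OF atlas smooth_vf_tangent[OF X p] oW p]) (rule eta_eq[OF smooth_vf_tangent[OF Y] \<alpha>])
  moreover have "act (Y p) (\<lambda>q. \<eta> \<alpha> q (X q)) = act (Y p) (\<lambda>q. g q (X q) (\<xi> \<alpha> q))"
    by (rule act_cong[OF atlas smooth_vf_tangent[OF Y p] oW p]) (rule eta_eq[OF smooth_vf_tangent[OF X] \<alpha>])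
  moreover have "\<eta> \<alpha> p (lie A X Y p) = g p (lie A X Y p) (\<xi> \<alpha> p)"
    by (rule eta_eq[OF smooth_vf_tangent[OF smooth_lie[OF X Y] p] \<alpha>])
  ultimately show ?thesis by (simp add: extd_def)
qed

lemma extd_eq:
  assumes "smooth_vf A W X" "smooth_vf A W Y" "p \<in> W" "\<alpha> \<in> {1..s}"
  shows "extd A (\<eta> \<alpha>) X Y p = g p (X p) (f p (Y p))"
  using S assms unfolding S_manifold_def by metis

lemma normality:
  assumes "smooth_vf A W X" "smooth_vf A W Y" "p \<in> W"
  shows "nijenhuis A f X Y p + 2 *\<^sub>R (\<Sum>\<alpha>=1..s. g p (X p) (f p (Y p)) *\<^sub>R \<xi> \<alpha> p) = 0"
proof -
  have "nijenhuis A f X Y p + 2 *\<^sub>R (\<Sum>\<alpha>=1..s. extd A (\<eta> \<alpha>) X Y p *\<^sub>R \<xi> \<alpha> p) = 0"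
    using S assms unfolding S_manifold_def normal_f_structure_def by blast
  then show ?thesis by (simp add: extd_eq[OF assms])
qed

text \<open>This is d\<Phi> = 0 in terms of brackets, and holds because \<Phi> is the exact form
  d\<eta>, here for the index 1, available by \<open>s_ge_1\<close>. Second derivatives cancel and
  the double brackets vanish by \<open>jacobi\<close>.\<close>

lemma Phi_closed:
  assumes X: "smooth_vf A W X" and Y: "smooth_vf A W Y" and Z: "smooth_vf A W Z" and p: "p \<in> W"
  shows "act (X p) (\<lambda>q. g q (Y q) (f q (Z q))) + act (Y p) (\<lambda>q. g q (Z q) (f q (X q)))
    + act (Z p) (\<lambda>q. g q (X q) (f q (Y q))) =
    g p (lie A X Y p) (f p (Z p)) + g p (lie A Y Z p) (f p (X p)) + g p (lie A Z X p) (f p (Y p))"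
proof -
  have \<alpha>: "1 \<in> {1..s}" using s_ge_1 by simp
  have oW: "open W" by (rule smooth_vf_openD[OF X])
  let ?x = "\<xi> 1"
  note xi = smooth_xi[OF \<alpha> oW]
  have d: "2 * act (X p) (\<lambda>q. g q (Y q) (f q (Z q))) =
      act (X p) (\<lambda>q. act (Y q) (\<lambda>q. g q (Z q) (?x q))) - act (X p) (\<lambda>q. act (Z q) (\<lambda>q. g q (Y q) (?x q)))
      - act (X p) (\<lambda>q. g q (lie A Y Z q) (?x q))"
    if X: "smooth_vf A W X" and Y: "smooth_vf A W Y" and Z: "smooth_vf A W Z" for X Y Z
  proof -
    note tX = smooth_vf_tangent[OF X p]
    note s1 = smooth_act_fun[OF Y smooth_metric[OF Z xi]] and s2 = smooth_act_fun[OF Z smooth_metric[OF Y xi]]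
      and s3 = smooth_metric[OF smooth_lie[OF Y Z] xi]
    have "2 * act (X p) (\<lambda>q. g q (Y q) (f q (Z q))) = act (X p) (\<lambda>q. 2 * g q (Y q) (f q (Z q)))"
      by (rule act_cmult[OF tX smooth_nearI[OF smooth_metric[OF Y smooth_f[OF Z]] p], symmetric])
    also have "\<dots> = act (X p) (\<lambda>q. act (Y q) (\<lambda>q. g q (Z q) (?x q)) - act (Z q) (\<lambda>q. g q (Y q) (?x q))
        - g q (lie A Y Z q) (?x q))"
      by (rule act_cong[OF atlas tX oW p]) (rule d_eta[OF Y Z _ \<alpha>])
    also have "\<dots> = act (X p) (\<lambda>q. act (Y q) (\<lambda>q. g q (Z q) (?x q)) - act (Z q) (\<lambda>q. g q (Y q) (?x q)))
        - act (X p) (\<lambda>q. g q (lie A Y Z q) (?x q))"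
      by (rule act_diff[OF tX smooth_nearI[OF smooth_fun_diff[OF atlas s1 s2] p] smooth_nearI[OF s3 p]])
    also have "act (X p) (\<lambda>q. act (Y q) (\<lambda>q. g q (Z q) (?x q)) - act (Z q) (\<lambda>q. g q (Y q) (?x q))) =
        act (X p) (\<lambda>q. act (Y q) (\<lambda>q. g q (Z q) (?x q))) - act (X p) (\<lambda>q. act (Z q) (\<lambda>q. g q (Y q) (?x q)))"
      by (rule act_diff[OF tX smooth_nearI[OF s1 p] smooth_nearI[OF s2 p]])
    finally show ?thesis .
  qed
  have b: "2 * g p (lie A X Y p) (f p (Z p)) =
      act (X p) (\<lambda>q. act (Y q) (\<lambda>q. g q (Z q) (?x q))) - act (Y p) (\<lambda>q. act (X q) (\<lambda>q. g q (Z q) (?x q)))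
      - act (Z p) (\<lambda>q. g q (lie A X Y q) (?x q)) - g p (lie A (lie A X Y) Z p) (?x p)"
    if X: "smooth_vf A W X" and Y: "smooth_vf A W Y" and Z: "smooth_vf A W Z" for X Y Z
    using d_eta[OF smooth_lie[OF X Y] Z p \<alpha>] act_lie[OF smooth_nearI[OF smooth_metric[OF Z xi] p], of X Y]
    by simp
  have t: "lie A (lie A X Y) Z p \<in> tangent_space A p"
    if X: "smooth_vf A W X" and Y: "smooth_vf A W Y" and Z: "smooth_vf A W Z" for X Y Z
    by (rule smooth_vf_tangent[OF smooth_lie[OF smooth_lie[OF X Y] Z] p])
  have "g p (lie A (lie A X Y) Z p) (?x p) + g p (lie A (lie A Y Z) X p) (?x p) + g p (lie A (lie A Z X) Y p) (?x p)
      = g p (lie A (lie A X Y) Z p + lie A (lie A Y Z) X p + lie A (lie A Z X) Y p) (?x p)"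
    using t[OF X Y Z] t[OF Y Z X] t[OF Z X Y] xi_in[OF \<alpha>] by (simp add: I.left I.closed)
  also have "\<dots> = 0" unfolding jacobi[OF X Y Z p] by (rule I.left(5)[OF xi_in[OF \<alpha>]])
  finally have "g p (lie A (lie A X Y) Z p) (?x p) + g p (lie A (lie A Y Z) X p) (?x p)
      + g p (lie A (lie A Z X) Y p) (?x p) = 0" .
  then show ?thesis
    using d[OF X Y Z] d[OF Y Z X] d[OF Z X Y] b[OF X Y Z] b[OF Y Z X] b[OF Z X Y] by linarith
qed

lemma act_g_f_xi:
  assumes X: "smooth_vf A W X" and Y: "smooth_vf A W Y" and p: "p \<in> W" and \<alpha>: "\<alpha> \<in> {1..s}"
  shows "act (Y p) (\<lambda>q. g q (f q (X q)) (\<xi> \<alpha> q)) = 0"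
proof -
  have "act (Y p) (\<lambda>q. g q (f q (X q)) (\<xi> \<alpha> q)) = act (Y p) (\<lambda>q. 0)"
    by (rule act_cong[OF atlas smooth_vf_tangent[OF Y p] smooth_vf_openD[OF X] p])
      (rule g_f_xi[OF smooth_vf_tangent[OF X] \<alpha>])
  then show ?thesis using act_const[OF smooth_vf_tangent[OF Y p]] by simp
qed

lemma act_g_xi_xi:
  assumes "v \<in> tangent_space A p" "\<alpha> \<in> {1..s}" "\<beta> \<in> {1..s}"
  shows "act v (\<lambda>q. g q (\<xi> \<alpha> q) (\<xi> \<beta> q)) = 0"
  using act_const[OF assms(1)] by (simp add: xi_orthonormal[OF assms(2,3)])

text \<open>The Lie derivative of \<open>f\<close> along a structure field is zero. As
  \<open>f\<close> kills \<open>\<xi> \<alpha>\<close>, normality for \<open>X\<close> and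
  \<open>\<xi> \<alpha>\<close> puts the difference of the two sides in the kernel of
  \<open>f\<close>; \<open>d_eta\<close> shows it orthogonal to every structure field, and
  \<open>ff\<close> then leaves only 0.\<close>

lemma bracket_xi_f:
  assumes X: "smooth_vf A W X" and p: "p \<in> W" and \<alpha>: "\<alpha> \<in> {1..s}"
  shows "lie A (\<lambda>q. f q (X q)) (\<xi> \<alpha>) p = f p (lie A X (\<xi> \<alpha>) p)"
proof -
  note xi = smooth_xi[OF \<alpha> smooth_vf_openD[OF X]]
  note tX = smooth_vf_tangent[OF X p]
  let ?a = "lie A (\<lambda>q. f q (X q)) (\<xi> \<alpha>) p" and ?b = "lie A X (\<xi> \<alpha>) p"
  have ta: "?a \<in> tangent_space A p" and tb: "?b \<in> tangent_space A p"
    using smooth_vf_tangent[OF smooth_lie p] X smooth_f[OF X] xi by blast+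
  have "nijenhuis A f X (\<xi> \<alpha>) p = 0"
    using normality[OF X xi p] \<alpha> tX by (simp add: I.right)
  then have "f p (f p ?b) - f p ?a = 0"
    unfolding nijenhuis_def f_xi_field[OF \<alpha>] using lie_zero[of X p A, OF tX] lie_zero[of "\<lambda>q. f q (X q)" p A, OF f_in[OF tX]]
    by simp
  then have f0: "f p (?a - f p ?b) = 0"
    using ta tb by (simp add: f_diff f_in)
  have "g p ?a (\<xi> \<beta> p) = 0" if \<beta>: "\<beta> \<in> {1..s}" for \<beta>
    using d_eta[OF smooth_f[OF X] xi p \<beta>] act_g_f_xi[OF X xi p \<beta>]
      act_g_xi_xi[OF smooth_vf_tangent[OF smooth_f[OF X] p] \<alpha> \<beta>] \<alpha> f_in[OF tX] by (simp add: I.right)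
  then have "g p (?a - f p ?b) (\<xi> \<beta> p) = 0" if "\<beta> \<in> {1..s}" for \<beta>
    using that ta tb by (simp add: I.left f_in xi_in g_f_xi)
  then show ?thesis
    using ff[of "?a - f p ?b" p] f0 ta tb by (simp add: I.closed f_in)
qed

text \<open>The Lie derivatives of \<open>\<Phi>\<close> and \<open>f\<close> along \<open>\<xi>\<^sub>\<alpha>\<close> vanish, hence so does that of
  \<open>g(fX, fY) = g(X, Y) - \<Sum> \<eta>(X) \<eta>(Y)\<close>, and therefore \<open>\<xi>\<^sub>\<alpha>\<close> is Killing.\<close>

lemma xi_killing:
  assumes Y: "smooth_vf A W Y" and Z: "smooth_vf A W Z" and p: "p \<in> W" and \<alpha>: "\<alpha> \<in> {1..s}"
  shows "g p (nabla Y (\<xi> \<alpha>) p) (Z p) + g p (Y p) (nabla Z (\<xi> \<alpha>) p) = 0"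
proof -
  have oW: "open W" by (rule smooth_vf_openD[OF Y])
  note xi = smooth_xi[OF \<alpha> oW]
  note tx = smooth_vf_tangent[OF xi p]
  let ?x = "\<xi> \<alpha>"
  let ?y = "lie A ?x Y p" and ?z = "lie A ?x Z p"
  have ty: "?y \<in> tangent_space A p" "Y p \<in> tangent_space A p"
    using smooth_vf_tangent[OF smooth_lie[OF xi Y] p] smooth_vf_tangent[OF Y p] by blast+
  have tz: "?z \<in> tangent_space A p" "Z p \<in> tangent_space A p"
    using smooth_vf_tangent[OF smooth_lie[OF xi Z] p] smooth_vf_tangent[OF Z p] by blast+
  have fY: "lie A ?x (\<lambda>q. f q (Y q)) p = f p ?y"
    using bracket_xi_f[OF Y p \<alpha>] lie_swap[of A ?x "\<lambda>q. f q (Y q)" p] lie_swap[of A ?x Y p]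
      lin_on_uminus[OF f_lin ty(1)] by simp
  \<comment> \<open>The Lie derivative of each form \<eta> along \<open>\<xi> \<alpha>\<close>
    vanishes: d\<eta> = \<Phi> is zero on \<open>\<xi> \<alpha>\<close>, and \<eta> is constant on
    it.\<close>
  have eta: "act (?x p) (\<lambda>q. g q (U q) (\<xi> \<beta> q)) = g p (lie A ?x U p) (\<xi> \<beta> p)"
    if U: "smooth_vf A W U" and \<beta>: "\<beta> \<in> {1..s}" for U \<beta>
    using d_eta[OF xi U p \<beta>] act_g_xi_xi[OF smooth_vf_tangent[OF U p] \<alpha> \<beta>]
      g_f[OF tx smooth_vf_tangent[OF U p]] \<alpha> smooth_vf_tangent[OF U p]
    by (simp add: I.left)
  have Phi: "act (?x p) (\<lambda>q. g q (U q) (f q (Z q))) = g p (lie A ?x U p) (f p (Z p)) - g p ?z (f p (U p))"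
    if U: "smooth_vf A W U" for U
  proof -
    have tU: "U q \<in> tangent_space A q" if "q \<in> W" for q by (rule smooth_vf_tangent[OF U that])
    have "act (Z p) (\<lambda>q. g q (?x q) (f q (U q))) = act (Z p) (\<lambda>q. 0)"
      by (rule act_cong[OF atlas tz(2) oW p]) (use \<alpha> tU in \<open>simp add: g_f xi_in I.left\<close>)
    moreover have "act (U p) (\<lambda>q. g q (Z q) (f q (?x q))) = act (U p) (\<lambda>q. 0)"
      by (rule act_cong[OF atlas tU[OF p] oW p])
        (use \<alpha> in \<open>simp add: I.right smooth_vf_tangent[OF Z]\<close>)
    ultimately show ?thesis
      using Phi_closed[OF xi U Z p] act_const[OF tU[OF p]] act_const[OF tz(2)] \<alpha>
        smooth_vf_tangent[OF smooth_lie[OF U Z] p] tz tU[OF p] lie_swap[of A Z ?x p]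
      by (simp add: I.right I.left f_in)
  qed
  have s2: "smooth_near A p (\<lambda>q. g q (U q) (V q))" if "smooth_vf A W U" "smooth_vf A W V" for U V
    by (rule smooth_nearI[OF smooth_metric[OF that] p])
  have s3: "smooth_near A p (\<lambda>q. g q (Y q) (\<xi> \<beta> q) * g q (Z q) (\<xi> \<beta> q))" if "\<beta> \<in> {1..s}" for \<beta>
    using s2[OF Y smooth_xi[OF that oW]] s2[OF Z smooth_xi[OF that oW]] smooth_near_mult[OF atlas] by blast
  have "act (?x p) (\<lambda>q. g q (Y q) (Z q)) = act (?x p) (\<lambda>q. g q (f q (Y q)) (f q (Z q))
      + (\<Sum>\<beta>=1..s. g q (Y q) (\<xi> \<beta> q) * g q (Z q) (\<xi> \<beta> q)))"
    by (rule act_cong[OF atlas tx oW p]) (simp add: g_ff smooth_vf_tangent[OF Y] smooth_vf_tangent[OF Z])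
  also have "\<dots> = act (?x p) (\<lambda>q. g q (f q (Y q)) (f q (Z q)))
      + act (?x p) (\<lambda>q. \<Sum>\<beta>=1..s. g q (Y q) (\<xi> \<beta> q) * g q (Z q) (\<xi> \<beta> q))"
    by (rule act_add[OF tx s2[OF smooth_f[OF Y] smooth_f[OF Z]] smooth_near_sum[OF atlas s3]])
  also have "act (?x p) (\<lambda>q. g q (f q (Y q)) (f q (Z q))) = g p (f p ?y) (f p (Z p)) + g p (f p ?z) (f p (Y p))"
    using Phi[OF smooth_f[OF Y]] fY g_f[OF tz(1) f_in[OF ty(2)]] by simp
  also have "act (?x p) (\<lambda>q. \<Sum>\<beta>=1..s. g q (Y q) (\<xi> \<beta> q) * g q (Z q) (\<xi> \<beta> q)) =
      (\<Sum>\<beta>=1..s. g p (Y p) (\<xi> \<beta> p) * g p ?z (\<xi> \<beta> p) + g p (Z p) (\<xi> \<beta> p) * g p ?y (\<xi> \<beta> p))"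
  proof (subst act_sum[OF atlas tx s3])
    show "(\<Sum>\<beta>=1..s. act (?x p) (\<lambda>q. g q (Y q) (\<xi> \<beta> q) * g q (Z q) (\<xi> \<beta> q))) =
      (\<Sum>\<beta>=1..s. g p (Y p) (\<xi> \<beta> p) * g p ?z (\<xi> \<beta> p) + g p (Z p) (\<xi> \<beta> p) * g p ?y (\<xi> \<beta> p))"
    proof (rule sum.cong[OF refl])
      fix \<beta> assume \<beta>: "\<beta> \<in> {1..s}"
      show "act (?x p) (\<lambda>q. g q (Y q) (\<xi> \<beta> q) * g q (Z q) (\<xi> \<beta> q)) =
          g p (Y p) (\<xi> \<beta> p) * g p ?z (\<xi> \<beta> p) + g p (Z p) (\<xi> \<beta> p) * g p ?y (\<xi> \<beta> p)"
        using act_mult[OF tx s2[OF Y smooth_xi[OF \<beta> oW]] s2[OF Z smooth_xi[OF \<beta> oW]]]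
        by (simp add: eta[OF Y \<beta>] eta[OF Z \<beta>])
    qed
  qed
  finally have "act (?x p) (\<lambda>q. g q (Y q) (Z q)) = g p ?y (Z p) + g p ?z (Y p)"
    using g_ff[OF ty(1) tz(2)] g_ff[OF tz(1) ty(2)]
    by (simp add: sum.distrib mult.commute)
  then show ?thesis
    using metric_compatible[OF xi Y Z p] torsion_free[OF xi Y p] torsion_free[OF xi Z p] I.sym[OF tz(1) ty(2)]
      tz ty smooth_vf_tangent[OF smooth_nabla[OF xi Y] p] smooth_vf_tangent[OF smooth_nabla[OF xi Z] p]
      smooth_vf_tangent[OF smooth_nabla[OF Y xi] p] smooth_vf_tangent[OF smooth_nabla[OF Z xi] p]
    by (simp add: I.left I.right)
qed

text \<open>d\<eta> = \<Phi> determines the skew part of \<nabla>\<xi>, and by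
  \<open>xi_killing\<close> there is no symmetric part.\<close>

lemma nabla_xi:
  assumes Y: "smooth_vf A W Y" and p: "p \<in> W" and \<alpha>: "\<alpha> \<in> {1..s}"
  shows "nabla Y (\<xi> \<alpha>) p = - f p (Y p)"
proof -
  note xi = smooth_xi[OF \<alpha> smooth_vf_openD[OF Y]]
  note N = smooth_nabla[OF Y xi]
  have eq: "g p (nabla Y (\<xi> \<alpha>) p) (Z p) = - g p (f p (Y p)) (Z p)" if Z: "smooth_vf A W Z" for Z
  proof -
    note t = smooth_vf_tangent[OF Y p] smooth_vf_tangent[OF Z p] smooth_vf_tangent[OF xi p]
      smooth_vf_tangent[OF smooth_nabla[OF Y Z] p] smooth_vf_tangent[OF smooth_nabla[OF Z Y] p]
      smooth_vf_tangent[OF smooth_nabla[OF Y xi] p] smooth_vf_tangent[OF smooth_nabla[OF Z xi] p]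
    have "2 * g p (Y p) (f p (Z p)) = g p (Z p) (nabla Y (\<xi> \<alpha>) p) - g p (Y p) (nabla Z (\<xi> \<alpha>) p)"
      using d_eta[OF Y Z p \<alpha>] metric_compatible[OF Y Z xi p] metric_compatible[OF Z Y xi p]
        torsion_free[OF Y Z p] t by (simp add: I.left)
    then show ?thesis
      using xi_killing[OF Y Z p \<alpha>] I.sym[OF t(2,6)] g_f[OF t(1,2)] by simp
  qed
  \<comment> \<open>The difference of the two sides is itself a smooth field, so it may be paired
    with itself through \<open>eq\<close>.\<close>
  let ?r = "\<lambda>q. nabla Y (\<xi> \<alpha>) q + f q (Y q)"
  have r: "smooth_vf A W ?r" by (rule smooth_vf_add[OF atlas N smooth_f[OF Y]])
  have "g p (?r p) (?r p) = 0"
    using eq[OF r] smooth_vf_tangent[OF N p] smooth_vf_tangent[OF smooth_f[OF Y] p]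
    by (simp add: I.left I.closed)
  then have "?r p = 0" by (rule I.eq_zeroI[OF smooth_vf_tangent[OF r p]])
  then show ?thesis by (simp add: eq_neg_iff_add_eq_0)
qed

lemma act_eta:
  assumes X: "smooth_vf A W X" and Y: "smooth_vf A W Y" and p: "p \<in> W" and \<alpha>: "\<alpha> \<in> {1..s}"
  shows "act (X p) (\<lambda>q. g q (Y q) (\<xi> \<alpha> q)) = g p (nabla X Y p) (\<xi> \<alpha> p) - g p (Y p) (f p (X p))"
  using metric_compatible[OF X Y smooth_xi[OF \<alpha> smooth_vf_openD[OF X]] p] nabla_xi[OF X p \<alpha>]
    smooth_vf_tangent[OF Y p] smooth_vf_tangent[OF smooth_f[OF X] p] by (simp add: I.right)

definition eta_sum :: "'a \<Rightarrow> 'a tvec \<Rightarrow> real" where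
  "eta_sum p u = (\<Sum>\<alpha>=1..s. g p u (\<xi> \<alpha> p))"

lemma lin_eta_sum: "lin_on (tangent_space A p) (eta_sum p)"
  by (auto simp: lin_on_def eta_sum_def I.left I.closed xi_in sum.distrib sum_distrib_left)

lemma eta_sum_f: "u \<in> tangent_space A p \<Longrightarrow> eta_sum p (f p u) = 0"
  by (simp add: eta_sum_def g_f_xi)

lemma eta_sum_xi:
  assumes "\<alpha> \<in> {1..s}"
  shows "eta_sum p (\<xi> \<alpha> p) = 1"
proof -
  have "eta_sum p (\<xi> \<alpha> p) = (\<Sum>\<beta>=1..s. if \<beta> = \<alpha> then 1 else 0)"
    unfolding eta_sum_def by (intro sum.cong refl) (use xi_orthonormal[OF assms] in auto)
  then show ?thesis using assms by simp
qed

text \<open>Each of the \<open>s\<close> forms contributes the same term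
  \<open>g p (Y p) (f p (X p))\<close>, by \<open>act_eta\<close>. This is the origin of the factor
  \<open>s\<close> in \<open>Rm_f\<close>.\<close>

lemma act_eta_sum:
  assumes X: "smooth_vf A W X" and Y: "smooth_vf A W Y" and p: "p \<in> W"
  shows "act (X p) (\<lambda>q. eta_sum q (Y q)) = eta_sum p (nabla X Y p) - real s * g p (Y p) (f p (X p))"
proof -
  have "act (X p) (\<lambda>q. eta_sum q (Y q)) = (\<Sum>\<alpha>=1..s. act (X p) (\<lambda>q. g q (Y q) (\<xi> \<alpha> q)))"
    unfolding eta_sum_def
    by (rule act_sum[OF atlas smooth_vf_tangent[OF X p]])
      (rule smooth_nearI[OF smooth_metric[OF Y smooth_xi[OF _ smooth_vf_openD[OF X]]] p])
  also have "\<dots> = (\<Sum>\<alpha>=1..s. g p (nabla X Y p) (\<xi> \<alpha> p) - g p (Y p) (f p (X p)))"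
    by (intro sum.cong act_eta[OF X Y p] refl)
  finally show ?thesis by (simp add: eta_sum_def sum_subtractf)
qed

lemma smooth_eta_sum:
  assumes "smooth_vf A W Y"
  shows "smooth_fun A W (\<lambda>q. eta_sum q (Y q))"
  unfolding eta_sum_def using smooth_vf_openD[OF assms]
  by (intro smooth_fun_sum[OF atlas] smooth_metric[OF assms] smooth_xi) auto

lemma g_f_skew: "u \<in> tangent_space A p \<Longrightarrow> v \<in> tangent_space A p \<Longrightarrow> g p (f p u) v = - g p (f p v) u"
  using g_f[of v p u] I.sym[OF f_in, of u p v] by simp

lemma g_f_ff:
  assumes "u \<in> tangent_space A p" "v \<in> tangent_space A p"
  shows "g p (f p u) (f p (f p v)) = - g p (f p u) v" and "g p (f p (f p u)) (f p v) = g p (f p u) v"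
proof -
  have *: "g p (f p u) (f p (f p v)) = - g p (f p u) v" if "u \<in> tangent_space A p" "v \<in> tangent_space A p" for u v
    using g_ff[OF that(1) f_in[OF that(2)]] g_f[OF that] g_f_xi[OF that(2)] by simp
  show "g p (f p u) (f p (f p v)) = - g p (f p u) v" by (rule *[OF assms])
  show "g p (f p (f p u)) (f p v) = g p (f p u) v"
    using *[OF assms(2,1)] I.sym[OF f_in[OF f_in[OF assms(1)]] f_in[OF assms(2)]] g_f_skew[OF assms] by simp
qed

section \<open>The covariant derivative of f\<close>

text \<open>This is g((\<nabla>_X f) Y, Z); the term -g(f \<nabla>_X Y, Z) is written with
  \<open>f\<close> moved to the other side by skewness.\<close>

definition nabla_f :: "'a vfield \<Rightarrow> 'a vfield \<Rightarrow> 'a vfield \<Rightarrow> 'a \<Rightarrow> real" where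
  "nabla_f X Y Z p = g p (nabla X (\<lambda>q. f q (Y q)) p) (Z p) + g p (nabla X Y p) (f p (Z p))"

text \<open>The claimed value of (\<nabla>_u f) v paired with \<open>w\<close>; the minus sign comes
  from g(f f u, w) = -g(f u, f w).\<close>

definition \<sigma> :: "'a \<Rightarrow> 'a tvec \<Rightarrow> 'a tvec \<Rightarrow> 'a tvec \<Rightarrow> real" where
  "\<sigma> p u v w = g p (f p u) (f p v) * eta_sum p w - eta_sum p v * g p (f p u) (f p w)"

lemma \<sigma>_skew: "\<sigma> p u v w = - \<sigma> p u w v"
  by (simp add: \<sigma>_def)

lemma nabla_f_skew:
  assumes X: "smooth_vf A W X" and Y: "smooth_vf A W Y" and Z: "smooth_vf A W Z" and p: "p \<in> W"
  shows "nabla_f X Y Z p = - nabla_f X Z Y p"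
proof -
  note t = smooth_vf_tangent[OF Y] smooth_vf_tangent[OF Z] smooth_vf_tangent[OF X p]
  have "act (X p) (\<lambda>q. g q (f q (Y q)) (Z q)) = act (X p) (\<lambda>q. (-1) * g q (Y q) (f q (Z q)))"
    by (rule act_cong[OF atlas t(3) smooth_vf_openD[OF X] p]) (simp add: g_f t)
  also have "\<dots> = - act (X p) (\<lambda>q. g q (Y q) (f q (Z q)))"
    using act_cmult[OF t(3) smooth_nearI[OF smooth_metric[OF Y smooth_f[OF Z]] p], of "-1"] by simp
  finally show ?thesis
    using metric_compatible[OF X smooth_f[OF Y] Z p] metric_compatible[OF X Y smooth_f[OF Z] p]
      I.sym[OF t(1)[OF p] smooth_vf_tangent[OF smooth_nabla[OF X smooth_f[OF Z]] p]]
      I.sym[OF f_in[OF t(1)[OF p]] smooth_vf_tangent[OF smooth_nabla[OF X Z] p]]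
    by (simp add: nabla_f_def)
qed

text \<open>With vanishing torsion, the cyclic sum is d\<Phi> up to sign, so
  \<open>Phi_closed\<close> applies.\<close>

lemma nabla_f_cyclic:
  assumes X: "smooth_vf A W X" and Y: "smooth_vf A W Y" and Z: "smooth_vf A W Z" and p: "p \<in> W"
  shows "nabla_f X Y Z p + nabla_f Y Z X p + nabla_f Z X Y p = 0"
proof -
  have d: "act (X p) (\<lambda>q. g q (Y q) (f q (Z q))) = g p (nabla X Y p) (f p (Z p)) + nabla_f X Z Y p
      - g p (nabla X Z p) (f p (Y p))"
    if X: "smooth_vf A W X" and Y: "smooth_vf A W Y" and Z: "smooth_vf A W Z" for X Y Z
    using metric_compatible[OF X Y smooth_f[OF Z] p]
      I.sym[OF smooth_vf_tangent[OF Y p] smooth_vf_tangent[OF smooth_nabla[OF X smooth_f[OF Z]] p]]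
    by (simp add: nabla_f_def)
  have b: "g p (lie A X Y p) (f p (Z p)) = g p (nabla X Y p) (f p (Z p)) - g p (nabla Y X p) (f p (Z p))"
    if X: "smooth_vf A W X" and Y: "smooth_vf A W Y" and Z: "smooth_vf A W Z" for X Y Z
    using torsion_free[OF X Y p] smooth_vf_tangent[OF smooth_nabla[OF X Y] p]
      smooth_vf_tangent[OF smooth_nabla[OF Y X] p] f_in[OF smooth_vf_tangent[OF Z p]]
    by (simp add: I.left)
  show ?thesis
    using Phi_closed[OF X Y Z p] d[OF X Y Z] d[OF Y Z X] d[OF Z X Y] b[OF X Y Z] b[OF Y Z X] b[OF Z X Y]
      nabla_f_skew[OF X Y Z p] nabla_f_skew[OF Y Z X p] nabla_f_skew[OF Z X Y p] by linarith
qed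

text \<open>The left-hand side is g((\<nabla>_X f f) Y, Z). It is found by differentiating f f = -I
  + \<Sum> \<eta> \<otimes> \<xi>, with \<open>act_eta\<close> for the derivatives of the
  forms.\<close>

lemma nabla_f_move:
  assumes X: "smooth_vf A W X" and Y: "smooth_vf A W Y" and Z: "smooth_vf A W Z" and p: "p \<in> W"
  shows "nabla_f X (\<lambda>q. f q (Y q)) Z p - nabla_f X Y (\<lambda>q. f q (Z q)) p =
    - g p (f p (X p)) (Y p) * eta_sum p (Z p) - eta_sum p (Y p) * g p (f p (X p)) (Z p)"
proof -
  have oW: "open W" by (rule smooth_vf_openD[OF X])
  note t = smooth_vf_tangent[OF Y] smooth_vf_tangent[OF Z]
  note tX = smooth_vf_tangent[OF X p]
  note tXY = smooth_vf_tangent[OF smooth_nabla[OF X Y] p] and tXZ = smooth_vf_tangent[OF smooth_nabla[OF X Z] p]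
  have s: "smooth_near A p (\<lambda>q. g q (U q) (\<xi> \<beta> q))" if "smooth_vf A W U" "\<beta> \<in> {1..s}" for U \<beta>
    by (rule smooth_nearI[OF smooth_metric[OF that(1) smooth_xi[OF that(2) oW]] p])
  have s2: "smooth_near A p (\<lambda>q. g q (Y q) (\<xi> \<beta> q) * g q (Z q) (\<xi> \<beta> q))" if "\<beta> \<in> {1..s}" for \<beta>
    by (rule smooth_near_mult[OF atlas s[OF Y that] s[OF Z that]])
  have sYZ: "smooth_near A p (\<lambda>q. g q (Y q) (Z q))"
    by (rule smooth_nearI[OF smooth_metric[OF Y Z] p])
  have "act (X p) (\<lambda>q. g q (f q (f q (Y q))) (Z q)) =
      act (X p) (\<lambda>q. (\<Sum>\<beta>=1..s. g q (Y q) (\<xi> \<beta> q) * g q (Z q) (\<xi> \<beta> q)) - g q (Y q) (Z q))"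
    by (rule act_cong[OF atlas tX oW p]) (simp add: g_ff_left t)
  also have "\<dots> = act (X p) (\<lambda>q. \<Sum>\<beta>=1..s. g q (Y q) (\<xi> \<beta> q) * g q (Z q) (\<xi> \<beta> q))
      - act (X p) (\<lambda>q. g q (Y q) (Z q))"
    by (rule act_diff[OF tX smooth_near_sum[OF atlas s2] sYZ])
  also have "act (X p) (\<lambda>q. \<Sum>\<beta>=1..s. g q (Y q) (\<xi> \<beta> q) * g q (Z q) (\<xi> \<beta> q)) =
      (\<Sum>\<beta>=1..s. act (X p) (\<lambda>q. g q (Y q) (\<xi> \<beta> q) * g q (Z q) (\<xi> \<beta> q)))"
    by (rule act_sum[OF atlas tX s2])
  also have "\<dots> = (\<Sum>\<beta>=1..s. g p (Y p) (\<xi> \<beta> p) * g p (nabla X Z p) (\<xi> \<beta> p)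
      - g p (Y p) (\<xi> \<beta> p) * g p (Z p) (f p (X p))
      + (g p (nabla X Y p) (\<xi> \<beta> p) * g p (Z p) (\<xi> \<beta> p) - g p (Z p) (\<xi> \<beta> p) * g p (Y p) (f p (X p))))"
  proof (rule sum.cong[OF refl])
    fix \<beta> assume \<beta>: "\<beta> \<in> {1..s}"
    show "act (X p) (\<lambda>q. g q (Y q) (\<xi> \<beta> q) * g q (Z q) (\<xi> \<beta> q)) = g p (Y p) (\<xi> \<beta> p) * g p (nabla X Z p) (\<xi> \<beta> p)
      - g p (Y p) (\<xi> \<beta> p) * g p (Z p) (f p (X p))
      + (g p (nabla X Y p) (\<xi> \<beta> p) * g p (Z p) (\<xi> \<beta> p) - g p (Z p) (\<xi> \<beta> p) * g p (Y p) (f p (X p)))"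
      using act_mult[OF tX s[OF Y \<beta>] s[OF Z \<beta>]] act_eta[OF X Y p \<beta>] act_eta[OF X Z p \<beta>]
      by (simp add: algebra_simps)
  qed
  also have "\<dots> = (\<Sum>\<beta>=1..s. g p (Y p) (\<xi> \<beta> p) * g p (nabla X Z p) (\<xi> \<beta> p))
      - eta_sum p (Y p) * g p (Z p) (f p (X p))
      + ((\<Sum>\<beta>=1..s. g p (nabla X Y p) (\<xi> \<beta> p) * g p (Z p) (\<xi> \<beta> p)) - eta_sum p (Z p) * g p (Y p) (f p (X p)))"
    unfolding eta_sum_def by (simp only: sum.distrib sum_subtractf sum_distrib_right)
  finally have "act (X p) (\<lambda>q. g q (f q (f q (Y q))) (Z q)) = \<dots> - act (X p) (\<lambda>q. g q (Y q) (Z q))" .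
  moreover have "g p (nabla X Y p) (f p (f p (Z p))) = g p (f p (f p (nabla X Y p))) (Z p)"
    using g_f[OF tXY f_in[OF t(2)[OF p]]] g_f[OF f_in[OF tXY] t(2)[OF p]] by simp
  ultimately show ?thesis
    using metric_compatible[OF X smooth_f[OF smooth_f[OF Y]] Z p] metric_compatible[OF X Y Z p]
      g_ff_left[OF t(1)[OF p] tXZ] g_ff_left[OF tXY t(2)[OF p]]
      I.sym[OF t(1)[OF p] f_in[OF tX]] I.sym[OF t(2)[OF p] f_in[OF tX]]
    by (simp add: nabla_f_def mult.commute)
qed

text \<open>The normality condition paired with \<open>Z\<close>, every bracket being replaced by
  covariant derivatives through vanishing torsion.\<close>

lemma nabla_f_normal:
  assumes X: "smooth_vf A W X" and Y: "smooth_vf A W Y" and Z: "smooth_vf A W Z" and p: "p \<in> W"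
  shows "nabla_f (\<lambda>q. f q (X q)) Y Z p - nabla_f (\<lambda>q. f q (Y q)) X Z p
    - nabla_f Y X (\<lambda>q. f q (Z q)) p + nabla_f X Y (\<lambda>q. f q (Z q)) p =
    - 2 * g p (X p) (f p (Y p)) * eta_sum p (Z p)"
proof -
  note fX = smooth_f[OF X] and fY = smooth_f[OF Y]
  note tZ = smooth_vf_tangent[OF Z p]
  note t = smooth_vf_tangent[OF smooth_nabla[OF X Y] p] smooth_vf_tangent[OF smooth_nabla[OF Y X] p]
    smooth_vf_tangent[OF smooth_nabla[OF fX fY] p] smooth_vf_tangent[OF smooth_nabla[OF fY fX] p]
    smooth_vf_tangent[OF smooth_nabla[OF fX Y] p] smooth_vf_tangent[OF smooth_nabla[OF Y fX] p]
    smooth_vf_tangent[OF smooth_nabla[OF X fY] p] smooth_vf_tangent[OF smooth_nabla[OF fY X] p]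
  have "g p (nijenhuis A f X Y p + 2 *\<^sub>R (\<Sum>\<alpha>=1..s. g p (X p) (f p (Y p)) *\<^sub>R \<xi> \<alpha> p)) (Z p) = 0"
    using normality[OF X Y p] tZ by (simp add: I.left)
  moreover have "g p (\<Sum>\<alpha>=1..s. g p (X p) (f p (Y p)) *\<^sub>R \<xi> \<alpha> p) (Z p) =
      (\<Sum>\<alpha>=1..s. g p (g p (X p) (f p (Y p)) *\<^sub>R \<xi> \<alpha> p) (Z p))"
    by (rule lin_on_sum[OF I.lin_left[OF tZ] subspace_tangent_space]) (simp add: I.closed xi_in)
  moreover have "\<dots> = (\<Sum>\<alpha>=1..s. g p (X p) (f p (Y p)) * g p (Z p) (\<xi> \<alpha> p))"
    by (intro sum.cong refl) (simp add: I.left xi_in tZ I.sym)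
  moreover have "\<dots> = g p (X p) (f p (Y p)) * eta_sum p (Z p)"
    by (simp add: eta_sum_def sum_distrib_left)
  moreover have "(\<Sum>\<alpha>=1..s. g p (X p) (f p (Y p)) *\<^sub>R \<xi> \<alpha> p) \<in> tangent_space A p"
    by (intro subspace_sum[OF subspace_tangent_space]) (simp add: I.closed xi_in)
  moreover have "nijenhuis A f X Y p = f p (f p (nabla X Y p)) - f p (f p (nabla Y X p))
      + (nabla (\<lambda>q. f q (X q)) (\<lambda>q. f q (Y q)) p - nabla (\<lambda>q. f q (Y q)) (\<lambda>q. f q (X q)) p)
      - (f p (nabla (\<lambda>q. f q (X q)) Y p) - f p (nabla Y (\<lambda>q. f q (X q)) p))
      - (f p (nabla X (\<lambda>q. f q (Y q)) p) - f p (nabla (\<lambda>q. f q (Y q)) X p))"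
    unfolding nijenhuis_def torsion_free[OF X Y p] torsion_free[OF fX fY p] torsion_free[OF fX Y p]
      torsion_free[OF X fY p] using t by (simp add: f_diff f_in)
  ultimately have "g p (f p (f p (nabla X Y p))) (Z p) - g p (f p (f p (nabla Y X p))) (Z p)
      + (g p (nabla (\<lambda>q. f q (X q)) (\<lambda>q. f q (Y q)) p) (Z p) - g p (nabla (\<lambda>q. f q (Y q)) (\<lambda>q. f q (X q)) p) (Z p))
      - (g p (f p (nabla (\<lambda>q. f q (X q)) Y p)) (Z p) - g p (f p (nabla Y (\<lambda>q. f q (X q)) p)) (Z p))
      - (g p (f p (nabla X (\<lambda>q. f q (Y q)) p)) (Z p) - g p (f p (nabla (\<lambda>q. f q (Y q)) X p)) (Z p))
      = - 2 * (g p (X p) (f p (Y p)) * eta_sum p (Z p))"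
    using t tZ by (simp add: I.left I.closed f_in)
  then show ?thesis
    using g_f[OF t(5) tZ] g_f[OF t(6) tZ] g_f[OF t(7) tZ] g_f[OF t(8) tZ]
      g_f[OF t(1) f_in[OF tZ]] g_f[OF f_in[OF t(1)] tZ] g_f[OF t(2) f_in[OF tZ]] g_f[OF f_in[OF t(2)] tZ]
    by (simp add: nabla_f_def)
qed

text \<open>Since \<open>f\<close> kills \<open>\<xi> \<alpha>\<close>, only -f \<nabla>_X \<xi> = f
  f X survives. This covers the direction that the image of \<open>f\<close> misses.\<close>

lemma nabla_f_xi:
  assumes X: "smooth_vf A W X" and Y: "smooth_vf A W Y" and p: "p \<in> W" and \<alpha>: "\<alpha> \<in> {1..s}"
  shows "nabla_f X (\<xi> \<alpha>) Y p = \<sigma> p (X p) (\<xi> \<alpha> p) (Y p)"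
proof -
  note t = smooth_vf_tangent[OF X p] smooth_vf_tangent[OF Y p]
  have "nabla X (\<lambda>q. 0) p = 0"
    using nabla_cscale_right[OF X X p, of 0] by simp
  then show ?thesis
    using t f_in[OF t(1)] f_in[OF t(2)] \<alpha>
    by (simp add: nabla_f_def \<sigma>_def nabla_xi[OF X p \<alpha>] eta_sum_xi I.left I.right)
qed

text \<open>\<open>\<sigma>\<close> satisfies the same inhomogeneous relations as
  \<open>nabla_f\<close>, so the difference \<open>D\<close> satisfies the homogeneous ones of
  \<open>f_trilinear_vanishes\<close>. That settles last arguments in the image of \<open>f\<close>;
  structure fields follow from skewness and \<open>nabla_f_xi\<close>. Using fields in place of
  tangent vectors avoids proving that \<open>D\<close> is tensorial in \<open>X\<close> and
  \<open>Y\<close>.\<close>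

lemma nabla_f_eq:
  assumes X: "smooth_vf A W X" and Y: "smooth_vf A W Y" and Z: "smooth_vf A W Z" and p: "p \<in> W"
  shows "nabla_f X Y Z p = \<sigma> p (X p) (Y p) (Z p)"
proof -
  define D where "D X Y Z = nabla_f X Y Z p - \<sigma> p (X p) (Y p) (Z p)" for X Y Z
  let ?S = "{X. smooth_vf A W X}" and ?F = "\<lambda>X q. f q (X q)"
  have t: "X p \<in> tangent_space A p" if "X \<in> ?S" for X
    using smooth_vf_tangent p that by blast
  have van: "D X Y (?F Z) = 0" if "smooth_vf A W Z" for Z
  proof (rule f_trilinear_vanishes[where S = ?S and F = ?F and D = D])
    fix x y z assume m: "x \<in> ?S" "y \<in> ?S" "z \<in> ?S"
    then have sm: "smooth_vf A W x" "smooth_vf A W y" "smooth_vf A W z" by simp_all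
    note tt = t[OF m(1)] t[OF m(2)] t[OF m(3)]
    show "D x y z = - D x z y"
      using nabla_f_skew[OF sm p] \<sigma>_skew[of p "x p" "y p" "z p"] by (simp add: D_def)
    show "D x y z + D y z x + D z x y = 0"
      using nabla_f_cyclic[OF sm p] I.sym[OF f_in[OF tt(1)] f_in[OF tt(2)]]
        I.sym[OF f_in[OF tt(1)] f_in[OF tt(3)]] I.sym[OF f_in[OF tt(2)] f_in[OF tt(3)]]
      by (simp add: D_def \<sigma>_def)
    show "D x (?F y) z = D x y (?F z)"
      using nabla_f_move[OF sm p] tt by (simp add: D_def \<sigma>_def eta_sum_f g_f_ff)
    show "D (?F x) y z - D (?F y) x z - D y x (?F z) + D x y (?F z) = 0"
      using nabla_f_normal[OF sm p] tt g_f_skew[OF tt(1,2)] g_f[OF tt(1,2)]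
      by (simp add: D_def \<sigma>_def eta_sum_f g_f_ff algebra_simps)
  qed (use X Y that smooth_f in auto)
  \<comment> \<open>\<open>D X Y Z\<close> as a linear functional of the value \<open>Z p\<close>,
    so that the splitting of \<open>Z p\<close> given by \<open>ff\<close> can be inserted.\<close>
  let ?\<Lambda> = "\<lambda>w. g p (nabla X (\<lambda>q. f q (Y q)) p) w + g p (nabla X Y p) (f p w) - \<sigma> p (X p) (Y p) w"
  have D: "D X Y U = ?\<Lambda> (U p)" for U by (simp add: D_def nabla_f_def)
  note tt = smooth_vf_tangent[OF X p] smooth_vf_tangent[OF Z p]
    smooth_vf_tangent[OF smooth_nabla[OF X Y] p] smooth_vf_tangent[OF smooth_nabla[OF X smooth_f[OF Y]] p]
  have lin: "lin_on (tangent_space A p) ?\<Lambda>"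
    unfolding lin_on_def \<sigma>_def using tt f_in[OF tt(1)]
    by (auto simp: I.right I.closed lin_onD[OF lin_eta_sum] lin_onD[OF f_lin] f_in algebra_simps)
  have xi0: "?\<Lambda> (\<xi> \<alpha> p) = 0" if \<alpha>: "\<alpha> \<in> {1..s}" for \<alpha>
  proof -
    note xi = smooth_xi[OF \<alpha> smooth_vf_openD[OF X]]
    have "D X Y (\<xi> \<alpha>) = 0"
      using nabla_f_skew[OF X Y xi p] nabla_f_xi[OF X Y p \<alpha>] \<sigma>_skew[of p "X p" "Y p" "\<xi> \<alpha> p"]
      by (simp add: D_def)
    then show ?thesis by (simp add: D)
  qed
  have "Z p = (\<Sum>\<alpha>=1..s. g p (Z p) (\<xi> \<alpha> p) *\<^sub>R \<xi> \<alpha> p) - f p (f p (Z p))"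
    using ff[OF tt(2)] by simp
  then have "?\<Lambda> (Z p) = ?\<Lambda> ((\<Sum>\<alpha>=1..s. g p (Z p) (\<xi> \<alpha> p) *\<^sub>R \<xi> \<alpha> p) - f p (f p (Z p)))"
    by simp
  also have "\<dots> = ?\<Lambda> (\<Sum>\<alpha>=1..s. g p (Z p) (\<xi> \<alpha> p) *\<^sub>R \<xi> \<alpha> p) - ?\<Lambda> (f p (f p (Z p)))"
    by (rule lin_on_diff[OF lin subspace_sum[OF subspace_tangent_space] f_in[OF f_in[OF tt(2)]]])
      (simp add: I.closed xi_in)
  also have "?\<Lambda> (\<Sum>\<alpha>=1..s. g p (Z p) (\<xi> \<alpha> p) *\<^sub>R \<xi> \<alpha> p) = (\<Sum>\<alpha>=1..s. ?\<Lambda> (g p (Z p) (\<xi> \<alpha> p) *\<^sub>R \<xi> \<alpha> p))"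
    by (rule lin_on_sum[OF lin subspace_tangent_space]) (simp add: I.closed xi_in)
  also have "\<dots> = 0"
  proof (rule sum.neutral, rule ballI)
    fix \<alpha> assume \<alpha>: "\<alpha> \<in> {1..s}"
    let ?c = "g p (Z p) (\<xi> \<alpha> p)"
    have "?\<Lambda> (?c *\<^sub>R \<xi> \<alpha> p) = ?c *\<^sub>R ?\<Lambda> (\<xi> \<alpha> p)" by (rule lin_on_scale[OF lin xi_in[OF \<alpha>]])
    then show "?\<Lambda> (?c *\<^sub>R \<xi> \<alpha> p) = 0" unfolding xi0[OF \<alpha>] by simp
  qed
  also have "?\<Lambda> (f p (f p (Z p))) = 0"
    using van[OF smooth_f[OF Z]] D by simp
  finally have "D X Y Z = 0" using D[of Z] by simp
  then show ?thesis by (simp add: D_def)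
qed

section \<open>Curvature identities of S-manifolds\<close>

text \<open>Substituting \<nabla>\<xi> = -f in the curvature, the bracket term combines by vanishing
  torsion to (\<nabla>_Y f) X - (\<nabla>_X f) Y, and \<open>nabla_f_eq\<close> evaluates
  both.\<close>

lemma Rm_xi:
  assumes X: "smooth_vf A W X" and Y: "smooth_vf A W Y" and V: "smooth_vf A W V" and p: "p \<in> W"
    and \<alpha>: "\<alpha> \<in> {1..s}"
  shows "Rm X Y (\<xi> \<alpha>) V p = eta_sum p (Y p) * g p (f p (X p)) (f p (V p))
    - eta_sum p (X p) * g p (f p (Y p)) (f p (V p))"
proof -
  note xi = smooth_xi[OF \<alpha> smooth_vf_openD[OF X]]
  note t = smooth_vf_tangent[OF X p] smooth_vf_tangent[OF Y p] smooth_vf_tangent[OF V p]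
    smooth_vf_tangent[OF smooth_nabla[OF X Y] p] smooth_vf_tangent[OF smooth_nabla[OF Y X] p]
  have N: "nabla X (nabla Y (\<xi> \<alpha>)) p = - nabla X (\<lambda>q. f q (Y q)) p"
    if X: "smooth_vf A W X" and Y: "smooth_vf A W Y" for X Y
  proof -
    have "nabla X (nabla Y (\<xi> \<alpha>)) p = nabla X (\<lambda>q. (-1) *\<^sub>R f q (Y q)) p"
      by (rule nabla_cong[OF X X smooth_nabla[OF Y xi] smooth_vf_cscale[OF atlas smooth_f[OF Y]] refl _ p])
        (simp add: nabla_xi[OF Y _ \<alpha>])
    then show ?thesis using nabla_cscale_right[OF X smooth_f[OF Y] p, of "-1"] by simp
  qed
  have "nabla (lie A X Y) (\<xi> \<alpha>) p = f p (nabla Y X p) - f p (nabla X Y p)"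
    using nabla_xi[OF smooth_lie[OF X Y] p \<alpha>] torsion_free[OF X Y p] t by (simp add: f_diff)
  then have "Rm X Y (\<xi> \<alpha>) V p = nabla_f Y X V p - nabla_f X Y V p"
    using Rm_expand[OF X Y xi V p] N[OF X Y] N[OF Y X] t g_f[OF t(4,3)] g_f[OF t(5,3)]
      smooth_vf_tangent[OF smooth_nabla[OF X smooth_f[OF Y]] p]
      smooth_vf_tangent[OF smooth_nabla[OF Y smooth_f[OF X]] p]
    by (simp add: nabla_f_def I.left f_in)
  then show ?thesis
    using nabla_f_eq[OF X Y V p] nabla_f_eq[OF Y X V p] I.sym[OF f_in[OF t(1)] f_in[OF t(2)]]
    by (simp add: \<sigma>_def)
qed

text \<open>The equation \<open>nabla_f_eq\<close> for \<open>Y\<close>, \<open>Z\<close>,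
  \<open>V\<close> is differentiated along \<open>X\<close>; the surviving products of first
  covariant derivatives regroup into two more of its instances.\<close>

lemma nabla_nabla_f:
  assumes X: "smooth_vf A W X" and Y: "smooth_vf A W Y" and Z: "smooth_vf A W Z" and V: "smooth_vf A W V"
    and p: "p \<in> W"
  shows "g p (nabla X (nabla Y (\<lambda>q. f q (Z q))) p) (V p) + g p (nabla X (nabla Y Z) p) (f p (V p)) =
    \<sigma> p (X p) (nabla Y Z p) (V p) + act (X p) (\<lambda>q. \<sigma> q (Y q) (Z q) (V q))
    - \<sigma> p (Y p) (Z p) (nabla X V p)"
proof -
  note P = smooth_nabla[OF Y smooth_f[OF Z]] and Q = smooth_nabla[OF Y Z] and fV = smooth_f[OF V]
  note tX = smooth_vf_tangent[OF X p]
  have "act (X p) (\<lambda>q. \<sigma> q (Y q) (Z q) (V q)) =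
      act (X p) (\<lambda>q. g q (nabla Y (\<lambda>q. f q (Z q)) q) (V q) + g q (nabla Y Z q) (f q (V q)))"
    by (rule act_cong[OF atlas tX smooth_vf_openD[OF X] p])
      (simp add: nabla_f_eq[OF Y Z V, symmetric] nabla_f_def)
  also have "\<dots> = act (X p) (\<lambda>q. g q (nabla Y (\<lambda>q. f q (Z q)) q) (V q))
      + act (X p) (\<lambda>q. g q (nabla Y Z q) (f q (V q)))"
    by (rule act_add[OF tX smooth_nearI[OF smooth_metric[OF P V] p] smooth_nearI[OF smooth_metric[OF Q fV] p]])
  finally have "act (X p) (\<lambda>q. \<sigma> q (Y q) (Z q) (V q)) =
      g p (nabla X (nabla Y (\<lambda>q. f q (Z q))) p) (V p) + g p (nabla Y (\<lambda>q. f q (Z q)) p) (nabla X V p)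
      + (g p (nabla X (nabla Y Z) p) (f p (V p)) + g p (nabla Y Z p) (nabla X (\<lambda>q. f q (V q)) p))"
    by (simp only: metric_compatible[OF X P V p] metric_compatible[OF X Q fV p])
  moreover note nabla_f_eq[OF Y Z smooth_nabla[OF X V] p, unfolded nabla_f_def]
    nabla_f_eq[OF X V Q p, unfolded nabla_f_def]
  moreover have "g p (nabla Y Z p) (nabla X (\<lambda>q. f q (V q)) p) = g p (nabla X (\<lambda>q. f q (V q)) p) (nabla Y Z p)"
    by (rule I.sym[OF smooth_vf_tangent[OF Q p] smooth_vf_tangent[OF smooth_nabla[OF X fV] p]])
  moreover have "g p (nabla X V p) (f p (nabla Y Z p)) = - g p (nabla Y Z p) (f p (nabla X V p))"
    using g_f[OF smooth_vf_tangent[OF smooth_nabla[OF X V] p] smooth_vf_tangent[OF Q p]]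
      I.sym[OF f_in[OF smooth_vf_tangent[OF smooth_nabla[OF X V] p]] smooth_vf_tangent[OF Q p]] by simp
  ultimately show ?thesis
    using \<sigma>_skew[of p "X p" "V p" "nabla Y Z p"] by linarith
qed

text \<open>\<open>Z\<close> and \<open>V\<close> are orthogonal to \<Sum> \<xi> only at
  \<open>p\<close>, so derivatives of \<open>eta_sum\<close> remain and bring in \<open>s\<close>.
  The two terms with \<open>eta_sum\<close> of a covariant derivative are exchanged by swapping
  \<open>X\<close> and \<open>Y\<close>, hence drop out of \<open>Rm_f\<close>.\<close>

lemma nabla_nabla_f_horizontal:
  assumes X: "smooth_vf A W X" and Y: "smooth_vf A W Y" and Z: "smooth_vf A W Z" and V: "smooth_vf A W V"
    and p: "p \<in> W" and hZ: "eta_sum p (Z p) = 0" and hV: "eta_sum p (V p) = 0"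
  shows "g p (nabla X (nabla Y (\<lambda>q. f q (Z q))) p) (V p) + g p (nabla X (nabla Y Z) p) (f p (V p)) =
    - eta_sum p (nabla Y Z p) * g p (f p (X p)) (f p (V p)) - eta_sum p (nabla X Z p) * g p (f p (Y p)) (f p (V p))
    - real s * (g p (f p (Y p)) (f p (Z p)) * g p (f p (X p)) (V p)
      - g p (f p (X p)) (Z p) * g p (f p (Y p)) (f p (V p)))"
proof -
  note tX = smooth_vf_tangent[OF X p]
  have s: "smooth_fun A W (\<lambda>q. g q (f q (Y q)) (f q (U q)))" if "smooth_vf A W U" for U
    by (rule smooth_metric[OF smooth_f[OF Y] smooth_f[OF that]])
  note near = smooth_nearI[OF s[OF Z] p] smooth_nearI[OF s[OF V] p]
    smooth_nearI[OF smooth_eta_sum[OF Z] p] smooth_nearI[OF smooth_eta_sum[OF V] p]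
  have "act (X p) (\<lambda>q. \<sigma> q (Y q) (Z q) (V q)) =
      act (X p) (\<lambda>q. g q (f q (Y q)) (f q (Z q)) * eta_sum q (V q))
      - act (X p) (\<lambda>q. eta_sum q (Z q) * g q (f q (Y q)) (f q (V q)))"
    unfolding \<sigma>_def
    by (rule act_diff[OF tX smooth_near_mult[OF atlas near(1,4)] smooth_near_mult[OF atlas near(3,2)]])
  also have "\<dots> = g p (f p (Y p)) (f p (Z p)) * (eta_sum p (nabla X V p) - real s * g p (V p) (f p (X p)))
      - g p (f p (Y p)) (f p (V p)) * (eta_sum p (nabla X Z p) - real s * g p (Z p) (f p (X p)))"
    using act_mult[OF tX near(1,4)] act_mult[OF tX near(3,2)] act_eta_sum[OF X V p] act_eta_sum[OF X Z p]
    by (simp add: hZ hV)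
  finally show ?thesis
    using nabla_nabla_f[OF X Y Z V p] I.sym[OF smooth_vf_tangent[OF V p] f_in[OF tX]]
      I.sym[OF smooth_vf_tangent[OF Z p] f_in[OF tX]]
    by (simp add: \<sigma>_def hZ hV algebra_simps)
qed

text \<open>The left-hand side pairs the commutator of R(X, Y) and f with \<open>V\<close>, that is,
  the skew part of the second derivative of f. The bracket term is zero because
  \<open>\<sigma>\<close> vanishes when \<open>eta_sum\<close> is 0 on its last two
  arguments.\<close>

lemma Rm_f:
  assumes X: "smooth_vf A W X" and Y: "smooth_vf A W Y" and Z: "smooth_vf A W Z" and V: "smooth_vf A W V"
    and p: "p \<in> W" and hZ: "eta_sum p (Z p) = 0" and hV: "eta_sum p (V p) = 0"
  shows "Rm X Y (\<lambda>q. f q (Z q)) V p + Rm X Y Z (\<lambda>q. f q (V q)) p =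
    - real s * (g p (f p (Y p)) (f p (Z p)) * g p (f p (X p)) (V p)
      - g p (f p (X p)) (f p (Z p)) * g p (f p (Y p)) (V p)
      - g p (f p (X p)) (Z p) * g p (f p (Y p)) (f p (V p))
      + g p (f p (Y p)) (Z p) * g p (f p (X p)) (f p (V p)))"
proof -
  have "g p (nabla (lie A X Y) (\<lambda>q. f q (Z q)) p) (V p) + g p (nabla (lie A X Y) Z p) (f p (V p)) = 0"
    using nabla_f_eq[OF smooth_lie[OF X Y] Z V p] by (simp add: nabla_f_def \<sigma>_def hZ hV)
  then show ?thesis
    using Rm_expand[OF X Y smooth_f[OF Z] V p] Rm_expand[OF X Y Z smooth_f[OF V] p]
      nabla_nabla_f_horizontal[OF X Y Z V p hZ hV] nabla_nabla_f_horizontal[OF Y X Z V p hZ hV]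
    by (simp add: algebra_simps)
qed

lemma s_curvature_Riem:
  assumes hol: "\<forall>u\<in>distL A s \<xi> g p. g p u u = 1 \<longrightarrow> sec_curv A g nabla p u (f p u) = c"
  shows "s_curvature (tangent_space A p) (g p) (Riem A g nabla p) (f p) (\<lambda>\<alpha>. \<xi> \<alpha> p) s c"
proof -
  let ?T = "tangent_space A p" and ?e = "ext A p"
  have fields: "\<exists>W. p \<in> W \<and> smooth_vf A W (?e u) \<and> smooth_vf A W (?e v) \<and> smooth_vf A W (?e w) \<and>
      smooth_vf A W (?e z)" if "u \<in> ?T" "v \<in> ?T" "w \<in> ?T" "z \<in> ?T" for u v w z
  proof -
    have "finite {u, v, w, z}" "{u, v, w, z} \<subseteq> ?T" using that by simp_all
    from vector_fields_exist[OF atlas this] show ?thesis by simp blast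
  qed
  note e = ext_extends(2)[OF atlas]
  interpret C: curvature_tensor ?T "Riem A g nabla p" by (rule curvature_tensor_Riem)
  show ?thesis
  proof (unfold_locales, goal_cases)
    case (1 u) then show ?case by (rule f_in)
  next
    case 2 show ?case by (rule f_lin)
  next
    case (3 \<alpha>) then show ?case by (rule xi_in)
  next
    case (4 \<alpha> \<beta>) then show ?case by (rule xi_orthonormal)
  next
    case (5 u) then show ?case by (rule ff)
  next
    case (6 u v) then show ?case by (rule g_ff)
  next
    case (7 u v) then show ?case by (rule g_f)
  next
    case (8 \<alpha>) then show ?case by (rule f_xi)
  next
    case (9 u v w \<alpha>)
    from fields[OF 9(1-3) 9(3)] obtain W where W: "p \<in> W" "smooth_vf A W (?e u)" "smooth_vf A W (?e v)"
      "smooth_vf A W (?e w)" by blast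
    show ?case
      using Rm_xi[OF W(2-4,1) 9(4)]
        Riem_eq_Rm[OF W(2,3) smooth_xi[OF 9(4) smooth_vf_openD[OF W(2)]] W(4,1)] 9(1-3)
      by (simp add: e eta_sum_def)
  next
    case (10 u v w z)
    then have t: "u \<in> ?T" "v \<in> ?T" "w \<in> ?T" "z \<in> ?T" by simp_all
    from fields[OF t] obtain W where W: "p \<in> W" "smooth_vf A W (?e u)" "smooth_vf A W (?e v)"
      "smooth_vf A W (?e w)" "smooth_vf A W (?e z)" by blast
    have h: "eta_sum p (?e w p) = 0" "eta_sum p (?e z p) = 0"
      using 10 t by (simp_all add: eta_sum_def e)
    have gff: "g p (f p a) (f p b) = g p a b" if "a \<in> {u, v}" "b \<in> {w, z}" for a b
      using g_ff[of a p b] that 10 t by auto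
    show ?case
      using Rm_f[OF W(2-5,1) h] Riem_eq_Rm[OF W(2,3) smooth_f[OF W(4)] W(5,1)]
        Riem_eq_Rm[OF W(2,3,4) smooth_f[OF W(5)] W(1)] t
      by (simp add: e gff algebra_simps)
  next
    case (11 u)
    then have t: "u \<in> ?T" by simp
    \<comment> \<open>\<open>distL\<close> asks for orthogonality to the whole span, the locale only
      to the structure vectors themselves.\<close>
    have "span {\<xi> \<alpha> p |\<alpha>. \<alpha> \<in> {1..s}} \<subseteq> {w \<in> ?T. g p u w = 0}"
      using 11 t xi_in by (intro span_minimal subspaceI) (auto simp: I.closed I.right)
    then have "u \<in> distL A s \<xi> g p" using t by (auto simp: distL_def)
    then show ?case using hol 11(2) by (simp add: sec_curv_def)
  qed
qed

end

theorem mainTheorem3: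
  fixes A :: "('a::{t2_space,second_countable_topology}, 'e::euclidean_space) chart set"
    and n s :: nat
    and f :: "'a \<Rightarrow> 'a tvec \<Rightarrow> 'a tvec"
    and \<xi> :: "nat \<Rightarrow> 'a vfield"
    and \<eta> :: "nat \<Rightarrow> 'a \<Rightarrow> 'a tvec \<Rightarrow> real"
    and g :: "'a \<Rightarrow> 'a tvec \<Rightarrow> 'a tvec \<Rightarrow> real"
    and nabla :: "'a vfield \<Rightarrow> 'a vfield \<Rightarrow> 'a vfield"
    and c :: real
    and p :: 'a
  assumes "levi_civita A g nabla"
    and "S_space_form A n s f \<xi> \<eta> g nabla c"
  shows "scalar_curvature A g nabla p =
    real n * (real n - 1) * (c + 3 * real s) / 2 + real n * (c + 2 * real s)"
proof -
  have S: "S_manifold A n s f \<xi> \<eta> g"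
    and hol: "\<forall>u\<in>distL A s \<xi> g p. g p u u = 1 \<longrightarrow> sec_curv A g nabla p u (f p u) = c"
    using assms(2) by (auto simp: S_space_form_def)
  interpret M: s_manifold A g nabla n s f \<xi> \<eta>
    using S assms(1) by unfold_locales (auto simp: S_manifold_def metric_f_manifold_def)
  interpret K: s_curvature "tangent_space A p" "g p" "Riem A g nabla p" "f p" "\<lambda>\<alpha>. \<xi> \<alpha> p" s c
    by (rule M.s_curvature_Riem[OF hol])
  obtain B where B: "independent B" "span B = tangent_space A p" "finite B" "card B = DIM('e)"
    using tangent_space_basis[OF M.atlas] .
  have dim: "DIM('e) = 2 * n + s" by (rule M.dimension)
  have frame: "orthonormal_frame A g p e \<longleftrightarrow> inner_on.orthonormal (tangent_space A p) (g p) (2 * n + s) e" for e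
    unfolding orthonormal_frame_def M.I.orthonormal_def dim ..
  \<comment> \<open>A frame must exist: otherwise every \<open>t\<close> would meet the condition
    under \<open>THE\<close>, and uniqueness would fail.\<close>
  obtain e where e: "orthonormal_frame A g p e"
    using M.I.orthonormal_exists[OF B(1-3)] unfolding frame B(4) dim by blast
  have val: "(\<Sum>i=1..DIM('e). \<Sum>j=1..DIM('e). if i = j then 0 else sec_curv A g nabla p (e i) (e j)) / 2 =
      real n * (real n - 1) * (c + 3 * real s) / 2 + real n * (c + 2 * real s)"
    if "orthonormal_frame A g p e" for e
    using K.scalar_curvature[OF B(1-3) B(4)[unfolded dim] that[unfolded frame]]
    unfolding sec_curv_def dim .
  show ?thesis
    unfolding scalar_curvature_def
  proof (rule the_equality)
    show "\<forall>e. orthonormal_frame A g p e \<longrightarrow>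
        real n * (real n - 1) * (c + 3 * real s) / 2 + real n * (c + 2 * real s) =
        (\<Sum>i=1..DIM('e). \<Sum>j=1..DIM('e). if i = j then 0 else sec_curv A g nabla p (e i) (e j)) / 2"
      using val by simp
  next
    fix t assume t: "\<forall>e. orthonormal_frame A g p e \<longrightarrow>
        t = (\<Sum>i=1..DIM('e). \<Sum>j=1..DIM('e). if i = j then 0 else sec_curv A g nabla p (e i) (e j)) / 2"
    show "t = real n * (real n - 1) * (c + 3 * real s) / 2 + real n * (c + 2 * real s)"
      by (rule trans[OF t[rule_format, OF e] val[OF e]])
  qed
qed

end
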